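(* Let $m$ be a positive integer, let $\beta>0$, $0<\alpha\le 1$, $0<d<\pi/2$, and put $\mu=\min\{\alpha,\beta\}$. Let $\boldsymbol{y}=(y_1,\dots,y_m)^{\mathrm T}$ be the solution of the initial value problem $$\boldsymbol{y}'(t)=K(t)\boldsymbol{y}(t)+\boldsymbol{g}(t)\quad (t\ge 0),\qquad \boldsymbol{y}(0)=\boldsymbol{r},$$ where $K(t)=(k_{ij}(t))$ is an $m\times m$ matrix, and $\boldsymbol{g}(t)=(g_1(t),\dots,g_m(t))^{\mathrm T}$ and $\boldsymbol{r}=(r_1,\dots,r_m)^{\mathrm T}$ are $m$-dimensional vectors. Assume: (1) each $k_{ij}$ $(i,j=1,\dots,m)$ is analytic and bounded on $\phi(\mathscr{D}_d)$; (2) each of the functions $f=y_i$ and $f=g_i$ $(i=1,\dots,m)$ is analytic in $\phi(\mathscr{D}_d)$ and there is a positive constant $C_{\ddagger}$ such that $|f(z)|\le C_{\ddagger}\left|\frac{z}{1+z}\right|^{\alpha-1}|e^{-z}|^{\beta}$ for all $z\in\phi(\mathscr{D}_d)$; (3) there exists a positive constant $H$ such that, for all $z\in\phi(\mathscr{D}_d)$, $$\max_{1\le i\le m}|y_i(z)-r_i|\le H|z|^{\alpha},\qquad \max_{1\le i\le m}|y_i(z)|\le H|e^{-z}|^{\beta}.$$ For a positive integer $n$, let $h=\operatorname{arsinh}(dn/\mu)/n$, let $M=n$, $N=\left\lceil\frac1h\operatorname{arsinh}\left(\frac{\alpha}{\beta}\sinh(nh)\right)\right\rceil$ if $\mu=\alpha$,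 and $N=n$, $M=\left\lceil\frac1h\operatorname{arsinh}\left(\frac{\beta}{\alpha}\sinh(nh)\right)\right\rceil$ if $\mu=\beta$, and let $l=M+N+1$. Let $B_{lm}$ be the coefficient matrix and $\hat{\boldsymbol{y}}^{(l)}=(\hat y^{(l)}_1,\dots,\hat y^{(l)}_m)^{\mathrm T}$ the approximate solution of the DE-Sinc-collocation method, as defined in the context, and assume that $B_{lm}$ is invertible. Then $$\max_{1\le i\le m}\left\{\sup_{t\in(0,\infty)}\left|y_i(t)-\hat{y}^{(l)}_i(t)\right|\right\}\le\left(C+\hat{C}\,\|B_{lm}^{-1}\|_{\infty}\right)\operatorname{arsinh}(dn/\mu)\,\log(n+1)\,e^{-\pi dn/\operatorname{arsinh}(dn/\mu)},$$ where $C$ and $\hat{C}$ are positive constants independent of $n$.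
   Context: For $d>0$, $\mathscr{D}_d=\{\zeta\in\mathbb{C}:|\operatorname{Im}\zeta|<d\}$. The DE transformation is $\phi(\zeta)=\log(1+e^{\pi\sinh\zeta})$, where the logarithm is taken so that $\phi$ is analytic on $\mathscr{D}_{\pi/2}$ and real on $\mathbb{R}$; $\phi$ maps $\mathbb{R}$ bijectively onto $(0,\infty)$, $\phi^{-1}:(0,\infty)\to\mathbb{R}$ denotes the inverse of $\phi|_{\mathbb{R}}$, and $\phi(\mathscr{D}_d)=\{\phi(\zeta):\zeta\in\mathscr{D}_d\}$. The Sinc function is $S(j,h)(x)=\frac{\sin[\pi(x-jh)/h]}{\pi(x-jh)/h}$ (equal to $1$ at $x=jh$), and $\operatorname{Si}(x)=\int_0^x\frac{\sin t}{t}\,dt$. The expression $|z/(1+z)|^{\alpha-1}$ is read as $|(1+z)/z|^{1-\alpha}$. Linear system. Let $I_m, I_l$ be identity matrices and $\otimes$ the Kronecker product. With indices $i,j=-M,-M+1,\dots,N$, let $I_l^{(-1)}$ be the $l\times l$ matrix with entries $(I_l^{(-1)})_{ij}=\frac12+\frac1\pi\operatorname{Si}(\pi(i-j))$, and let $D_l^{(\phi)}=\operatorname{diag}[\phi'(-Mh),\dots,\phi'(Nh)]$. For $i,j=1,\dots,m$ let $K_{ij}^{(\phi)}=\operatorname{diag}[k_{ij}(\phi(-Mh)),\dots,k_{ij}(\phi(Nh))]$, and let $[K_{ij}^{(\phi)}]$ be the $m\times m$ block matrix with blocks $K_{ij}^{(\phi)}$. The $lm\times lm$ coefficient matrix is $$B_{lm}=I_m\otimes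 I_l-\{I_m\otimes(hI_l^{(-1)}D_l^{(\phi)})\}[K_{ij}^{(\phi)}].$$ Let $\boldsymbol{R}\in\mathbb{C}^{lm}$ consist of $l$ copies of $r_1$, then $l$ copies of $r_2$, ..., then $l$ copies of $r_m$; let $\boldsymbol{G}^{(\phi)}$ consist of $g_1(\phi(-Mh)),\dots,g_1(\phi(Nh)),\dots,g_m(\phi(-Mh)),\dots,g_m(\phi(Nh))$. When $B_{lm}$ is invertible, the values $\boldsymbol{y}^{(l)}(\phi(jh))=(y^{(l)}_1(\phi(jh)),\dots,y^{(l)}_m(\phi(jh)))^{\mathrm T}$, $j=-M,\dots,N$, are defined as the components of the solution $$\boldsymbol{Y}^{(\phi)}=[y^{(l)}_1(\phi(-Mh)),\dots,y^{(l)}_1(\phi(Nh)),\dots,y^{(l)}_m(\phi(-Mh)),\dots,y^{(l)}_m(\phi(Nh))]^{\mathrm T}$$ of $B_{lm}\boldsymbol{Y}^{(\phi)}=\boldsymbol{R}+\{I_m\otimes(hI_l^{(-1)}D_l^{(\phi)})\}\boldsymbol{G}^{(\phi)}$. DE-Sinc-collocation approximate solution. Put $$\boldsymbol{p}^{(\phi)}=\boldsymbol{r}+h\sum_{j=-M}^N\{K(\phi(jh))\boldsymbol{y}^{(l)}(\phi(jh))+\boldsymbol{g}(\phi(jh))\}\phi'(jh),$$ $$\hat{\boldsymbol{y}}^{(l)}(t)=\frac{\boldsymbol{r}+\boldsymbol{p}^{(\phi)}(e^t-1)}{e^t}+\sum_{k=-M}^N\left\{\boldsymbol{y}^{(l)}(\phi(kh))-\frac{\boldsymbol{r}+\boldsymbol{p}^{(\phi)}e^{\pi\sinh(kh)}}{1+e^{\pi\sinh(kh)}}\right\}S(k,h)(\phi^{-1}(t)),\quad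 t\in(0,\infty).$$ $\|\cdot\|_\infty$ is the matrix norm induced by the maximum norm. *)

theory Defs
  imports
    "HOL-Complex_Analysis.Complex_Analysis"
    "HOL-Probability.Sinc_Integral"
    "Jordan_Normal_Form.Matrix"
    "Jordan_Normal_Form.Gauss_Jordan_Elimination"
begin

section \<open>The double-exponential transformation\<close>

definition strip :: "real \<Rightarrow> complex set" where
  "strip d = {\<zeta>. \<bar>Im \<zeta>\<bar> < d}"

text \<open>
  The branch of \<open>log (1 + exp (\<pi> sinh \<zeta>))\<close> that is analytic on the strip of half-width \<open>\<pi>/2\<close>
  and real on the real line. The principal logarithm \<^const>\<open>Ln\<close> would not do: \<open>1 + exp (\<pi> sinh \<zeta>)\<close>
  takes negative real values on this strip.
\<close>

definition is_de_branch :: "(complex \<Rightarrow> complex) \<Rightarrow> bool" where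
  "is_de_branch f \<longleftrightarrow>
     f holomorphic_on strip (pi / 2) \<and>
     (\<forall>\<zeta>\<in>strip (pi / 2). exp (f \<zeta>) = 1 + exp (of_real pi * sinh \<zeta>)) \<and>
     (\<forall>x::real. f (of_real x) \<in> \<real>)"

definition de_phi :: "complex \<Rightarrow> complex" where
  "de_phi = (SOME f. is_de_branch f)"

lemma strip_eq: "strip d = {\<zeta>. Im \<zeta> < d} \<inter> {\<zeta>. Im \<zeta> > - d}"
  by (auto simp: strip_def)

lemma open_strip: "open (strip d)"
  unfolding strip_eq by (intro open_Int open_halfspace_Im_lt open_halfspace_Im_gt)

lemma convex_strip: "convex (strip d)"
  unfolding strip_eq by (intro convex_Int convex_halfspace_Im_lt convex_halfspace_Im_gt)

lemma Re_sinh: "Re (sinh z) = sinh (Re z) * cos (Im z)"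
  by (simp add: sinh_field_def Re_divide_numeral Re_exp cos_minus field_simps)

lemma Im_sinh: "Im (sinh z) = cosh (Re z) * sin (Im z)"
  by (simp add: sinh_field_def cosh_field_def Im_divide_numeral Im_exp field_simps)

lemma one_plus_exp_sinh_nonzero:
  assumes "\<zeta> \<in> strip (pi / 2)"
  shows "1 + exp (of_real pi * sinh \<zeta>) \<noteq> 0"
proof
  assume "1 + exp (of_real pi * sinh \<zeta>) = 0"
  hence e: "exp (of_real pi * sinh \<zeta>) = -1"
    by (simp add: add_eq_0_iff)
  have y: "\<bar>Im \<zeta>\<bar> < pi / 2" using assms by (simp add: strip_def)
  hence c: "cos (Im \<zeta>) > 0" by (intro cos_gt_zero_pi) auto
  have "norm (exp (of_real pi * sinh \<zeta>)) = 1" using e by simp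
  hence "Re (sinh \<zeta>) = 0" by simp
  hence "Re \<zeta> = 0" using c by (simp add: Re_sinh)
  hence im: "Im (sinh \<zeta>) = sin (Im \<zeta>)" by (simp add: Im_sinh)
  have "Re (exp (of_real pi * sinh \<zeta>)) = cos (pi * sin (Im \<zeta>))"
    using \<open>Re (sinh \<zeta>) = 0\<close> im by (simp add: Re_exp)
  hence cos: "cos \<bar>pi * sin (Im \<zeta>)\<bar> = -1" using e by (simp add: cos_abs_real)
  have "\<bar>sin (Im \<zeta>)\<bar> < 1"
  proof -
    have "(sin (Im \<zeta>))\<^sup>2 = 1 - (cos (Im \<zeta>))\<^sup>2" by (simp add: sin_squared_eq)
    also have "\<dots> < 1" using c by simp
    finally show ?thesis by (simp add: abs_square_less_1)
  qed
  hence "\<bar>pi * sin (Im \<zeta>)\<bar> < pi" by (simp add: abs_mult)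
  hence "cos \<bar>pi * sin (Im \<zeta>)\<bar> > cos pi" by (intro cos_monotone_0_pi) auto
  thus False using cos by simp
qed

lemma one_plus_exp_sinh_of_real:
  "1 + exp (of_real pi * sinh (of_real x)) = complex_of_real (1 + exp (pi * sinh x))"
proof -
  have "complex_of_real pi * sinh (of_real x) = of_real (pi * sinh x)"
    by (intro complex_eqI) (simp_all add: Re_sinh Im_sinh)
  then show ?thesis by (simp only: exp_of_real of_real_add of_real_1)
qed

lemma is_de_branch_exists: "\<exists>f. is_de_branch f"
proof -
  let ?S = "strip (pi / 2)"
  let ?E = "\<lambda>\<zeta>::complex. 1 + exp (of_real pi * sinh \<zeta>)"
  have real_in: "complex_of_real x \<in> ?S" for x by (simp add: strip_def)
  have "?E holomorphic_on ?S"
    unfolding sinh_field_def by (intro holomorphic_intros) auto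
  then obtain f where f: "f holomorphic_on ?S" "\<And>\<zeta>. \<zeta> \<in> ?S \<Longrightarrow> exp (f \<zeta>) = ?E \<zeta>"
    by (rule holomorphic_logarithm_exists[OF convex_strip open_strip _ _ real_in[of 0]])
       (use one_plus_exp_sinh_nonzero in auto)
  define c where "c = f 0 - of_real (ln 2)"
  have ec: "exp c = 1"
    using f(2)[OF real_in[of 0]] by (simp add: c_def exp_diff exp_of_real)
  define F where "F = (\<lambda>\<zeta>. f \<zeta> - c)"
  have hol: "F holomorphic_on ?S"
    unfolding F_def by (intro holomorphic_intros f)
  have eF: "exp (F \<zeta>) = ?E \<zeta>" if "\<zeta> \<in> ?S" for \<zeta>
    using f(2)[OF that] ec by (simp add: F_def exp_diff)
  have per: "\<exists>n::int. Im (F (of_real x)) = 2 * pi * n" for x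
  proof -
    have "exp (F (of_real x)) = of_real (1 + exp (pi * sinh x))"
      using eF[OF real_in[of x]] by (simp only: one_plus_exp_sinh_of_real)
    moreover have "1 + exp (pi * sinh x) > 0" by (simp add: add_pos_pos)
    ultimately have "exp (F (of_real x)) = exp (of_real (ln (1 + exp (pi * sinh x))))"
      by (simp add: exp_of_real)
    then show ?thesis unfolding exp_eq by auto
  qed
  have cont: "continuous_on UNIV (\<lambda>x::real. Im (F (of_real x)))"
    by (intro continuous_intros continuous_on_compose2[OF holomorphic_on_imp_continuous_on[OF hol]])
       (auto simp: real_in)
  have disc: "\<exists>e>0. \<forall>y. y \<in> (UNIV::real set) \<and> Im (F (of_real y)) \<noteq> Im (F (of_real x))
      \<longrightarrow> e \<le> norm (Im (F (of_real y)) - Im (F (of_real x)))" for x :: real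
  proof (intro exI[of _ "2 * pi"] conjI allI impI)
    fix y assume ne: "y \<in> (UNIV::real set) \<and> Im (F (of_real y)) \<noteq> Im (F (of_real x))"
    obtain n k :: int where nk: "Im (F (of_real x)) = 2 * pi * n" "Im (F (of_real y)) = 2 * pi * k"
      using per by meson
    have "1 \<le> \<bar>k - n\<bar>" using ne nk by auto
    hence "1 \<le> \<bar>real_of_int (k - n)\<bar>" by linarith
    hence "2 * pi * 1 \<le> 2 * pi * \<bar>real_of_int (k - n)\<bar>" by (intro mult_left_mono) auto
    thus "2 * pi \<le> norm (Im (F (of_real y)) - Im (F (of_real x)))"
      by (simp add: nk right_diff_distrib[symmetric] abs_mult)
  qed simp
  have "(\<lambda>x::real. Im (F (of_real x))) constant_on UNIV"
    using continuous_discrete_range_constant[OF connected_UNIV cont] disc by blast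
  hence "Im (F (of_real x)) = Im (F (of_real 0))" for x :: real
    unfolding constant_on_def by (metis UNIV_I)
  moreover have "Im (F (of_real 0)) = 0"
    by (simp add: F_def c_def)
  ultimately have "F (of_real x) \<in> \<real>" for x :: real
    by (simp add: complex_is_Real_iff)
  with hol eF have "is_de_branch F" unfolding is_de_branch_def by blast
  thus ?thesis by blast
qed

lemma is_de_branch_de_phi: "is_de_branch de_phi"
  unfolding de_phi_def using is_de_branch_exists by (rule someI_ex)

lemma de_phi_of_real: "de_phi (of_real x) = of_real (ln (1 + exp (pi * sinh x)))"
proof -
  have re: "de_phi (of_real x) \<in> \<real>" and
    e: "exp (de_phi (of_real x)) = 1 + exp (of_real pi * sinh (of_real x))"
    using is_de_branch_de_phi by (auto simp: is_de_branch_def strip_def)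
  from re obtain u where u: "de_phi (of_real x) = of_real u" by (auto elim: Reals_cases)
  have "complex_of_real (exp u) = of_real (1 + exp (pi * sinh x))"
    using e by (simp only: u exp_of_real one_plus_exp_sinh_of_real)
  hence "exp u = 1 + exp (pi * sinh x)" by (simp only: of_real_eq_iff)
  hence "u = ln (1 + exp (pi * sinh x))" by (metis ln_exp)
  thus ?thesis by (simp add: u)
qed

definition de_phi_real :: "real \<Rightarrow> real" where
  "de_phi_real x = Re (de_phi (of_real x))"

definition de_phi_inv :: "real \<Rightarrow> real" where
  "de_phi_inv t = the_inv_into UNIV de_phi_real t"

lemma de_phi_real_eq: "de_phi_real x = ln (1 + exp (pi * sinh x))"
  by (simp add: de_phi_real_def de_phi_of_real)

lemma bij_betw_de_phi_real: "bij_betw de_phi_real UNIV {0<..}"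
  unfolding bij_betw_def
proof (intro conjI Set.set_eqI iffI)
  have pos: "1 + exp (pi * sinh x) > 0" for x :: real by (simp add: add_pos_pos)
  show "inj de_phi_real"
    using pos by (auto intro!: injI simp: de_phi_real_eq)
  show "t \<in> {0<..}" if "t \<in> range de_phi_real" for t
    using that by (auto simp: de_phi_real_eq intro!: ln_gt_zero)
  show "t \<in> range de_phi_real" if "t \<in> {0<..}" for t
  proof
    have "exp t - 1 > 0" using that by simp
    thus "t = de_phi_real (arsinh (ln (exp t - 1) / pi))"
      by (simp add: de_phi_real_eq)
  qed simp
qed


section \<open>The initial value problem and the decay condition\<close>

text \<open>
  Vector components and matrix entries are numbered from \<open>0\<close> to \<open>m - 1\<close>.
  At \<open>t = 0\<close> the derivative is one-sided.
\<close>

definition solves_ivp :: "nat \<Rightarrow> (nat \<Rightarrow> nat \<Rightarrow> complex \<Rightarrow> complex) \<Rightarrow> (nat \<Rightarrow> complex \<Rightarrow> complex)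
    \<Rightarrow> (nat \<Rightarrow> complex) \<Rightarrow> (nat \<Rightarrow> complex \<Rightarrow> complex) \<Rightarrow> bool" where
  "solves_ivp m k g r y \<longleftrightarrow>
     (\<forall>i<m. \<forall>t\<ge>0. ((\<lambda>s. y i (of_real s)) has_vector_derivative
        (\<Sum>j<m. k i j (of_real t) * y j (of_real t)) + g i (of_real t)) (at t within {0..})) \<and>
     (\<forall>i<m. y i 0 = r i)"

text \<open>
  \<open>|z / (1 + z)| powr (\<alpha> - 1)\<close>, read as \<open>|(1 + z) / z| powr (1 - \<alpha>)\<close>. For \<open>\<alpha> = 1\<close> the value
  is \<open>1\<close> even at \<open>z = -1\<close>, whereas \<open>0 powr 0 = 0\<close> in HOL; hence the case distinction.
\<close>

definition de_weight :: "real \<Rightarrow> complex \<Rightarrow> real" where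
  "de_weight \<alpha> z = (if \<alpha> = 1 then 1 else cmod ((1 + z) / z) powr (1 - \<alpha>))"

definition de_decay :: "real \<Rightarrow> real \<Rightarrow> real \<Rightarrow> (complex \<Rightarrow> complex) \<Rightarrow> bool" where
  "de_decay \<alpha> \<beta> d f \<longleftrightarrow>
     f analytic_on de_phi ` strip d \<and>
     (\<exists>C>0. \<forall>z\<in>de_phi ` strip d. cmod (f z) \<le> C * de_weight \<alpha> z * cmod (exp (- z)) powr \<beta>)"


section \<open>Mesh size and truncation numbers\<close>

definition de_h :: "real \<Rightarrow> real \<Rightarrow> nat \<Rightarrow> real" where
  "de_h d \<mu> n = arsinh (d * real n / \<mu>) / real n"

text \<open>
  With \<open>\<mu> = min \<alpha> \<beta>\<close>, the case \<open>\<mu> = \<alpha>\<close> is \<open>\<alpha> \<le> \<beta>\<close>. For \<open>\<alpha> = \<beta>\<close> both prescriptions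
  give \<open>M = N = n\<close>, so the order of the cases is immaterial.
\<close>

definition de_M :: "real \<Rightarrow> real \<Rightarrow> real \<Rightarrow> nat \<Rightarrow> nat" where
  "de_M \<alpha> \<beta> d n = (let \<mu> = min \<alpha> \<beta>; h = de_h d \<mu> n in
     if \<mu> = \<alpha> then n else nat \<lceil>1 / h * arsinh (\<beta> / \<alpha> * sinh (real n * h))\<rceil>)"

definition de_N :: "real \<Rightarrow> real \<Rightarrow> real \<Rightarrow> nat \<Rightarrow> nat" where
  "de_N \<alpha> \<beta> d n = (let \<mu> = min \<alpha> \<beta>; h = de_h d \<mu> n in
     if \<mu> = \<alpha> then nat \<lceil>1 / h * arsinh (\<alpha> / \<beta> * sinh (real n * h))\<rceil> else n)"


section \<open>Matrix notions\<close>

definition kronecker_mat :: "complex mat \<Rightarrow> complex mat \<Rightarrow> complex mat" where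
  "kronecker_mat A B = mat (dim_row A * dim_row B) (dim_col A * dim_col B)
     (\<lambda>(a, b). A $$ (a div dim_row B, b div dim_col B) * B $$ (a mod dim_row B, b mod dim_col B))"

text \<open>The \<open>m \<times> m\<close> block matrix whose blocks \<open>A i j\<close> are \<open>l \<times> l\<close> matrices.\<close>

definition block_mat :: "nat \<Rightarrow> nat \<Rightarrow> (nat \<Rightarrow> nat \<Rightarrow> complex mat) \<Rightarrow> complex mat" where
  "block_mat m l A = mat (m * l) (m * l) (\<lambda>(a, b). A (a div l) (b div l) $$ (a mod l, b mod l))"

definition vec_max_norm :: "complex vec \<Rightarrow> real" where
  "vec_max_norm v = (MAX i\<in>{..<dim_vec v}. cmod (vec_index v i))"

definition mat_max_norm :: "complex mat \<Rightarrow> real" where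
  "mat_max_norm A = (SUP v\<in>carrier_vec (dim_col A) - {0\<^sub>v (dim_col A)}.
     vec_max_norm (A *\<^sub>v v) / vec_max_norm v)"


section \<open>The DE-Sinc-collocation method\<close>

text \<open>
  Rows and columns of \<open>l \<times> l\<close> matrices, indexed by \<open>j = -M, \<dots>, N\<close> in the method, are numbered
  \<open>p = j + M = 0, \<dots>, l - 1\<close> with \<open>l = M + N + 1\<close>. Only differences of indices enter \<open>sinc_int_mat\<close>,
  which is the matrix \<open>I\<^sub>l\<close> with superscript \<open>(-1)\<close>.
\<close>

definition sinc_int_mat :: "nat \<Rightarrow> complex mat" where
  "sinc_int_mat l = mat l l (\<lambda>(p, q). of_real (1 / 2 + 1 / pi * Si (pi * (real p - real q))))"

definition de_node :: "real \<Rightarrow> int \<Rightarrow> complex" where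
  "de_node h j = de_phi (of_real (real_of_int j * h))"

definition de_node_deriv :: "real \<Rightarrow> int \<Rightarrow> complex" where
  "de_node_deriv h j = deriv de_phi (of_real (real_of_int j * h))"

definition D_mat :: "real \<Rightarrow> nat \<Rightarrow> nat \<Rightarrow> complex mat" where
  "D_mat h M N = mat_diag (M + N + 1) (\<lambda>p. de_node_deriv h (int p - int M))"

definition K_mat :: "(complex \<Rightarrow> complex) \<Rightarrow> real \<Rightarrow> nat \<Rightarrow> nat \<Rightarrow> complex mat" where
  "K_mat f h M N = mat_diag (M + N + 1) (\<lambda>p. f (de_node h (int p - int M)))"

definition int_op_mat :: "nat \<Rightarrow> real \<Rightarrow> nat \<Rightarrow> nat \<Rightarrow> complex mat" where
  "int_op_mat m h M N =
     kronecker_mat (1\<^sub>m m) (of_real h \<cdot>\<^sub>m (sinc_int_mat (M + N + 1) * D_mat h M N))"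

definition B_mat :: "nat \<Rightarrow> (nat \<Rightarrow> nat \<Rightarrow> complex \<Rightarrow> complex) \<Rightarrow> real \<Rightarrow> nat \<Rightarrow> nat \<Rightarrow> complex mat" where
  "B_mat m k h M N = kronecker_mat (1\<^sub>m m) (1\<^sub>m (M + N + 1)) -
     int_op_mat m h M N * block_mat m (M + N + 1) (\<lambda>i j. K_mat (k i j) h M N)"

definition R_vec :: "nat \<Rightarrow> (nat \<Rightarrow> complex) \<Rightarrow> nat \<Rightarrow> nat \<Rightarrow> complex vec" where
  "R_vec m r M N = vec (m * (M + N + 1)) (\<lambda>a. r (a div (M + N + 1)))"

definition G_vec :: "nat \<Rightarrow> (nat \<Rightarrow> complex \<Rightarrow> complex) \<Rightarrow> real \<Rightarrow> nat \<Rightarrow> nat \<Rightarrow> complex vec" where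
  "G_vec m g h M N = vec (m * (M + N + 1))
     (\<lambda>a. g (a div (M + N + 1)) (de_node h (int (a mod (M + N + 1)) - int M)))"

text \<open>Meaningful only if \<open>B_mat m k h M N\<close> is invertible, when the solution is unique.\<close>

definition Y_vec :: "nat \<Rightarrow> (nat \<Rightarrow> nat \<Rightarrow> complex \<Rightarrow> complex) \<Rightarrow> (nat \<Rightarrow> complex \<Rightarrow> complex)
    \<Rightarrow> (nat \<Rightarrow> complex) \<Rightarrow> real \<Rightarrow> nat \<Rightarrow> nat \<Rightarrow> complex vec" where
  "Y_vec m k g r h M N = (THE Y. Y \<in> carrier_vec (m * (M + N + 1)) \<and>
     B_mat m k h M N *\<^sub>v Y = R_vec m r M N + int_op_mat m h M N *\<^sub>v G_vec m g h M N)"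

definition y_node :: "nat \<Rightarrow> (nat \<Rightarrow> nat \<Rightarrow> complex \<Rightarrow> complex) \<Rightarrow> (nat \<Rightarrow> complex \<Rightarrow> complex)
    \<Rightarrow> (nat \<Rightarrow> complex) \<Rightarrow> real \<Rightarrow> nat \<Rightarrow> nat \<Rightarrow> nat \<Rightarrow> int \<Rightarrow> complex" where
  "y_node m k g r h M N i j = vec_index (Y_vec m k g r h M N) (i * (M + N + 1) + nat (j + int M))"

definition p_coeff :: "nat \<Rightarrow> (nat \<Rightarrow> nat \<Rightarrow> complex \<Rightarrow> complex) \<Rightarrow> (nat \<Rightarrow> complex \<Rightarrow> complex)
    \<Rightarrow> (nat \<Rightarrow> complex) \<Rightarrow> real \<Rightarrow> nat \<Rightarrow> nat \<Rightarrow> nat \<Rightarrow> complex" where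
  "p_coeff m k g r h M N i = r i + of_real h * (\<Sum>j\<in>{- int M..int N}.
     ((\<Sum>q<m. k i q (de_node h j) * y_node m k g r h M N q j) + g i (de_node h j)) * de_node_deriv h j)"

definition sinc_basis :: "int \<Rightarrow> real \<Rightarrow> real \<Rightarrow> real" where
  "sinc_basis j h x = sinc (pi * (x - real_of_int j * h) / h)"

definition y_hat :: "nat \<Rightarrow> (nat \<Rightarrow> nat \<Rightarrow> complex \<Rightarrow> complex) \<Rightarrow> (nat \<Rightarrow> complex \<Rightarrow> complex)
    \<Rightarrow> (nat \<Rightarrow> complex) \<Rightarrow> real \<Rightarrow> nat \<Rightarrow> nat \<Rightarrow> nat \<Rightarrow> real \<Rightarrow> complex" where
  "y_hat m k g r h M N i t =
     (r i + p_coeff m k g r h M N i * of_real (exp t - 1)) / of_real (exp t) +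
     (\<Sum>j\<in>{- int M..int N}.
        (y_node m k g r h M N i j -
          (r i + p_coeff m k g r h M N i * of_real (exp (pi * sinh (real_of_int j * h)))) /
            of_real (1 + exp (pi * sinh (real_of_int j * h)))) *
        of_real (sinc_basis j h (de_phi_inv t)))"

end

theory Submission
  imports Defs "HOL-Real_Asymp.Real_Asymp"
begin

text \<open>
  In the variable \<open>x\<close> with \<open>t = \<phi> x\<close> everything becomes holomorphic in a strip about the real line.
  Let \<open>F\<^sub>i = (\<Sum>\<^sub>j k\<^sub>i\<^sub>j(\<phi>) y\<^sub>j(\<phi>) + g\<^sub>i(\<phi>)) \<phi>'\<close>, so that \<open>y\<^sub>i(\<phi> x) = r\<^sub>i + \<integral> F\<^sub>i\<close> over \<open>(-\<infinity>, x]\<close>,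
  and \<open>U\<^sub>i = y\<^sub>i(\<phi>) - r\<^sub>i / (1 + e)\<close> with \<open>e = exp (\<pi> sinh \<zeta>)\<close>. Both are \<open>O(exp (-2 \<gamma> |sinh (Re \<zeta>)|))\<close>
  on the strip (\<open>de_transformed_decay\<close>, \<open>de_interpolant_decay\<close>). For \<open>F\<^sub>i\<close>, the decay of \<open>y\<^sub>j\<close> and \<open>g\<^sub>i\<close> prevails
  over the growth of \<open>\<phi>'\<close> at the right end, and the decay of \<open>\<phi>'\<close> over the singularity of the weight at the
  left end; for \<open>U\<^sub>i\<close>, both limits of \<open>y\<^sub>i\<close> have been subtracted.

  The error of the Sinc interpolant of such a function is, by the residue theorem, an integral of
  \<open>F(z) sin(\<pi>x/h) / ((z - x) sin(\<pi>z/h))\<close> over the boundary of the strip (\<open>cardinal_series_contour\<close>), and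
  there \<open>1 / sin(\<pi>z/h)\<close> is \<open>O(exp (-\<pi>d/h))\<close>. For indefinite integration the formula is integrated in
  \<open>x\<close> first: the oscillating kernel integrates to \<open>O(h)\<close> (\<open>oscillatory_cauchy_kernel_le\<close>), which gives the
  same rate uniformly in \<open>x\<close> and without a logarithm. Cutting the series off at \<open>-M\<close> and \<open>N\<close> costs only
  a term \<open>n exp (-c n)\<close>, because \<open>sinh\<close> of both end points grows linearly in \<open>n\<close>. Hence the interpolation error \<open>P\<close>
  of \<open>U\<^sub>i\<close> and the indefinite integration error \<open>Q\<close> of \<open>F\<^sub>i\<close> are both \<open>O(exp (-\<pi>d/h))\<close>, which is the
  exponential in the claim since \<open>h = arsinh(dn/\<mu>) / n\<close>.

  The exact nodal values solve the collocation system up to a residual \<open>\<le> Q\<close>, so the nodal errors \<open>\<delta>\<close> are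
  at most \<open>\<parallel>B\<^sup>-\<^sup>1\<parallel> Q\<close> (\<open>collocation_stability\<close>). With \<open>w = e / (1 + e)\<close>, the total error is
  the interpolation error of \<open>U\<^sub>i\<close>, plus \<open>\<Sum>\<^sub>j \<delta>\<^sub>j S(j,h)\<close>, minus \<open>p (w - \<Sum>\<^sub>j w(jh) S(j,h))\<close>.
  The second term is \<open>O(log n)\<close> times \<open>\<delta>\<close> by the Lebesgue constant of the Sinc functions. In the third,
  the bracket is at most 5: \<open>w\<close> is monotone and partial sums of the \<open>S(j,h)\<close> are bounded, so Abel
  summation applies (\<open>abs_sum_mono_sinc_le\<close>).

  There remains \<open>p\<close>, whose exact counterpart \<open>r\<^sub>i + \<integral> F\<^sub>i\<close> over the whole line is the limit of \<open>y\<^sub>i\<close> at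
  infinity, that is \<open>0\<close>. So \<open>p\<close> is a quadrature error, at most \<open>Q\<close>, minus \<open>h \<Sum>\<^sub>j K \<delta>\<^sub>j \<phi>'(jh)\<close>. Since \<open>\<phi>'(jh)\<close>
  grows to the order of \<open>n\<close>, a termwise estimate of that sum would lose too much. But the last row of the linear
  system controls the same sum with the weights \<open>1/2 + Si(\<pi>(N-j))/\<pi>\<close>, and these differ from \<open>1\<close> by
  at most \<open>1 / (1 + N - j)\<close>. What is left is of order \<open>h n log n = arsinh(dn/\<mu>) log n\<close> times \<open>\<delta>\<close>
  (\<open>collocation_error_at_point\<close>). This term produces both factors in front of the exponential.
\<close>

section \<open>Sums of Sinc functions and the sine integral\<close>

lemma abs_sinc_le_one: "\<bar>sinc x\<bar> \<le> 1"
proof (cases "x = 0")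
  case False
  have "\<bar>sin x\<bar> \<le> \<bar>x\<bar>" by (rule abs_sin_x_le_abs_x)
  thus ?thesis using False by (simp add: abs_divide divide_le_eq)
qed simp

lemma abs_sinc_le_inverse: "x \<noteq> 0 \<Longrightarrow> \<bar>sinc x\<bar> \<le> 1 / \<bar>x\<bar>"
  by (simp add: abs_divide divide_right_mono)

lemma Si_uminus: "Si (- x) = - Si x"
  using Si_neg[of x] Si_neg[of "- x"] by (cases "x \<ge> 0") auto

lemma Si_at_bot: "(Si \<longlongrightarrow> - (pi / 2)) at_bot"
proof -
  have "((\<lambda>x. - Si x) \<longlongrightarrow> - (pi / 2)) at_top"
    by (intro tendsto_minus Si_at_top)
  thus ?thesis by (simp add: filterlim_at_bot_mirror Si_uminus)
qed

text \<open>
  The functions \<open>Si t + (cos t \<plusminus> 1) / t\<close> have the derivatives \<open>- (cos t \<plusminus> 1) / t\<^sup>2\<close> and tend to \<open>\<pi>/2\<close>.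
  The signs of the derivatives show that one decreases to this limit and that the other increases to it.
\<close>

lemma Si_tail_bound:
  assumes "x > 0"
  shows "\<bar>pi / 2 - Si x\<bar> \<le> 2 / x"
proof -
  have lim: "((\<lambda>t. Si t + (cos t + c) / t) \<longlongrightarrow> pi / 2 + 0) at_top" for c :: real
  proof (intro tendsto_add Si_at_top)
    show "((\<lambda>t. (cos t + c) / t) \<longlongrightarrow> 0) at_top"
    proof (rule Lim_null_comparison)
      show "\<forall>\<^sub>F t in at_top. norm ((cos t + c) / t) \<le> (1 + \<bar>c\<bar>) / t"
        using eventually_gt_at_top[of 0]
      proof eventually_elim
        case (elim t)
        have "\<bar>cos t + c\<bar> \<le> 1 + \<bar>c\<bar>"
          using abs_triangle_ineq[of "cos t" c] abs_cos_le_one[of t] by linarith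
        thus ?case using elim by (simp add: abs_divide divide_right_mono)
      qed
      show "((\<lambda>t. (1 + \<bar>c\<bar>) / t) \<longlongrightarrow> 0) at_top"
        by (intro tendsto_divide_0[OF tendsto_const] filterlim_at_top_imp_at_infinity filterlim_ident)
    qed
  qed
  have der: "((\<lambda>t. Si t + (cos t + c) / t) has_real_derivative - (cos t + c) / t\<^sup>2) (at t)"
    if "t > 0" for c t :: real
    using that
    by (auto intro!: derivative_eq_intros DERIV_Si simp: power2_eq_square field_simps)
  have up: "pi / 2 \<le> Si x + (cos x + 1) / x"
  proof (rule tendsto_upperbound)
    show "((\<lambda>t. Si t + (cos t + 1) / t) \<longlongrightarrow> pi / 2) at_top" using lim[of 1] by simp
    show "\<forall>\<^sub>F t in at_top. Si t + (cos t + 1) / t \<le> Si x + (cos x + 1) / x"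
      using eventually_ge_at_top[of x]
    proof eventually_elim
      case (elim t)
      show ?case
      proof (rule DERIV_nonpos_imp_nonincreasing[OF elim])
        fix s assume s: "x \<le> s" "s \<le> t"
        have "- (cos s + 1) / s\<^sup>2 \<le> 0" using cos_ge_minus_one[of s] by (simp add: divide_nonpos_nonneg)
        thus "\<exists>y. DERIV (\<lambda>t. Si t + (cos t + 1) / t) s :> y \<and> y \<le> 0"
          using der[of s 1] s assms by auto
      qed
    qed
  qed simp
  have lo: "Si x + (cos x + (-1)) / x \<le> pi / 2"
  proof (rule tendsto_lowerbound)
    show "((\<lambda>t. Si t + (cos t + (-1)) / t) \<longlongrightarrow> pi / 2) at_top" using lim[of "-1"] by simp
    show "\<forall>\<^sub>F t in at_top. Si x + (cos x + (-1)) / x \<le> Si t + (cos t + (-1)) / t"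
      using eventually_ge_at_top[of x]
    proof eventually_elim
      case (elim t)
      show ?case
      proof (rule DERIV_nonneg_imp_nondecreasing[OF elim])
        fix s assume s: "x \<le> s" "s \<le> t"
        have "- (cos s + (-1)) / s\<^sup>2 \<ge> 0" using cos_le_one[of s] by (intro divide_nonneg_nonneg) auto
        thus "\<exists>y. DERIV (\<lambda>t. Si t + (cos t + (-1)) / t) s :> y \<and> y \<ge> 0"
          using der[of s "-1"] s assms by (intro exI[of _ "- (cos s + (-1)) / s\<^sup>2"]) simp
      qed
    qed
  qed simp
  have "(cos x + 1) / x \<le> 2 / x" "(cos x + (-1)) / x \<ge> - 2 / x"
    using assms cos_le_one[of x] cos_ge_minus_one[of x] by (intro divide_right_mono; linarith)+
  with up lo have "pi / 2 - Si x \<le> 2 / x" "Si x - pi / 2 \<le> 2 / x" by linarith+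
  thus ?thesis by (simp only: abs_le_iff) simp
qed

lemma has_integral_sinc_basis:
  assumes "h > 0" "a \<le> x"
  shows "(sinc_basis j h has_integral
           h / pi * (Si (pi * (x - j * h) / h) - Si (pi * (a - j * h) / h))) {a..x}"
proof -
  have der: "((\<lambda>s. h / pi * Si (pi * (s - j * h) / h)) has_real_derivative sinc_basis j h s) (at s within {a..x})"
    for s
  proof -
    have "((\<lambda>s. pi * (s - j * h) / h) has_real_derivative pi / h) (at s within {a..x})"
      using assms by (auto intro!: derivative_eq_intros)
    from DERIV_cmult[OF DERIV_chain2[OF DERIV_Si this], of "h / pi"]
    show ?thesis unfolding sinc_basis_def using assms by (auto simp: field_simps cong: if_cong)
  qed
  from fundamental_theorem_of_calculus[OF assms(2), of "\<lambda>s. h / pi * Si (pi * (s - j * h) / h)"]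
  show ?thesis using der by (simp add: has_real_derivative_iff_has_vector_derivative right_diff_distrib)
qed

text \<open>
  Moving \<open>c\<close> to the nearest point of the window only increases the sum; then the window splits into the two
  sides of the centre, and on each side the summands are distinct reciprocals \<open>1/i\<close> with \<open>i \<le> l\<close>.
\<close>

lemma sum_inverse_distance:
  fixes c a b :: int
  assumes ab: "a \<le> b" and l: "int l = b - a + 1"
  shows "(\<Sum>k\<in>{a..b}. 1 / (1 + \<bar>real_of_int (k - c)\<bar>)) \<le> 2 * harm l"
proof -
  have side: "(\<Sum>k\<in>A. 1 / (1 + \<bar>real_of_int (k - e)\<bar>)) \<le> harm l"
    if A: "A \<subseteq> {a..b}" "(\<forall>k\<in>A. k \<ge> e) \<or> (\<forall>k\<in>A. k \<le> e)" "e \<in> {a..b}" for A e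
  proof -
    have inj: "inj_on (\<lambda>k. nat (1 + \<bar>k - e\<bar>)) A"
    proof (rule inj_onI)
      fix u v assume uv: "u \<in> A" "v \<in> A" and "nat (1 + \<bar>u - e\<bar>) = nat (1 + \<bar>v - e\<bar>)"
      hence "\<bar>u - e\<bar> = \<bar>v - e\<bar>" by (simp add: eq_nat_nat_iff)
      thus "u = v" using A(2) uv by fastforce
    qed
    have "(\<Sum>k\<in>A. 1 / (1 + \<bar>real_of_int (k - e)\<bar>)) = (\<Sum>k\<in>A. inverse (real (nat (1 + \<bar>k - e\<bar>))))"
      by (intro sum.cong) (auto simp: field_simps)
    also have "\<dots> = (\<Sum>i\<in>(\<lambda>k. nat (1 + \<bar>k - e\<bar>)) ` A. inverse (real i))"
      using inj by (simp add: sum.reindex)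
    also have "\<dots> \<le> (\<Sum>i\<in>{1..l}. inverse (real i))"
      using A l by (intro sum_mono2) (auto simp: subset_iff)
    finally show ?thesis by (simp add: harm_def)
  qed
  define e where "e = max a (min b c)"
  have e: "e \<in> {a..b}" using ab by (auto simp: e_def)
  have "(\<Sum>k\<in>{a..b}. 1 / (1 + \<bar>real_of_int (k - c)\<bar>)) \<le> (\<Sum>k\<in>{a..b}. 1 / (1 + \<bar>real_of_int (k - e)\<bar>))"
    by (intro sum_mono divide_left_mono) (auto simp: e_def)
  also have "\<dots> = (\<Sum>k\<in>{a..e-1} \<union> {e..b}. 1 / (1 + \<bar>real_of_int (k - e)\<bar>))"
    using e by (intro sum.cong) auto
  also have "(\<Sum>k\<in>{a..e-1} \<union> {e..b}. 1 / (1 + \<bar>real_of_int (k - e)\<bar>)) =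
     (\<Sum>k\<in>{a..e-1}. 1 / (1 + \<bar>real_of_int (k - e)\<bar>)) + (\<Sum>k\<in>{e..b}. 1 / (1 + \<bar>real_of_int (k - e)\<bar>))"
    by (intro sum.union_disjoint) auto
  also have "\<dots> \<le> harm l + harm l"
    using e by (intro add_mono side) auto
  finally show ?thesis by simp
qed

text \<open>
  The Lebesgue constant of the Sinc functions: only the distance of \<open>k\<close> from the integer part of \<open>u\<close> matters.
\<close>

lemma sum_abs_sinc_le:
  fixes a b :: int
  assumes ab: "a \<le> b" and l: "int l = b - a + 1"
  shows "(\<Sum>k\<in>{a..b}. \<bar>sinc (pi * (u - real_of_int k))\<bar>) \<le> 4 * harm l"
proof -
  define c where "c = \<lfloor>u\<rfloor>"
  have "\<bar>sinc (pi * (u - real_of_int k))\<bar> \<le> 2 * (1 / (1 + \<bar>real_of_int (k - c)\<bar>))" for k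
  proof (cases "\<bar>k - c\<bar> \<le> 1")
    case True
    hence "1 + \<bar>real_of_int (k - c)\<bar> \<le> 2" by linarith
    hence "1 \<le> 2 * (1 / (1 + \<bar>real_of_int (k - c)\<bar>))" by (simp add: field_simps)
    thus ?thesis using abs_sinc_le_one order_trans by blast
  next
    case False
    have f: "real_of_int c \<le> u" "u < real_of_int c + 1" by (auto simp: c_def)
    have "\<bar>real_of_int (k - c)\<bar> \<ge> 2" using False by linarith
    hence ge: "\<bar>u - real_of_int k\<bar> \<ge> \<bar>real_of_int (k - c)\<bar> - 1" "\<bar>real_of_int (k - c)\<bar> \<ge> 2"
      using f by auto
    have pi: "pi > 3" by (rule pi_gt3)
    have "1 + q \<le> 3 * (q - 1)" if "2 \<le> q" for q :: real using that by (simp add: algebra_simps)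
    from this[OF ge(2)] have "1 + \<bar>real_of_int (k - c)\<bar> \<le> 3 * (\<bar>real_of_int (k - c)\<bar> - 1)" .
    also have "\<dots> \<le> pi * \<bar>u - real_of_int k\<bar>" using ge pi by (intro mult_mono) auto
    finally have *: "1 + \<bar>real_of_int (k - c)\<bar> \<le> \<bar>pi * (u - real_of_int k)\<bar>" by (simp add: abs_mult)
    have "pi * (u - real_of_int k) \<noteq> 0" using ge by auto
    from abs_sinc_le_inverse[OF this]
    have "\<bar>sinc (pi * (u - real_of_int k))\<bar> \<le> 1 / \<bar>pi * (u - real_of_int k)\<bar>" .
    also have "\<dots> \<le> 1 / (1 + \<bar>real_of_int (k - c)\<bar>)" using * ge by (intro divide_left_mono) auto
    also have "\<dots> \<le> 2 * \<dots>" by (simp add: divide_right_mono)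
    finally show ?thesis .
  qed
  hence "(\<Sum>k\<in>{a..b}. \<bar>sinc (pi * (u - real_of_int k))\<bar>) \<le> (\<Sum>k\<in>{a..b}. 2 * (1 / (1 + \<bar>real_of_int (k - c)\<bar>)))"
    by (intro sum_mono)
  also have "\<dots> \<le> 2 * (2 * harm l)"
    unfolding sum_distrib_left[symmetric] using sum_inverse_distance[OF ab l, of c] by simp
  finally show ?thesis by simp
qed

lemma alternating_sum_bounds:
  fixes b :: "nat \<Rightarrow> real"
  assumes "\<And>i. 0 \<le> b i" "\<And>i. b (Suc i) \<le> b i"
  shows "0 \<le> (\<Sum>i<n. (-1) ^ i * b i) \<and> (\<Sum>i<n. (-1) ^ i * b i) \<le> b 0"
  using assms
proof (induction n arbitrary: b)
  case (Suc n)
  have "(\<Sum>i<Suc n. (-1) ^ i * b i) = b 0 - (\<Sum>i<n. (-1) ^ i * b (Suc i))"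
    by (subst sum.lessThan_Suc_shift) (simp add: sum_negf)
  moreover have "0 \<le> (\<Sum>i<n. (-1) ^ i * b (Suc i)) \<and> (\<Sum>i<n. (-1) ^ i * b (Suc i)) \<le> b (Suc 0)"
    using Suc.IH[of "\<lambda>i. b (Suc i)"] Suc.prems by simp
  ultimately show ?case using Suc.prems(2)[of 0] by linarith
qed simp

text \<open>
  On one side of a point the values of \<open>sinc\<close> at unit spacing alternate in sign and decrease in modulus,
  so every block of consecutive values sums to at most the first one.
\<close>

lemma abs_sum_sinc_one_sided:
  assumes f: "0 \<le> f" "f \<le> 1"
  shows "\<bar>\<Sum>i<n. sinc (pi * (f + real (i0 + i)))\<bar> \<le> 1"
proof -
  define b where "b = (\<lambda>i. \<bar>sinc (pi * (f + real i))\<bar>)"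
  have sf: "sin (pi * f) \<ge> 0" using f by (intro sin_ge_zero) (auto intro: mult_left_le)
  have sgn: "sinc (pi * (f + real i)) = (-1) ^ i * b i" for i
  proof (cases "f + real i = 0")
    case True
    thus ?thesis using f by (simp add: b_def add_nonneg_eq_0_iff)
  next
    case False
    hence p: "f + real i > 0" using f by (simp add: less_le add_nonneg_nonneg)
    have "sin (pi * (f + real i)) = (-1) ^ i * sin (pi * f)"
      by (simp add: distrib_left sin_add mult.commute[of pi "real i"])
    hence eq: "sinc (pi * (f + real i)) = (-1) ^ i * (sin (pi * f) / (pi * (f + real i)))"
      using p by simp
    have "b i = sin (pi * f) / (pi * (f + real i))"
      unfolding b_def eq using p sf by (simp add: abs_mult)
    thus ?thesis using eq by simp
  qed
  have dec: "b (Suc i) \<le> b i" for i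
  proof (cases "f + real i = 0")
    case True
    hence "f = 0" "i = 0" using f by (auto simp: add_nonneg_eq_0_iff)
    thus ?thesis by (simp add: b_def)
  next
    case False
    hence p: "f + real i > 0" using f by (simp add: less_le add_nonneg_nonneg)
    have "\<bar>sin (pi * (f + real (Suc i)))\<bar> = \<bar>sin (pi * (f + real i))\<bar>"
    proof -
      have "pi * (f + real (Suc i)) = pi * (f + real i) + pi" by (simp add: algebra_simps)
      thus ?thesis by (simp only: sin_periodic_pi abs_minus_cancel)
    qed
    thus ?thesis unfolding b_def using p by (auto simp: abs_mult intro!: divide_left_mono mult_pos_pos)
  qed
  have "(\<Sum>i<n. sinc (pi * (f + real (i0 + i)))) = (-1) ^ i0 * (\<Sum>i<n. (-1) ^ i * b (i0 + i))"
    unfolding sgn by (simp add: power_add sum_distrib_left mult_ac)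
  moreover have "0 \<le> (\<Sum>i<n. (-1) ^ i * b (i0 + i)) \<and> (\<Sum>i<n. (-1) ^ i * b (i0 + i)) \<le> b (i0 + 0)"
    by (rule alternating_sum_bounds) (auto simp: dec, simp add: b_def)
  moreover have "b (i0 + 0) \<le> 1" unfolding b_def by (rule abs_sinc_le_one)
  ultimately show ?thesis by (simp add: abs_mult power_abs)
qed

lemma abs_sum_sinc_le_two:
  fixes a b :: int
  shows "\<bar>\<Sum>k\<in>{a..b}. sinc (pi * (u - real_of_int k))\<bar> \<le> 2"
proof -
  define c where "c = \<lfloor>u\<rfloor>"
  define f where "f = u - real_of_int c"
  have f: "0 \<le> f" "f \<le> 1" unfolding f_def c_def by linarith+
  have up: "\<bar>\<Sum>k\<in>{p..b}. sinc (pi * (u - real_of_int k))\<bar> \<le> 1" if p: "p > c" for p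
  proof -
    define n where "n = nat (b - p + 1)"
    have "(\<Sum>k\<in>{p..b}. sinc (pi * (u - real_of_int k))) =
          (\<Sum>i<n. sinc (pi * ((1 - f) + real (nat (p - c - 1) + i))))"
    proof (rule sum.reindex_bij_witness[of _ "\<lambda>i. p + int i" "\<lambda>k. nat (k - p)"])
      fix k assume k: "k \<in> {p..b}"
      have "(1 - f) + real (nat (p - c - 1) + nat (k - p)) = - (u - real_of_int k)"
        using k p by (simp add: f_def of_nat_nat)
      hence "pi * ((1 - f) + real (nat (p - c - 1) + nat (k - p))) = - (pi * (u - real_of_int k))"
        by (simp only: mult_minus_right)
      thus "sinc (pi * ((1 - f) + real (nat (p - c - 1) + nat (k - p)))) = sinc (pi * (u - real_of_int k))"
        by (simp only: sinc_neg)
    qed (auto simp: n_def)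
    moreover have "0 \<le> 1 - f" "1 - f \<le> 1" using f by auto
    ultimately show ?thesis using abs_sum_sinc_one_sided[where f="1 - f" and n=n and ?i0.0="nat (p - c - 1)"] by (simp only:)
  qed
  have down: "\<bar>\<Sum>k\<in>{a..p}. sinc (pi * (u - real_of_int k))\<bar> \<le> 1" if p: "p \<le> c" for p
  proof -
    define n where "n = nat (p - a + 1)"
    have "(\<Sum>k\<in>{a..p}. sinc (pi * (u - real_of_int k))) =
          (\<Sum>i<n. sinc (pi * (f + real (nat (c - p) + i))))"
    proof (rule sum.reindex_bij_witness[of _ "\<lambda>i. p - int i" "\<lambda>k. nat (p - k)"])
      fix k assume k: "k \<in> {a..p}"
      have "u - real_of_int k = f + real (nat (c - p) + nat (p - k))"
        using k p by (simp add: f_def of_nat_nat)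
      thus "sinc (pi * (f + real (nat (c - p) + nat (p - k)))) = sinc (pi * (u - real_of_int k))"
        by simp
    qed (auto simp: n_def)
    thus ?thesis using abs_sum_sinc_one_sided[where f=f and n=n and ?i0.0="nat (c - p)"] f by simp
  qed
  have "{a..b} = {a..min b c} \<union> {max a (c + 1)..b}" by auto
  hence "(\<Sum>k\<in>{a..b}. sinc (pi * (u - real_of_int k))) =
     (\<Sum>k\<in>{a..min b c}. sinc (pi * (u - real_of_int k))) + (\<Sum>k\<in>{max a (c + 1)..b}. sinc (pi * (u - real_of_int k)))"
    by (simp only:) (rule sum.union_disjoint; auto)
  thus ?thesis using up[of "max a (c + 1)"] down[of "min b c"] by linarith
qed

text \<open>
  Abel summation: the increments of the weights are nonnegative and add up to at most \<open>w n\<close>.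
\<close>

lemma abs_sum_mult_mono_le:
  fixes w s :: "nat \<Rightarrow> real"
  assumes w: "\<And>i. 0 \<le> w i" "\<And>i. w i \<le> w (Suc i)" and P: "\<And>n. \<bar>\<Sum>i<n. s i\<bar> \<le> C"
  shows "\<bar>\<Sum>i<n. w i * s i\<bar> \<le> 2 * C * w n"
proof -
  have C: "C \<ge> 0" using P[of 0] by simp
  have abel: "(\<Sum>i<n. w i * s i) = w n * (\<Sum>i<n. s i) - (\<Sum>i<n. (w (Suc i) - w i) * (\<Sum>k<Suc i. s k))"
    by (induction n) (simp_all add: algebra_simps)
  have "\<bar>\<Sum>i<n. (w (Suc i) - w i) * (\<Sum>k<Suc i. s k)\<bar> \<le> (\<Sum>i<n. \<bar>(w (Suc i) - w i) * (\<Sum>k<Suc i. s k)\<bar>)"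
    by (rule sum_abs)
  also have "\<dots> \<le> (\<Sum>i<n. (w (Suc i) - w i) * C)"
  proof (rule sum_mono)
    fix i
    show "\<bar>(w (Suc i) - w i) * (\<Sum>k<Suc i. s k)\<bar> \<le> (w (Suc i) - w i) * C"
      unfolding abs_mult using w(2)[of i] P[of "Suc i"] by (intro mult_mono) auto
  qed
  also have "\<dots> = (w n - w 0) * C" by (simp add: sum_distrib_right[symmetric] sum_lessThan_telescope)
  also have "\<dots> \<le> w n * C" using w(1)[of 0] C by (intro mult_right_mono) auto
  finally have 1: "\<bar>\<Sum>i<n. (w (Suc i) - w i) * (\<Sum>k<Suc i. s k)\<bar> \<le> w n * C" .
  have "\<bar>w n * (\<Sum>i<n. s i)\<bar> \<le> w n * C"
    unfolding abs_mult using w(1)[of n] P[of n] by (intro mult_mono) auto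
  with 1 show ?thesis unfolding abel by (simp add: mult_ac)
qed

text \<open>
  A Sinc series with monotone coefficients does not pay the logarithmic Lebesgue constant. This is applied to
  the samples of \<open>exp (\<pi> sinh x) / (1 + exp (\<pi> sinh x))\<close>.
\<close>

lemma abs_sum_mono_sinc_le:
  fixes w :: "int \<Rightarrow> real"
  assumes w: "\<And>k. 0 \<le> w k" "\<And>k. w k \<le> w (k + 1)" "\<And>k. w k \<le> 1"
  shows "\<bar>\<Sum>k\<in>{a..b}. w k * sinc (pi * (u - real_of_int k))\<bar> \<le> 4"
proof -
  have re: "(\<Sum>k\<in>{a..a + int n - 1}. g k) = (\<Sum>i<n. g (a + int i))" for g :: "int \<Rightarrow> real" and n
    by (rule sum.reindex_bij_witness[of _ "\<lambda>i. a + int i" "\<lambda>k. nat (k - a)"]) auto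
  define n where "n = nat (b - a + 1)"
  have "{a..b} = {a..a + int n - 1}" by (auto simp: n_def)
  hence "(\<Sum>k\<in>{a..b}. w k * sinc (pi * (u - real_of_int k))) =
        (\<Sum>i<n. w (a + int i) * sinc (pi * (u - real_of_int (a + int i))))"
    by (simp only: re)
  moreover have "\<bar>\<Sum>i<n. w (a + int i) * sinc (pi * (u - real_of_int (a + int i)))\<bar> \<le> 2 * 2 * w (a + int n)"
  proof (rule abs_sum_mult_mono_le)
    show "w (a + int i) \<le> w (a + int (Suc i))" for i using w(2)[of "a + int i"] by (simp add: add_ac)
    show "\<bar>\<Sum>i<n. sinc (pi * (u - real_of_int (a + int i)))\<bar> \<le> 2" for n
      using abs_sum_sinc_le_two[where a=a and b="a + int n - 1" and u=u] by (simp only: re)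
  qed (rule w)
  ultimately show ?thesis using w(3)[of "a + int n"] by linarith
qed

section \<open>The cardinal series as a contour integral\<close>

definition rect_boundary :: "real \<Rightarrow> real \<Rightarrow> complex set" where
  "rect_boundary L \<delta> = {z. \<bar>Re z\<bar> \<le> L \<and> \<bar>Im z\<bar> \<le> \<delta> \<and> (\<bar>Re z\<bar> = L \<or> \<bar>Im z\<bar> = \<delta>)}"

text \<open>
  The contour integral over the positively oriented boundary of \<open>[-L, L] \<times> [-\<delta>, \<delta>]\<close>, written with four real
  integrals so that estimates and Fubini's theorem for real intervals apply side by side.
\<close>

definition rect_integral :: "real \<Rightarrow> real \<Rightarrow> (complex \<Rightarrow> complex) \<Rightarrow> complex" where
  "rect_integral L \<delta> f =
     integral {-L..L} (\<lambda>t. f (Complex t (- \<delta>))) + \<i> * integral {-\<delta>..\<delta>} (\<lambda>v. f (Complex L v))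
     - integral {-L..L} (\<lambda>t. f (Complex t \<delta>)) - \<i> * integral {-\<delta>..\<delta>} (\<lambda>v. f (Complex (- L) v))"

lemma path_image_rectpath_rect_boundary:
  assumes "L > 0" "\<delta> > 0"
  shows "path_image (rectpath (Complex (- L) (- \<delta>)) (Complex L \<delta>)) = rect_boundary L \<delta>"
  using assms by (auto simp: path_image_rectpath rect_boundary_def)

lemma contour_integral_rectpath_eq:
  assumes L: "L > 0" "\<delta> > 0" and f: "continuous_on (rect_boundary L \<delta>) f"
  shows "contour_integral (rectpath (Complex (- L) (- \<delta>)) (Complex L \<delta>)) f = rect_integral L \<delta> f"
proof -
  have cont: "continuous_on (closed_segment a b) f"
    if "closed_segment a b \<subseteq> rect_boundary L \<delta>" for a b
    using f that by (rule continuous_on_subset)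
  let ?a = "Complex (- L) (- \<delta>)" and ?b = "Complex L (- \<delta>)" and ?c = "Complex L \<delta>" and ?d = "Complex (- L) \<delta>"
  have s: "closed_segment ?a ?b \<subseteq> rect_boundary L \<delta>" "closed_segment ?b ?c \<subseteq> rect_boundary L \<delta>"
    "closed_segment ?c ?d \<subseteq> rect_boundary L \<delta>" "closed_segment ?d ?a \<subseteq> rect_boundary L \<delta>"
    using L by (auto simp: rect_boundary_def closed_segment_same_Re closed_segment_same_Im closed_segment_eq_real_ivl)
  have i: "f contour_integrable_on linepath ?a ?b" "f contour_integrable_on linepath ?b ?c"
    "f contour_integrable_on linepath ?c ?d" "f contour_integrable_on linepath ?d ?a"
    by (intro contour_integrable_continuous_linepath cont s)+
  have hor: "contour_integral (linepath (Complex (- L) v) (Complex L v)) f = integral {-L..L} (\<lambda>t. f (Complex t v))"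
    if "\<bar>v\<bar> = \<delta>" for v
  proof -
    have "continuous_on {-L..L} (\<lambda>t. f (Complex t v))"
      using that L by (intro continuous_on_compose2[OF f])
        (auto simp: rect_boundary_def Complex_eq intro!: continuous_intros)
    hence "((\<lambda>t. f (Complex t v)) has_integral integral {-L..L} (\<lambda>t. f (Complex t v))) (cbox (-L) L)"
      by (simp add: integrable_integral integrable_continuous_real)
    from has_integral_affinity[OF this, of "2 * L" "- L"]
    have "((\<lambda>x. f (Complex (2 * L * x - L) v)) has_integral
        (1 / (2 * L)) *\<^sub>R integral {-L..L} (\<lambda>t. f (Complex t v))) ((\<lambda>x. x / (2 * L) + 1 / 2) ` {-L..L})"
      using L by simp
    moreover have "(\<lambda>x. x / (2 * L) + 1 / 2) ` {-L..L} = {0..1}"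
      using image_affinity_atLeastAtMost[of "1 / (2 * L)" "1/2" "- L" L] L by simp
    ultimately have "((\<lambda>x. f (Complex (2 * L * x - L) v) * of_real (2 * L)) has_integral
        ((1 / (2 * L)) *\<^sub>R integral {-L..L} (\<lambda>t. f (Complex t v))) * of_real (2 * L)) {0..1}"
      by (intro has_integral_mult_left) simp
    moreover have "linepath (Complex (- L) v) (Complex L v) x = Complex (2 * L * x - L) v" for x
      by (simp add: linepath_def complex_eq_iff algebra_simps)
    moreover have "Complex L v - Complex (- L) v = of_real (2 * L)"
      by (simp add: complex_eq_iff)
    ultimately have "(f has_contour_integral integral {-L..L} (\<lambda>t. f (Complex t v))) (linepath (Complex (- L) v) (Complex L v))"
      unfolding has_contour_integral_linepath using L by (simp add: scaleR_conv_of_real)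
    thus ?thesis by (rule contour_integral_unique)
  qed
  have ver: "contour_integral (linepath (Complex u (- \<delta>)) (Complex u \<delta>)) f = \<i> * integral {-\<delta>..\<delta>} (\<lambda>t. f (Complex u t))" for u
    using L contour_integral_linepath_same_Re[of "Complex u (- \<delta>)" u "Complex u \<delta>" "- \<delta>" \<delta> f] by simp
  have "contour_integral (rectpath ?a ?c) f = contour_integral (linepath ?a ?b) f + contour_integral (linepath ?b ?c) f
     + contour_integral (linepath ?c ?d) f + contour_integral (linepath ?d ?a) f"
    unfolding rectpath_def Let_def using i by simp
  also have "contour_integral (linepath ?c ?d) f = - contour_integral (linepath ?d ?c) f"
    by (intro contour_integral_reverse_linepath cont s)
  also have "contour_integral (linepath ?d ?a) f = - contour_integral (linepath ?a ?d) f"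
    by (intro contour_integral_reverse_linepath cont s)
  finally show ?thesis using L by (simp add: hor ver rect_integral_def)
qed

lemma complex_sin_scaled_eq_0:
  assumes "h > 0"
  shows "sin (of_real pi * z / of_real h) = (0::complex) \<longleftrightarrow> (\<exists>k::int. z = of_real (of_int k * h))"
proof -
  have "(of_real pi * z / of_real h = complex_of_real (of_int k * pi)) \<longleftrightarrow> (z = of_real (of_int k * h))" for k :: int
    using assms by (auto simp: field_simps)
  thus ?thesis by (simp add: sin_eq_0 del: of_real_mult)
qed

lemma sinc_basis_times:
  fixes x h :: real
  assumes "x \<noteq> j * h" "h > 0"
  shows "sinc_basis j h x = sin (pi * x / h) * cos (pi * j) * h / (pi * (x - j * h))"
proof -
  have "pi * (x - j * h) / h = pi * x / h - pi * j" using assms by (simp add: field_simps)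
  hence "sin (pi * (x - j * h) / h) = sin (pi * x / h) * cos (pi * j)"
    by (simp only: sin_diff sin_npi_int mult_zero_right diff_zero)
  thus ?thesis using assms by (simp add: sinc_basis_def)
qed

lemma sinc_basis_node:
  fixes h :: real
  assumes "h > 0"
  shows "sinc_basis j h (of_int i * h) = (if i = j then 1 else 0)"
proof -
  have "pi * (of_int i * h - of_int j * h) / h = pi * of_int (i - j)" using assms by (simp add: field_simps)
  moreover have "sin (pi * of_int (i - j)) = 0" by (rule sin_npi_int)
  ultimately show ?thesis unfolding sinc_basis_def by simp
qed

text \<open>
  The integrand has simple poles at \<open>x\<close> and at the nodes \<open>kh\<close> with \<open>|k| \<le> K\<close>. After multiplication by
  \<open>sin(\<pi>x/h)\<close> the residues are \<open>F(x)\<close> and \<open>- F(kh) S(k,h)(x)\<close>. The half-integer \<open>K + 1/2\<close> keeps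
  the vertical sides away from the nodes. If \<open>x\<close> is itself a node, both sides vanish.
\<close>

lemma cardinal_series_contour:
  fixes F :: "complex \<Rightarrow> complex" and h L x :: real
  assumes F: "F holomorphic_on strip d" and \<delta>: "0 < \<delta>" "\<delta> < d" and h: "h > 0"
    and L: "L = (real K + 1/2) * h" and x: "\<bar>x\<bar> < L"
  shows "of_real (sin (pi * x / h)) * rect_integral L \<delta> (\<lambda>z. F z / (sin (of_real pi * z / of_real h) * (z - of_real x)))
     = 2 * pi * \<i> * (F (of_real x) - (\<Sum>k\<in>{- int K..int K}. F (of_real (k * h)) * of_real (sinc_basis k h x)))"
proof (cases "\<exists>k::int. x = k * h")
  case True
  then obtain i :: int where i: "x = i * h" by blast
  have "\<bar>real_of_int i\<bar> * h < (real K + 1/2) * h" using x h by (simp add: i L abs_mult)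
  hence "\<bar>real_of_int i\<bar> < real K + 1/2" using h by simp
  hence iK: "i \<in> {- int K..int K}" by auto
  have "pi * x / h = pi * i" using h i by simp
  hence "sin (pi * x / h) = 0" by simp
  moreover have "(\<Sum>k\<in>{- int K..int K}. F (of_real (k * h)) * of_real (sinc_basis k h x)) =
     (\<Sum>k\<in>{- int K..int K}. if i = k then F (of_real (k * h)) else 0)"
    by (intro sum.cong refl) (simp add: i sinc_basis_node h)
  ultimately show ?thesis using iK by (simp add: i)
next
  case False
  define s where "s = (\<lambda>z::complex. sin (of_real pi * z / of_real h))"
  define f where "f = (\<lambda>z. F z / (s z * (z - of_real x)))"
  define S where "S = {z. \<bar>Re z\<bar> < (real K + 1) * h \<and> \<bar>Im z\<bar> < d}"
  define nodes where "nodes = (\<lambda>k::int. complex_of_real (k * h)) ` {- int K..int K}"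
  define g where "g = rectpath (Complex (- L) (- \<delta>)) (Complex L \<delta>)"
  have L0: "L > 0" using h by (simp add: L)
  have LK: "L < (real K + 1) * h" using h by (simp add: L)
  have Seq: "S = box (Complex (- ((real K + 1) * h)) (- d)) (Complex ((real K + 1) * h) d)"
    by (auto simp: S_def in_box_complex_iff abs_less_iff)
  have S: "open S" "connected S" unfolding Seq by (auto intro: convex_connected)
  have s0: "z \<in> nodes" if z: "z \<in> S" "s z = 0" for z
  proof -
    obtain k :: int where k: "z = of_real (k * h)" using z(2) complex_sin_scaled_eq_0[OF h, of z] by (auto simp: s_def)
    have "\<bar>real_of_int k\<bar> * h < (real K + 1) * h" using z(1) h by (simp add: k S_def abs_mult)
    hence "\<bar>real_of_int k\<bar> < real K + 1" using h by simp
    hence "k \<in> {- int K..int K}" by auto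
    thus ?thesis by (auto simp: nodes_def k)
  qed
  have holF: "F holomorphic_on S"
    using F by (rule holomorphic_on_subset) (auto simp: S_def strip_def)
  have hol: "f holomorphic_on S - insert (of_real x) nodes"
    unfolding f_def using s0
    by (intro holomorphic_intros holomorphic_on_subset[OF holF]) (auto simp: s_def intro!: holomorphic_intros)
  have fin: "finite nodes" by (simp add: nodes_def)
  have xnodes: "of_real x \<notin> nodes" using False by (auto simp: nodes_def simp del: of_real_mult)
  have img: "path_image g = rect_boundary L \<delta>"
    unfolding g_def by (intro path_image_rectpath_rect_boundary L0 \<delta>)
  have node_lt: "\<bar>real_of_int k * h\<bar> < L" if "k \<in> {- int K..int K}" for k
  proof -
    have "\<bar>real_of_int k\<bar> \<le> real K" using that by auto
    hence "\<bar>real_of_int k\<bar> * h < (real K + 1/2) * h" using h by (intro mult_strict_right_mono) auto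
    thus ?thesis using h by (simp add: L abs_mult)
  qed
  have inner: "p \<in> box (Complex (- L) (- \<delta>)) (Complex L \<delta>)" if p: "p \<in> insert (of_real x) nodes" for p
  proof -
    obtain u where "p = of_real u" "\<bar>u\<bar> < L" using p x node_lt by (auto simp: nodes_def simp del: of_real_mult)
    thus ?thesis using \<delta> by (auto simp: in_box_complex_iff abs_less_iff)
  qed
  have sub: "rect_boundary L \<delta> \<subseteq> S - insert (of_real x) nodes"
  proof -
    have "rect_boundary L \<delta> \<subseteq> S" using LK \<delta> by (auto simp: rect_boundary_def S_def)
    moreover have "p \<notin> rect_boundary L \<delta>" if "p \<in> insert (of_real x) nodes" for p
      using inner[OF that] by (auto simp: rect_boundary_def in_box_complex_iff)
    ultimately show ?thesis by blast
  qed
  have open_pt: "open (S - (insert (of_real x) nodes - {p}))" for p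
    using fin by (intro open_Diff S finite_imp_closed) auto
  have inS: "insert (of_real x) nodes \<subseteq> S"
    using inner LK \<delta> by (force simp: in_box_complex_iff S_def)
  have lim: "((\<lambda>w. f w * (w - p)) \<longlongrightarrow> c) (at p) \<Longrightarrow> p \<in> insert (of_real x) nodes \<Longrightarrow> residue f p = c" for p c
  proof (rule residue_simple'[OF open_pt[of p]])
    assume p: "p \<in> insert (of_real x) nodes"
    show "p \<in> S - (insert (of_real x) nodes - {p})" using p inS by auto
    show "f holomorphic_on S - (insert (of_real x) nodes - {p}) - {p}"
      using hol by (rule holomorphic_on_subset) auto
  qed
  have contF: "isCont F p" if "p \<in> S" for p
    using holomorphic_on_imp_continuous_on[OF holF] S(1) that continuous_on_eq_continuous_at by blast
  have resx: "residue f (of_real x) = F (of_real x) / s (of_real x)"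
  proof (rule lim)
    have sx: "s (of_real x) \<noteq> 0" using s0[of "of_real x"] inS xnodes by auto
    have "isCont (\<lambda>w. F w / s w) (of_real x)"
      using contF[of "of_real x"] inS sx unfolding s_def by (intro continuous_intros) auto
    hence "((\<lambda>w. F w / s w) \<longlongrightarrow> F (of_real x) / s (of_real x)) (at (of_real x))" by (simp add: isCont_def)
    thus "((\<lambda>w. f w * (w - of_real x)) \<longlongrightarrow> F (of_real x) / s (of_real x)) (at (of_real x))"
      by (rule Lim_transform_eventually) (auto simp: f_def eventually_at_filter)
  qed simp
  have resk: "residue f (of_real (k * h)) = F (of_real (k * h)) / of_real (k * h - x) * of_real (h * cos (pi * k) / pi)"
    if k: "k \<in> {- int K..int K}" for k :: int
  proof (rule lim)
    define p where "p = complex_of_real (k * h)"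
    have pn: "p \<in> nodes" using k by (auto simp: p_def nodes_def)
    have sq: "cos (pi * k) * cos (pi * k) = (1::real)"
      using sin_cos_squared_add[of "pi * k"] by (simp add: power2_eq_square)
    have c0: "cos (pi * real_of_int k) \<noteq> 0" using sq by auto
    have "of_real pi * p / of_real h = complex_of_real (pi * k)" using h by (simp add: p_def)
    hence ck: "cos (of_real pi * p / of_real h) = complex_of_real (cos (pi * k))" by (simp only: cos_of_real)
    have sp: "s p = 0" unfolding s_def using complex_sin_scaled_eq_0[OF h, of p] p_def by blast
    have "(s has_field_derivative cos (of_real pi * p / of_real h) * (of_real pi / of_real h)) (at p)"
      unfolding s_def using h by (auto intro!: derivative_eq_intros)
    hence "((\<lambda>w. (s w - s p) / (w - p)) \<longlongrightarrow> of_real (cos (pi * k) * pi / h)) (at p)"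
      by (simp add: has_field_derivative_iff ck)
    hence "((\<lambda>w. inverse ((s w - s p) / (w - p))) \<longlongrightarrow> inverse (of_real (cos (pi * k) * pi / h))) (at p)"
      by (rule tendsto_inverse) (use h c0 in auto)
    moreover have "((\<lambda>w. F w / (w - of_real x)) \<longlongrightarrow> F p / (p - of_real x)) (at p)"
      using contF[of p] pn inS xnodes unfolding isCont_def by (intro tendsto_intros) auto
    ultimately have "((\<lambda>w. F w / (w - of_real x) * inverse ((s w - s p) / (w - p))) \<longlongrightarrow>
        F p / (p - of_real x) * inverse (of_real (cos (pi * k) * pi / h))) (at p)"
      by (intro tendsto_mult)
    moreover have "inverse (cos (pi * k) * pi / h) = h * cos (pi * k) / pi"
      using h sq c0 by (simp add: field_simps)
    hence "inverse (complex_of_real (cos (pi * k) * pi / h)) = of_real (h * cos (pi * k) / pi)"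
      by (simp only: of_real_inverse[symmetric])
    ultimately have "((\<lambda>w. F w / (w - of_real x) * inverse ((s w - s p) / (w - p))) \<longlongrightarrow>
        F p / (p - of_real x) * of_real (h * cos (pi * k) / pi)) (at p)" by (simp only:)
    hence "((\<lambda>w. f w * (w - p)) \<longlongrightarrow> F p / (p - of_real x) * of_real (h * cos (pi * k) / pi)) (at p)"
      by (rule Lim_transform_eventually) (auto simp: f_def sp eventually_at_filter divide_simps)
    thus "((\<lambda>w. f w * (w - of_real (k * h))) \<longlongrightarrow> F (of_real (k * h)) / of_real (k * h - x) * of_real (h * cos (pi * k) / pi)) (at (of_real (k * h)))"
      by (simp add: p_def)
    show "complex_of_real (k * h) \<in> insert (of_real x) nodes" using pn by (simp add: p_def)
  qed
  have inj: "inj_on (\<lambda>k::int. complex_of_real (k * h)) {- int K..int K}"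
    using h by (auto intro!: inj_onI simp del: of_real_mult)
  have "contour_integral g f = 2 * pi * \<i> * (\<Sum>p\<in>insert (of_real x) nodes. winding_number g p * residue f p)"
  proof (rule Residue_theorem[OF S _ hol])
    show "\<forall>z. z \<notin> S \<longrightarrow> winding_number g z = 0"
    proof (intro allI impI)
      fix z assume "z \<notin> S"
      hence "z \<notin> cbox (Complex (- L) (- \<delta>)) (Complex L \<delta>)"
        using LK \<delta> by (auto simp: S_def in_cbox_complex_iff)
      thus "winding_number g z = 0"
        unfolding g_def using L0 \<delta> by (intro winding_number_rectpath_outside) auto
    qed
  qed (use fin sub img in \<open>auto simp: g_def\<close>)
  also have "(\<Sum>p\<in>insert (of_real x) nodes. winding_number g p * residue f p) = (\<Sum>p\<in>insert (of_real x) nodes. residue f p)"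
    using inner by (intro sum.cong refl) (auto simp: g_def winding_number_rectpath)
  also have "\<dots> = F (of_real x) / s (of_real x) + (\<Sum>k\<in>{- int K..int K}. F (of_real (k * h)) / of_real (k * h - x) * of_real (h * cos (pi * k) / pi))"
    using fin xnodes resx resk by (simp add: nodes_def sum.reindex[OF inj] del: of_real_mult of_real_diff)
  also have "contour_integral g f = rect_integral L \<delta> f"
    unfolding g_def using holomorphic_on_imp_continuous_on[OF hol] sub
    by (intro contour_integral_rectpath_eq L0 \<delta>) (rule continuous_on_subset)
  finally have main: "rect_integral L \<delta> f = 2 * pi * \<i> * (F (of_real x) / s (of_real x) +
     (\<Sum>k\<in>{- int K..int K}. F (of_real (k * h)) / of_real (k * h - x) * of_real (h * cos (pi * k) / pi)))" .
  have sx: "s (of_real x) = of_real (sin (pi * x / h))"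
  proof -
    have "of_real pi * of_real x / of_real h = complex_of_real (pi * x / h)" by simp
    thus ?thesis unfolding s_def by (simp only: sin_of_real)
  qed
  have sx0: "s (of_real x) \<noteq> 0" using s0[of "of_real x"] inS xnodes by auto
  have term_eq: "of_real (sin (pi * x / h)) * (F (of_real (k * h)) / of_real (k * h - x) * of_real (h * cos (pi * k) / pi))
      = - (F (of_real (k * h)) * of_real (sinc_basis k h x))" for k :: int
  proof -
    have ne: "x \<noteq> k * h" using False by blast
    have "sinc_basis k h x = - (sin (pi * x / h) * (1 / (k * h - x)) * (h * cos (pi * k) / pi))"
      unfolding sinc_basis_times[OF ne h] using ne by (simp add: divide_simps) (simp add: algebra_simps)
    thus ?thesis by (simp add: divide_inverse)
  qed
  have "of_real (sin (pi * x / h)) * rect_integral L \<delta> f = 2 * pi * \<i> *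
     (of_real (sin (pi * x / h)) * (F (of_real x) / s (of_real x)) +
      (\<Sum>k\<in>{- int K..int K}. of_real (sin (pi * x / h)) * (F (of_real (k * h)) / of_real (k * h - x) * of_real (h * cos (pi * k) / pi))))"
    unfolding main by (simp add: algebra_simps sum_distrib_left)
  also have "of_real (sin (pi * x / h)) * (F (of_real x) / s (of_real x)) = F (of_real x)"
    using sx0 by (simp add: sx[symmetric])
  finally show ?thesis unfolding term_eq by (simp add: f_def s_def sum_negf)
qed

lemma continuous_on_rect_sides:
  assumes "0 < L" "0 < \<delta>" and f: "continuous_on (rect_boundary L \<delta>) f"
  shows "\<bar>v\<bar> = \<delta> \<Longrightarrow> continuous_on {-L..L} (\<lambda>t. f (Complex t v))"
    and "\<bar>u\<bar> = L \<Longrightarrow> continuous_on {-\<delta>..\<delta>} (\<lambda>v. f (Complex u v))"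
proof -
  show "continuous_on {-L..L} (\<lambda>t. f (Complex t v))" if "\<bar>v\<bar> = \<delta>"
    using that assms(1,2)
    by (intro continuous_on_compose2[OF f]) (auto simp: rect_boundary_def Complex_eq intro!: continuous_intros)
  show "continuous_on {-\<delta>..\<delta>} (\<lambda>v. f (Complex u v))" if "\<bar>u\<bar> = L"
    using that assms(1,2)
    by (intro continuous_on_compose2[OF f]) (auto simp: rect_boundary_def Complex_eq intro!: continuous_intros)
qed

section \<open>Estimates on the rectangle\<close>

text \<open>
  Along each horizontal side the integral of \<open>1 / (1 + t\<^sup>2)\<close> is at most \<open>\<pi>\<close>, whatever \<open>L\<close> is.
\<close>

lemma norm_rect_integral_le:
  fixes f :: "complex \<Rightarrow> complex"
  assumes L: "0 < L" "0 < \<delta>" and f: "continuous_on (rect_boundary L \<delta>) f"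
    and hor: "\<And>t v. \<bar>v\<bar> = \<delta> \<Longrightarrow> \<bar>t\<bar> \<le> L \<Longrightarrow> norm (f (Complex t v)) \<le> a / (1 + t\<^sup>2)"
    and ver: "\<And>u v. \<bar>u\<bar> = L \<Longrightarrow> \<bar>v\<bar> \<le> \<delta> \<Longrightarrow> norm (f (Complex u v)) \<le> b"
  shows "norm (rect_integral L \<delta> f) \<le> 2 * pi * a + 4 * \<delta> * b"
proof -
  have "norm (f (Complex 0 \<delta>)) \<le> a / (1 + 0\<^sup>2)" using L by (intro hor) auto
  from order_trans[OF norm_ge_zero this] have a0: "a \<ge> 0" by simp
  have at: "((\<lambda>t. a / (1 + t\<^sup>2)) has_integral (a * arctan L - a * arctan (- L))) {-L..L}"
    using L by (intro fundamental_theorem_of_calculus)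
      (auto intro!: derivative_eq_intros simp: has_real_derivative_iff_has_vector_derivative[symmetric] field_simps add_nonneg_eq_0_iff)
  have h: "norm (integral {-L..L} (\<lambda>t. f (Complex t v))) \<le> pi * a" if v: "\<bar>v\<bar> = \<delta>" for v
  proof -
    have "norm (integral {-L..L} (\<lambda>t. f (Complex t v))) \<le> integral {-L..L} (\<lambda>t. a / (1 + t\<^sup>2))"
      using hor v continuous_on_rect_sides(1)[OF L f v]
      by (intro integral_norm_bound_integral integrable_continuous_real has_integral_integrable[OF at]) auto
    also have "\<dots> = a * (2 * arctan L)" using at by (simp add: integral_unique arctan_minus)
    also have "\<dots> \<le> a * pi" using a0 arctan_ubound[of L] by (intro mult_left_mono) auto
    finally show ?thesis by (simp add: mult.commute)
  qed
  have w: "norm (\<i> * integral {-\<delta>..\<delta>} (\<lambda>v. f (Complex u v))) \<le> 2 * \<delta> * b" if u: "\<bar>u\<bar> = L" for u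
  proof -
    have "norm (integral {-\<delta>..\<delta>} (\<lambda>v. f (Complex u v))) \<le> integral {-\<delta>..\<delta>} (\<lambda>v. b)"
      using ver u continuous_on_rect_sides(2)[OF L f u]
      by (intro integral_norm_bound_integral integrable_continuous_real) auto
    thus ?thesis using L by (simp add: norm_mult)
  qed
  have "norm (rect_integral L \<delta> f) \<le> pi * a + 2 * \<delta> * b + pi * a + 2 * \<delta> * b"
    unfolding rect_integral_def using L
    by (intro order_trans[OF norm_triangle_ineq4] order_trans[OF norm_triangle_ineq] add_mono h w) auto
  thus ?thesis by simp
qed

lemma rect_integral_cmult: "rect_integral L \<delta> (\<lambda>z. c * f z) = c * rect_integral L \<delta> f"
  unfolding rect_integral_def by (simp add: algebra_simps)

lemma integral_rect_integral_swap:
  fixes g :: "real \<Rightarrow> complex \<Rightarrow> complex"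
  assumes L: "0 < L" "0 < \<delta>"
    and g: "continuous_on ({a..x} \<times> rect_boundary L \<delta>) (\<lambda>(s, z). g s z)"
  shows "((\<lambda>s. rect_integral L \<delta> (g s)) has_integral
           rect_integral L \<delta> (\<lambda>z. integral {a..x} (\<lambda>s. g s z))) {a..x}"
proof -
  have side: "((\<lambda>s. integral {p..q} (\<lambda>t. g s (\<gamma> t))) has_integral
      integral {p..q} (\<lambda>t. integral {a..x} (\<lambda>s. g s (\<gamma> t)))) {a..x}"
    if \<gamma>: "continuous_on {p..q} \<gamma>" "\<gamma> ` {p..q} \<subseteq> rect_boundary L \<delta>" for p q :: real and \<gamma>
  proof -
    have c: "continuous_on (cbox (a, p) (x, q)) (\<lambda>y. g (fst y) (\<gamma> (snd y)))"
    proof -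
      have 1: "continuous_on ({a..x} \<times> {p..q}) (\<lambda>y. (fst y, \<gamma> (snd y)))"
        by (intro continuous_intros continuous_on_compose2[OF \<gamma>(1)]) auto
      have "continuous_on ({a..x} \<times> {p..q}) (\<lambda>y. (\<lambda>(s, z). g s z) (fst y, \<gamma> (snd y)))"
        by (rule continuous_on_compose2[OF g 1]) (use \<gamma>(2) in auto)
      thus ?thesis by (simp add: cbox_Pair_eq)
    qed
    have "(\<lambda>s. integral {p..q} (\<lambda>t. g s (\<gamma> t))) integrable_on {a..x}"
      using integral_integrable_2dim[OF c] by simp
    moreover have "integral {a..x} (\<lambda>s. integral {p..q} (\<lambda>t. g s (\<gamma> t))) =
        integral {p..q} (\<lambda>t. integral {a..x} (\<lambda>s. g s (\<gamma> t)))"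
      using integral_swap_continuous[of a p x q "\<lambda>s t. g s (\<gamma> t)"] c by (simp add: case_prod_beta)
    ultimately show ?thesis by (metis integrable_integral)
  qed
  show ?thesis
    unfolding rect_integral_def
    by (intro has_integral_add has_integral_diff has_integral_mult_right side)
       (use L in \<open>auto simp: Complex_eq rect_boundary_def intro!: continuous_intros\<close>)
qed

lemma exp_double_eq_sinh:
  fixes y :: real
  shows "exp (2 * y) + inverse (exp (2 * y)) = 4 * (sinh y)\<^sup>2 + 2"
proof -
  have "inverse (exp (2 * y)) = inverse (exp y) * inverse (exp y)" "exp (2 * y) = exp y * exp y"
    by (simp_all add: exp_double power2_eq_square)
  moreover have "4 * ((exp y - inverse (exp y)) / 2)\<^sup>2 = exp y * exp y + inverse (exp y) * inverse (exp y) - 2 * (exp y * inverse (exp y))"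
    by (simp add: power_divide) (simp add: power2_eq_square right_diff_distrib left_diff_distrib)
  ultimately show ?thesis by (simp add: sinh_field_def exp_minus)
qed

lemma norm_sin_ge_sinh:
  fixes z :: complex
  shows "norm (sin z) \<ge> \<bar>sinh (Im z)\<bar>"
proof -
  have "exp (2 * Im z) + inverse (exp (2 * Im z)) = 4 * (sinh (Im z))\<^sup>2 + 2"
    by (rule exp_double_eq_sinh)
  hence "(norm (sin z))\<^sup>2 = (sinh (Im z))\<^sup>2 + (1 - cos (2 * Re z)) / 2"
    by (simp add: norm_sin_squared)
  moreover have "cos (2 * Re z) \<le> 1" by simp
  ultimately have "(sinh (Im z))\<^sup>2 \<le> (norm (sin z))\<^sup>2" by simp
  thus ?thesis by (metis abs_le_square_iff abs_norm_cancel)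
qed

lemma norm_sin_half_integer_ge_one:
  fixes z :: complex
  assumes "\<bar>Re z\<bar> = pi * (real K + 1 / 2)"
  shows "norm (sin z) \<ge> 1"
proof -
  have "cos (2 * Re z) = cos \<bar>2 * Re z\<bar>" by (rule cos_abs_real[symmetric])
  also have "\<dots> = cos (2 * \<bar>Re z\<bar>)" by (simp only: abs_mult abs_numeral)
  also have "2 * \<bar>Re z\<bar> = 2 * real K * pi + pi" unfolding assms by (simp add: algebra_simps)
  also have "cos (2 * real K * pi + pi) = - 1" by (simp add: cos_add)
  finally have c: "cos (2 * Re z) = - 1" .
  have "exp (2 * Im z) + inverse (exp (2 * Im z)) = 4 * (sinh (Im z))\<^sup>2 + 2"
    by (rule exp_double_eq_sinh)
  hence "(norm (sin z))\<^sup>2 \<ge> 1\<^sup>2" by (simp add: norm_sin_squared c)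
  thus ?thesis by (rule power2_le_imp_le) simp
qed

lemma integral_one_over_dist_squared_le:
  fixes a x u v :: real
  assumes "a \<le> x" "v \<noteq> 0"
  shows "((\<lambda>s. 1 / ((s - u)\<^sup>2 + v\<^sup>2)) integrable_on {a..x})"
    and "integral {a..x} (\<lambda>s. 1 / ((s - u)\<^sup>2 + v\<^sup>2)) \<le> pi / \<bar>v\<bar>"
proof -
  define w where "w = \<bar>v\<bar>"
  have w: "w > 0" "v\<^sup>2 = w\<^sup>2" using assms by (auto simp: w_def)
  have pos: "(s - u)\<^sup>2 + w\<^sup>2 > 0" for s using w by (simp add: add_nonneg_pos)
  have der: "((\<lambda>s. arctan ((s - u) / w) / w) has_real_derivative 1 / ((s - u)\<^sup>2 + w\<^sup>2)) (at s within {a..x})" for s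
  proof -
    have "((\<lambda>s. arctan ((s - u) / w) / w) has_real_derivative inverse (1 + ((s - u) / w)\<^sup>2) * (1 / w) / w) (at s within {a..x})"
      using w by (auto intro!: derivative_eq_intros)
    moreover have "1 + ((s - u) / w)\<^sup>2 = ((s - u)\<^sup>2 + w\<^sup>2) / w\<^sup>2"
      using w by (simp add: power_divide add_divide_distrib)
    hence "inverse (1 + ((s - u) / w)\<^sup>2) * (1 / w) / w = 1 / ((s - u)\<^sup>2 + w\<^sup>2)"
      using w by (simp add: power2_eq_square)
    ultimately show ?thesis by simp
  qed
  have int: "((\<lambda>s. 1 / ((s - u)\<^sup>2 + w\<^sup>2)) has_integral (arctan ((x - u) / w) / w - arctan ((a - u) / w) / w)) {a..x}"
    using der assms(1) by (intro fundamental_theorem_of_calculus) (auto simp: has_real_derivative_iff_has_vector_derivative)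
  show "((\<lambda>s. 1 / ((s - u)\<^sup>2 + v\<^sup>2)) integrable_on {a..x})" using int w by auto
  have "arctan ((x - u) / w) - arctan ((a - u) / w) \<le> pi"
    using arctan_ubound[of "(x - u) / w"] arctan_lbound[of "(a - u) / w"] by linarith
  hence "arctan ((x - u) / w) / w - arctan ((a - u) / w) / w \<le> pi / w"
    using w by (simp add: diff_divide_distrib[symmetric] divide_right_mono)
  thus "integral {a..x} (\<lambda>s. 1 / ((s - u)\<^sup>2 + v\<^sup>2)) \<le> pi / \<bar>v\<bar>"
    unfolding w_def[symmetric] w(2) integral_unique[OF int] .
qed

text \<open>
  Integration by parts transfers the oscillation into a factor \<open>h/\<pi>\<close> and leaves \<open>1 / |z - s|\<^sup>2\<close>, whose
  integral over the real line is \<open>\<pi> / |Im z|\<close>. The bound does not depend on the length of the interval, which is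
  why the indefinite integration formula has no logarithmic loss.
\<close>

lemma oscillatory_cauchy_kernel_le:
  fixes z :: complex
  assumes h: "h > 0" and ax: "a \<le> x" and z: "Im z \<noteq> 0"
  shows "norm (integral {a..x} (\<lambda>s. of_real (sin (pi * s / h)) / (z - of_real s))) \<le> 2 * h / \<bar>Im z\<bar>"
proof -
  define v where "v = \<bar>Im z\<bar>"
  have v: "v > 0" using z by (simp add: v_def)
  have ne: "z - of_real s \<noteq> 0" for s
  proof
    assume "z - of_real s = 0"
    hence "Im (z - of_real s) = 0" by simp
    thus False using z by simp
  qed
  have ge: "norm (z - of_real s) \<ge> v" for s
    using abs_Im_le_cmod[of "z - of_real s"] by (simp add: v_def)
  define P where "P = (\<lambda>s. - of_real (h / pi * cos (pi * s / h)) / (z - of_real s))"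
  define Q where "Q = (\<lambda>s. of_real (h / pi * cos (pi * s / h)) / (z - of_real s)\<^sup>2)"
  have der: "(P has_vector_derivative of_real (sin (pi * s / h)) / (z - of_real s) - Q s) (at s within {a..x})" for s
  proof -
    have c: "((\<lambda>s. - (h / pi * cos (pi * s / h))) has_real_derivative sin (pi * s / h)) (at s within {a..x})"
      using h by (auto intro!: derivative_eq_intros)
    hence c': "((\<lambda>s. complex_of_real (- (h / pi * cos (pi * s / h)))) has_vector_derivative of_real (sin (pi * s / h))) (at s within {a..x})"
      by (rule has_vector_derivative_of_real)
    have i: "((\<lambda>s. inverse (z - of_real s)) has_vector_derivative inverse ((z - of_real s)\<^sup>2)) (at s within {a..x})"
    proof -
      have "((\<lambda>w. inverse (z - w)) has_field_derivative inverse ((z - of_real s)\<^sup>2)) (at (of_real s))"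
        using ne[of s] by (auto intro!: derivative_eq_intros simp: power2_eq_square)
      moreover have "(complex_of_real has_vector_derivative 1) (at s within {a..x})"
        using has_vector_derivative_of_real[OF DERIV_ident] by simp
      ultimately show ?thesis
        using field_vector_diff_chain_within[of of_real 1 s "{a..x}" "\<lambda>w. inverse (z - w)"]
        by (simp add: o_def has_field_derivative_at_within)
    qed
    from has_vector_derivative_mult[OF c' i] show ?thesis
      unfolding P_def Q_def by (simp add: divide_inverse algebra_simps)
  qed
  have intP: "((\<lambda>s. of_real (sin (pi * s / h)) / (z - of_real s) - Q s) has_integral (P x - P a)) {a..x}"
    by (rule fundamental_theorem_of_calculus[OF ax]) (rule der)
  have contQ: "continuous_on {a..x} Q" unfolding Q_def using ne by (intro continuous_intros) (auto simp: h less_imp_neq[OF h, symmetric])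
  have intQ: "(Q has_integral integral {a..x} Q) {a..x}"
    using contQ by (simp add: integrable_continuous_real integrable_integral)
  have "integral {a..x} (\<lambda>s. of_real (sin (pi * s / h)) / (z - of_real s)) = P x - P a + integral {a..x} Q"
    using has_integral_add[OF intP intQ] by (simp add: integral_unique)
  moreover have P: "norm (P s) \<le> h / pi / v" for s
  proof -
    have "norm (P s) = h / pi * \<bar>cos (pi * s / h)\<bar> / norm (z - of_real s)"
      unfolding P_def using h by (simp add: norm_divide norm_mult abs_mult)
    also have "\<dots> \<le> h / pi * 1 / v" using h v ge[of s] by (intro frac_le mult_left_mono) auto
    finally show ?thesis by simp
  qed
  moreover have "norm (integral {a..x} Q) \<le> h / v"
  proof -
    have "norm (integral {a..x} Q) \<le> integral {a..x} (\<lambda>s. h / pi * (1 / ((s - Re z)\<^sup>2 + (Im z)\<^sup>2)))"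
    proof (rule integral_norm_bound_integral)
      show "Q integrable_on {a..x}" using intQ by auto
      show "(\<lambda>s. h / pi * (1 / ((s - Re z)\<^sup>2 + (Im z)\<^sup>2))) integrable_on {a..x}"
        using integral_one_over_dist_squared_le(1)[OF ax z, of "Re z"] by (rule integrable_on_mult_right)
      fix s
      have "(norm (z - of_real s))\<^sup>2 = (s - Re z)\<^sup>2 + (Im z)\<^sup>2"
        by (simp add: cmod_power2 power2_commute)
      hence "norm (Q s) = h / pi * \<bar>cos (pi * s / h)\<bar> * (1 / ((s - Re z)\<^sup>2 + (Im z)\<^sup>2))"
        unfolding Q_def using h by (simp add: norm_divide norm_mult abs_mult norm_power)
      also have "\<dots> \<le> h / pi * 1 * (1 / ((s - Re z)\<^sup>2 + (Im z)\<^sup>2))"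
        using h by (intro mult_right_mono mult_left_mono) auto
      finally show "norm (Q s) \<le> h / pi * (1 / ((s - Re z)\<^sup>2 + (Im z)\<^sup>2))" by simp
    qed
    also have "\<dots> = h / pi * integral {a..x} (\<lambda>s. 1 / ((s - Re z)\<^sup>2 + (Im z)\<^sup>2))" by (rule integral_mult_right)
    also have "\<dots> \<le> h / pi * (pi / v)"
      unfolding v_def using integral_one_over_dist_squared_le(2)[OF ax z, of "Re z"] h by (intro mult_left_mono) auto
    finally show ?thesis by simp
  qed
  ultimately have "norm (integral {a..x} (\<lambda>s. of_real (sin (pi * s / h)) / (z - of_real s))) \<le> h / pi / v + h / pi / v + h / v"
    by (smt (verit) norm_triangle_ineq norm_triangle_ineq4)
  also have "h / pi / v + h / pi / v \<le> h / v"
    using h v pi_gt3 by (simp add: field_simps)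
  finally show ?thesis by (simp add: v_def)
qed

lemma sin_scaled_bounds_on_rect_boundary:
  fixes z :: complex
  assumes z: "z \<in> rect_boundary L \<delta>" and h: "h > 0" and \<delta>: "\<delta> > 0" and L: "L = (real K + 1/2) * h"
  shows "\<bar>Im z\<bar> = \<delta> \<Longrightarrow> sinh (pi * \<delta> / h) \<le> norm (sin (of_real pi * z / of_real h))"
    and "\<bar>Re z\<bar> = L \<Longrightarrow> 1 \<le> norm (sin (of_real pi * z / of_real h))"
    and "sin (of_real pi * z / of_real h) \<noteq> 0"
proof -
  let ?w = "of_real pi * z / of_real h"
  have re: "Re ?w = pi * Re z / h" and im: "Im ?w = pi * Im z / h"
    by (simp_all add: Re_divide_of_real Im_divide_of_real)
  have sinh_abs: "\<bar>sinh u\<bar> = sinh \<bar>u\<bar>" for u :: real by (simp add: abs_if)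
  show 1: "sinh (pi * \<delta> / h) \<le> norm (sin ?w)" if "\<bar>Im z\<bar> = \<delta>"
  proof -
    have "\<bar>sinh (Im ?w)\<bar> = sinh (pi * \<delta> / h)"
      unfolding sinh_abs im using that h by (simp add: abs_mult)
    thus ?thesis using norm_sin_ge_sinh[of ?w] by linarith
  qed
  show 2: "1 \<le> norm (sin ?w)" if "\<bar>Re z\<bar> = L"
  proof -
    have "\<bar>Re ?w\<bar> = pi * (real K + 1 / 2)"
      unfolding re using that h by (simp add: abs_mult L)
    thus ?thesis by (rule norm_sin_half_integer_ge_one)
  qed
  have "sinh (pi * \<delta> / h) > 0" using h \<delta> by simp
  thus "sin ?w \<noteq> 0" using z 1 2 by (force simp: rect_boundary_def)
qed

text \<open>
  A common estimate for interpolation and integration: they differ only in the kernel \<open>T\<close>, which is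
  \<open>1 / (z - x)\<close> in the former and the integrated oscillating kernel in the latter.
\<close>

lemma norm_rect_integral_cardinal_le:
  fixes F T :: "complex \<Rightarrow> complex"
  assumes F: "F holomorphic_on strip d" and \<delta>: "0 < \<delta>" "\<delta> < d" and h: "h > 0"
    and L: "L = (real K + 1/2) * h"
    and decay: "\<And>z. z \<in> strip d \<Longrightarrow> norm (F z) \<le> A / (1 + (Re z)\<^sup>2)"
    and T: "continuous_on (rect_boundary L \<delta>) T"
    and hor: "\<And>z. z \<in> rect_boundary L \<delta> \<Longrightarrow> \<bar>Im z\<bar> = \<delta> \<Longrightarrow> norm (T z) \<le> a"
    and ver: "\<And>z. z \<in> rect_boundary L \<delta> \<Longrightarrow> \<bar>Re z\<bar> = L \<Longrightarrow> norm (T z) \<le> b"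
  shows "norm (rect_integral L \<delta> (\<lambda>z. F z / sin (of_real pi * z / of_real h) * T z))
     \<le> 2 * pi * (A * a / sinh (pi * \<delta> / h)) + 4 * \<delta> * (A / L\<^sup>2 * b)"
proof -
  let ?s = "\<lambda>z::complex. sin (of_real pi * z / of_real h)"
  have L0: "L > 0" using h by (simp add: L)
  have sub: "rect_boundary L \<delta> \<subseteq> strip d" using \<delta> by (auto simp: rect_boundary_def strip_def)
  note s = sin_scaled_bounds_on_rect_boundary[OF _ h \<delta>(1) L]
  have sh: "sinh (pi * \<delta> / h) > 0" using h \<delta> by simp
  have A: "A \<ge> 0"
  proof -
    have "norm (F 0) \<le> A / (1 + (Re 0)\<^sup>2)" using \<delta> by (intro decay) (auto simp: strip_def)
    from order_trans[OF norm_ge_zero this] show ?thesis by simp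
  qed
  show ?thesis
  proof (rule norm_rect_integral_le[OF L0 \<delta>(1)])
    have "continuous_on (rect_boundary L \<delta>) F"
      using holomorphic_on_imp_continuous_on[OF F] sub by (rule continuous_on_subset)
    moreover have "continuous_on (rect_boundary L \<delta>) ?s" using h by (intro continuous_intros) auto
    ultimately show "continuous_on (rect_boundary L \<delta>) (\<lambda>z. F z / ?s z * T z)"
      using T s(3) by (intro continuous_intros) auto
  next
    fix t v assume tv: "\<bar>v\<bar> = \<delta>" "\<bar>t\<bar> \<le> L"
    define z where "z = Complex t v"
    have z: "z \<in> rect_boundary L \<delta>" "\<bar>Im z\<bar> = \<delta>" "Re z = t" using tv by (auto simp: z_def rect_boundary_def)
    have "norm (F z / ?s z * T z) = norm (F z) / norm (?s z) * norm (T z)"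
      by (simp add: norm_mult norm_divide)
    also have "\<dots> \<le> (A / (1 + t\<^sup>2)) / sinh (pi * \<delta> / h) * a"
      using decay[of z] z sub s(1)[OF z(1)] sh hor[OF z(1)] A
      by (intro mult_mono frac_le) auto
    also have "\<dots> = A * a / sinh (pi * \<delta> / h) / (1 + t\<^sup>2)" by (simp add: mult_ac)
    finally show "norm (F (Complex t v) / ?s (Complex t v) * T (Complex t v)) \<le> A * a / sinh (pi * \<delta> / h) / (1 + t\<^sup>2)"
      unfolding z_def .
  next
    fix u v assume uv: "\<bar>u\<bar> = L" "\<bar>v\<bar> \<le> \<delta>"
    define z where "z = Complex u v"
    have z: "z \<in> rect_boundary L \<delta>" "\<bar>Re z\<bar> = L" using uv by (auto simp: z_def rect_boundary_def)
    have "(Re z)\<^sup>2 = L\<^sup>2" using z(2) by (metis power2_abs)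
    hence "norm (F z) \<le> A / (1 + L\<^sup>2)" using decay[of z] z sub by auto
    also have "\<dots> \<le> A / L\<^sup>2" using A L0 by (intro divide_left_mono) (auto intro!: mult_pos_pos add_pos_pos)
    finally have Fz: "norm (F z) \<le> A / L\<^sup>2" .
    have "norm (F z / ?s z * T z) = norm (F z) / norm (?s z) * norm (T z)"
      by (simp add: norm_mult norm_divide)
    also have "\<dots> \<le> (A / L\<^sup>2) / 1 * b"
      using Fz z s(2)[OF z(1)] ver[OF z(1)] A L0 by (intro mult_mono frac_le) auto
    finally show "norm (F (Complex u v) / ?s (Complex u v) * T (Complex u v)) \<le> A / L\<^sup>2 * b"
      unfolding z_def by simp
  qed
qed

lemma rect_boundary_dist_real_ge:
  assumes "z \<in> rect_boundary L \<delta>" "\<bar>x\<bar> + 1 \<le> L" "\<delta> > 0"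
  shows "\<bar>Im z\<bar> = \<delta> \<Longrightarrow> \<delta> \<le> norm (z - of_real x)" "\<bar>Re z\<bar> = L \<Longrightarrow> 1 \<le> norm (z - of_real x)"
    "z - of_real x \<noteq> 0"
proof -
  show 1: "\<delta> \<le> norm (z - of_real x)" if "\<bar>Im z\<bar> = \<delta>"
    using that abs_Im_le_cmod[of "z - of_real x"] by simp
  show 2: "1 \<le> norm (z - of_real x)" if "\<bar>Re z\<bar> = L"
    using that abs_Re_le_cmod[of "z - of_real x"] assms(2) by simp
  show "z - of_real x \<noteq> 0" using 1 2 assms by (auto simp: rect_boundary_def)
qed

lemma cardinal_interpolation_partial:
  fixes F :: "complex \<Rightarrow> complex" and h L x :: real
  assumes F: "F holomorphic_on strip d" and \<delta>: "0 < \<delta>" "\<delta> < d" and h: "h > 0"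
    and L: "L = (real K + 1/2) * h" and x: "\<bar>x\<bar> + 1 \<le> L"
    and decay: "\<And>z. z \<in> strip d \<Longrightarrow> norm (F z) \<le> A / (1 + (Re z)\<^sup>2)"
  shows "norm (F (of_real x) - (\<Sum>k\<in>{- int K..int K}. F (of_real (k * h)) * of_real (sinc_basis k h x)))
     \<le> A / (\<delta> * sinh (pi * \<delta> / h)) + \<delta> * A / L\<^sup>2"
proof -
  let ?E = "F (of_real x) - (\<Sum>k\<in>{- int K..int K}. F (of_real (k * h)) * of_real (sinc_basis k h x))"
  let ?R = "rect_integral L \<delta> (\<lambda>z. F z / sin (of_real pi * z / of_real h) * (1 / (z - of_real x)))"
  have A: "A \<ge> 0"
  proof -
    have "norm (F 0) \<le> A / (1 + (Re 0)\<^sup>2)" using \<delta> by (intro decay) (auto simp: strip_def)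
    from order_trans[OF norm_ge_zero this] show ?thesis by simp
  qed
  have L0: "L > 0" using h by (simp add: L)
  have R: "norm ?R \<le> 2 * pi * (A * (1 / \<delta>) / sinh (pi * \<delta> / h)) + 4 * \<delta> * (A / L\<^sup>2 * 1)"
  proof (rule norm_rect_integral_cardinal_le[OF F \<delta> h L decay])
    show "continuous_on (rect_boundary L \<delta>) (\<lambda>z. 1 / (z - of_real x))"
      using rect_boundary_dist_real_ge(3)[OF _ x \<delta>(1)] by (intro continuous_intros) auto
  next
    fix z assume z: "z \<in> rect_boundary L \<delta>"
    note g = rect_boundary_dist_real_ge[OF z x \<delta>(1)]
    show "norm (1 / (z - of_real x)) \<le> 1 / \<delta>" if "\<bar>Im z\<bar> = \<delta>"
      using g(1)[OF that] \<delta> by (simp add: norm_divide frac_le)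
    show "norm (1 / (z - of_real x)) \<le> 1" if "\<bar>Re z\<bar> = L"
      using g(2)[OF that] by (simp add: norm_divide divide_le_eq)
  qed
  have "of_real (sin (pi * x / h)) * ?R = 2 * pi * \<i> * ?E"
    using cardinal_series_contour[OF F \<delta> h L, of x] x by simp
  hence "norm (of_real (sin (pi * x / h)) * ?R) = norm (2 * pi * \<i> * ?E)" by simp
  hence "2 * pi * norm ?E = \<bar>sin (pi * x / h)\<bar> * norm ?R" by (simp add: norm_mult)
  also have "\<dots> \<le> 1 * norm ?R" by (intro mult_right_mono) auto
  also have "\<dots> \<le> 2 * pi * (A * (1 / \<delta>) / sinh (pi * \<delta> / h)) + 4 * \<delta> * (A / L\<^sup>2 * 1)" using R by simp
  also have "4 * \<delta> * (A / L\<^sup>2 * 1) \<le> 2 * pi * (\<delta> * A / L\<^sup>2)"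
  proof -
    have "4 * (\<delta> * A / L\<^sup>2) \<le> 2 * pi * (\<delta> * A / L\<^sup>2)"
      using pi_gt3 A \<delta> by (intro mult_right_mono) auto
    thus ?thesis by simp
  qed
  finally have "2 * pi * norm ?E \<le> 2 * pi * (A * (1 / \<delta>) / sinh (pi * \<delta> / h) + \<delta> * A / L\<^sup>2)"
    by (simp add: distrib_left)
  hence "norm ?E \<le> A * (1 / \<delta>) / sinh (pi * \<delta> / h) + \<delta> * A / L\<^sup>2"
    by (rule mult_left_le_imp_le) simp
  thus ?thesis by simp
qed

text \<open>
  The contour formula is integrated over \<open>[a, x]\<close>; Fubini's theorem moves this integral onto the kernel.
\<close>

lemma cardinal_integration_partial:
  fixes F :: "complex \<Rightarrow> complex" and h L a x B :: real
  assumes F: "F holomorphic_on strip d" and \<delta>: "0 < \<delta>" "\<delta> < d" and h: "h > 0"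
    and L: "L = (real K + 1/2) * h" and ax: "a \<le> x" and aL: "\<bar>a\<bar> + 1 \<le> L" "\<bar>x\<bar> + 1 \<le> L"
    and decay: "\<And>z. z \<in> strip d \<Longrightarrow> norm (F z) \<le> A / (1 + (Re z)\<^sup>2)"
  shows "norm (integral {a..x} (\<lambda>s. F (of_real s)) - (\<Sum>k\<in>{- int K..int K}. F (of_real (k * h)) *
        of_real (h / pi * (Si (pi * (x - k * h) / h) - Si (pi * (a - k * h) / h)))))
     \<le> 2 * A * h / (\<delta> * sinh (pi * \<delta> / h)) + \<delta> * (x - a) * A / L\<^sup>2"
proof -
  let ?J = "\<lambda>k::int. complex_of_real (h / pi * (Si (pi * (x - k * h) / h) - Si (pi * (a - k * h) / h)))"
  let ?E = "integral {a..x} (\<lambda>s. F (of_real s)) - (\<Sum>k\<in>{- int K..int K}. F (of_real (k * h)) * ?J k)"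
  let ?s = "\<lambda>z::complex. sin (of_real pi * z / of_real h)"
  define T where "T = (\<lambda>z::complex. integral {a..x} (\<lambda>s. of_real (sin (pi * s / h)) / (z - of_real s)))"
  define g where "g = (\<lambda>(s::real) z. complex_of_real (sin (pi * s / h)) * (F z / (?s z * (z - of_real s))))"
  have A: "A \<ge> 0"
  proof -
    have "norm (F 0) \<le> A / (1 + (Re 0)\<^sup>2)" using \<delta> by (intro decay) (auto simp: strip_def)
    from order_trans[OF norm_ge_zero this] show ?thesis by simp
  qed
  have L0: "L > 0" using h by (simp add: L)
  have sL: "\<bar>s\<bar> + 1 \<le> L" if "s \<in> {a..x}" for s using that aL by auto
  have sub: "rect_boundary L \<delta> \<subseteq> strip d" using \<delta> by (auto simp: rect_boundary_def strip_def)
  have s0: "?s z \<noteq> 0" if "z \<in> rect_boundary L \<delta>" for z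
    using sin_scaled_bounds_on_rect_boundary(3)[OF that h \<delta>(1) L] .
  have zs: "z - of_real s \<noteq> 0" if "z \<in> rect_boundary L \<delta>" "s \<in> {a..x}" for z s
    using rect_boundary_dist_real_ge(3)[OF that(1) sL[OF that(2)] \<delta>(1)] .
  have contT: "continuous_on (rect_boundary L \<delta>) T"
  proof -
    have "continuous_on (rect_boundary L \<delta> \<times> cbox a x)
        (\<lambda>(z, s). complex_of_real (sin (pi * s / h)) / (z - of_real s))"
    proof -
      have "\<forall>p\<in>rect_boundary L \<delta> \<times> cbox a x. fst p - complex_of_real (snd p) \<noteq> 0"
        using zs by (metis mem_Times_iff box_real(2))
      thus ?thesis using h unfolding case_prod_beta by (intro continuous_intros) auto
    qed
    from integral_continuous_on_param[OF this] show ?thesis by (simp add: T_def)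
  qed
  have contg: "continuous_on ({a..x} \<times> rect_boundary L \<delta>) (\<lambda>(s, z). g s z)"
  proof -
    have "continuous_on (rect_boundary L \<delta>) F"
      using holomorphic_on_imp_continuous_on[OF F] sub by (rule continuous_on_subset)
    hence "continuous_on ({a..x} \<times> rect_boundary L \<delta>) (\<lambda>p. F (snd p))"
      by (rule continuous_on_compose2) (auto intro: continuous_intros)
    moreover have "\<forall>p\<in>{a..x} \<times> rect_boundary L \<delta>. ?s (snd p) * (snd p - complex_of_real (fst p)) \<noteq> 0"
      using zs s0 by (metis mem_Times_iff no_zero_divisors)
    ultimately show ?thesis unfolding g_def case_prod_beta using h
      by (intro continuous_intros) auto
  qed
  have gT: "integral {a..x} (\<lambda>s. g s z) = F z / ?s z * T z" for z
  proof -
    have "(\<lambda>s. g s z) = (\<lambda>s. F z / ?s z * (of_real (sin (pi * s / h)) / (z - of_real s)))"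
      by (auto simp: g_def)
    thus ?thesis unfolding T_def by (simp only: integral_mult_right)
  qed
  have res: "rect_integral L \<delta> (g s) = 2 * pi * \<i> * (F (of_real s) - (\<Sum>k\<in>{- int K..int K}. F (of_real (k * h)) * of_real (sinc_basis k h s)))"
    if "s \<in> {a..x}" for s
    using cardinal_series_contour[OF F \<delta> h L, of s] sL[OF that] unfolding g_def rect_integral_cmult by simp
  have "((\<lambda>s. rect_integral L \<delta> (g s)) has_integral rect_integral L \<delta> (\<lambda>z. F z / ?s z * T z)) {a..x}"
    using integral_rect_integral_swap[OF L0 \<delta>(1) contg] by (simp add: gT)
  hence 1: "((\<lambda>s. 2 * pi * \<i> * (F (of_real s) - (\<Sum>k\<in>{- int K..int K}. F (of_real (k * h)) * of_real (sinc_basis k h s)))) has_integral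
      rect_integral L \<delta> (\<lambda>z. F z / ?s z * T z)) {a..x}"
    by (rule has_integral_eq[rotated]) (simp add: res)
  have contF: "continuous_on {a..x} (\<lambda>s. F (of_real s))"
    by (rule continuous_on_compose2[OF holomorphic_on_imp_continuous_on[OF F]])
       (use \<delta> in \<open>auto simp: strip_def intro: continuous_intros\<close>)
  have 2: "((\<lambda>s. 2 * pi * \<i> * (F (of_real s) - (\<Sum>k\<in>{- int K..int K}. F (of_real (k * h)) * of_real (sinc_basis k h s)))) has_integral
      2 * pi * \<i> * ?E) {a..x}"
  proof (intro has_integral_mult_right has_integral_diff has_integral_sum)
    show "((\<lambda>s. F (of_real s)) has_integral integral {a..x} (\<lambda>s. F (of_real s))) {a..x}"
      using contF by (simp add: integrable_continuous_real integrable_integral)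
    show "((\<lambda>s. complex_of_real (sinc_basis k h s)) has_integral ?J k) {a..x}" for k
      by (intro has_integral_of_real has_integral_sinc_basis h ax)
  qed auto
  have eq: "2 * pi * \<i> * ?E = rect_integral L \<delta> (\<lambda>z. F z / ?s z * T z)"
    using has_integral_unique[OF 2 1] .
  have R: "norm (rect_integral L \<delta> (\<lambda>z. F z / ?s z * T z))
      \<le> 2 * pi * (A * (2 * h / \<delta>) / sinh (pi * \<delta> / h)) + 4 * \<delta> * (A / L\<^sup>2 * (x - a))"
  proof (rule norm_rect_integral_cardinal_le[OF F \<delta> h L decay contT])
    fix z assume z: "z \<in> rect_boundary L \<delta>"
    show "norm (T z) \<le> 2 * h / \<delta>" if "\<bar>Im z\<bar> = \<delta>"
      using oscillatory_cauchy_kernel_le[OF h ax, of z] that \<delta> by (auto simp: T_def)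
    show "norm (T z) \<le> x - a" if r: "\<bar>Re z\<bar> = L"
    proof -
      have "norm (T z) \<le> integral {a..x} (\<lambda>s. 1)"
        unfolding T_def
      proof (rule integral_norm_bound_integral)
        show "(\<lambda>s. complex_of_real (sin (pi * s / h)) / (z - of_real s)) integrable_on {a..x}"
          using zs[OF z] h by (intro integrable_continuous_real continuous_intros) auto
        fix s assume s: "s \<in> {a..x}"
        have "norm (complex_of_real (sin (pi * s / h)) / (z - of_real s)) = \<bar>sin (pi * s / h)\<bar> / norm (z - of_real s)"
          by (simp add: norm_divide)
        also have "\<dots> \<le> 1 / 1"
          using rect_boundary_dist_real_ge(2)[OF z sL[OF s] \<delta>(1) r] by (intro frac_le) auto
        finally show "norm (complex_of_real (sin (pi * s / h)) / (z - of_real s)) \<le> 1" by simp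
      qed auto
      thus ?thesis using ax by simp
    qed
  qed
  have "2 * pi * norm ?E = norm (2 * pi * \<i> * ?E)" by (simp only: norm_mult) simp
  also have "\<dots> \<le> 2 * pi * (A * (2 * h / \<delta>) / sinh (pi * \<delta> / h)) + 4 * \<delta> * (A / L\<^sup>2 * (x - a))"
    using R unfolding eq .
  also have "4 * \<delta> * (A / L\<^sup>2 * (x - a)) \<le> 2 * pi * (\<delta> * (x - a) * A / L\<^sup>2)"
  proof -
    have "4 * (\<delta> * (x - a) * A / L\<^sup>2) \<le> 2 * pi * (\<delta> * (x - a) * A / L\<^sup>2)"
      using pi_gt3 A \<delta> ax by (intro mult_right_mono) auto
    thus ?thesis by (simp add: mult_ac)
  qed
  finally have "2 * pi * norm ?E \<le> 2 * pi * (A * (2 * h / \<delta>) / sinh (pi * \<delta> / h) + \<delta> * (x - a) * A / L\<^sup>2)"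
    by (simp add: distrib_left)
  hence "norm ?E \<le> A * (2 * h / \<delta>) / sinh (pi * \<delta> / h) + \<delta> * (x - a) * A / L\<^sup>2"
    by (rule mult_left_le_imp_le) simp
  thus ?thesis by (simp add: mult_ac)
qed

section \<open>Truncated Sinc approximation in a strip\<close>

text \<open>
  A function holomorphic in the open strip need not extend to the boundary. Therefore the contours stay inside;
  their length grows first (\<open>K \<longrightarrow> \<infinity>\<close>) and their half-width \<open>\<delta>\<close> tends to \<open>d\<close> afterwards.
\<close>

lemma le_if_le_on_rectangles:
  fixes X c b T h d :: real
  assumes d: "d > 0" and h: "h > 0"
    and le: "\<And>\<delta> K. 0 < \<delta> \<Longrightarrow> \<delta> < d \<Longrightarrow> K \<ge> K0 \<Longrightarrow>
      X \<le> c / (\<delta> * sinh (pi * \<delta> / h)) + \<delta> * b / ((real K + 1/2) * h)\<^sup>2 + T"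
  shows "X \<le> c / (d * sinh (pi * d / h)) + T"
proof -
  have 1: "X \<le> c / (\<delta> * sinh (pi * \<delta> / h)) + T" if \<delta>: "0 < \<delta>" "\<delta> < d" for \<delta>
  proof (rule tendsto_lowerbound)
    have "((\<lambda>K. c / (\<delta> * sinh (pi * \<delta> / h)) + \<delta> * b / ((real K + 1/2) * h)\<^sup>2 + T) \<longlongrightarrow>
        c / (\<delta> * sinh (pi * \<delta> / h)) + 0 + T) sequentially"
    proof (intro tendsto_add tendsto_const)
      show "(\<lambda>K. \<delta> * b / ((real K + 1/2) * h)\<^sup>2) \<longlonglongrightarrow> 0"
        using h by real_asymp
    qed
    thus "((\<lambda>K. c / (\<delta> * sinh (pi * \<delta> / h)) + \<delta> * b / ((real K + 1/2) * h)\<^sup>2 + T) \<longlongrightarrow>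
        c / (\<delta> * sinh (pi * \<delta> / h)) + T) sequentially" by simp
    show "\<forall>\<^sub>F K in sequentially. X \<le> c / (\<delta> * sinh (pi * \<delta> / h)) + \<delta> * b / ((real K + 1/2) * h)\<^sup>2 + T"
      using eventually_ge_at_top[of K0] by eventually_elim (use le \<delta> in auto)
  qed simp
  show ?thesis
  proof (rule tendsto_lowerbound)
    show "((\<lambda>\<delta>. c / (\<delta> * sinh (pi * \<delta> / h)) + T) \<longlongrightarrow> c / (d * sinh (pi * d / h)) + T) (at_left d)"
      using d h by (intro tendsto_intros) auto
    show "\<forall>\<^sub>F \<delta> in at_left d. X \<le> c / (\<delta> * sinh (pi * \<delta> / h)) + T"
      using eventually_at_left_real[OF d] by eventually_elim (use 1 in auto)
  qed simp
qed

lemma sum_window_split: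
  fixes F :: "int \<Rightarrow> complex"
  assumes "K \<ge> max M N"
  shows "(\<Sum>k\<in>{- int K..int K}. F k) = (\<Sum>k\<in>{- int M..int N}. F k) + (\<Sum>k\<in>{- int K..int K} - {- int M..int N}. F k)"
  using assms by (subst add.commute, intro sum.subset_diff) auto

text \<open>
  The dropped terms enter only through the bound \<open>T\<close> for sums over nodes outside the window, since
  \<open>|S(k,h)| \<le> 1\<close>.
\<close>

lemma sinc_interpolation_truncated:
  fixes F :: "complex \<Rightarrow> complex" and h x :: real
  assumes F: "F holomorphic_on strip d" and d: "d > 0" and h: "h > 0"
    and decay: "\<And>z. z \<in> strip d \<Longrightarrow> norm (F z) \<le> A / (1 + (Re z)\<^sup>2)"
    and tail: "\<And>J. finite J \<Longrightarrow> J \<inter> {- int M..int N} = {} \<Longrightarrow> (\<Sum>k\<in>J. norm (F (of_real (of_int k * h)))) \<le> T"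
  shows "norm (F (of_real x) - (\<Sum>k\<in>{- int M..int N}. F (of_real (k * h)) * of_real (sinc_basis k h x)))
    \<le> A / (d * sinh (pi * d / h)) + T"
proof -
  define K0 where "K0 = max (max M N) (nat \<lceil>(\<bar>x\<bar> + 1) / h\<rceil>)"
  let ?I = "{- int M..int N}"
  let ?t = "\<lambda>k::int. F (of_real (k * h)) * of_real (sinc_basis k h x)"
  show ?thesis
  proof (rule le_if_le_on_rectangles[OF d h, where b=A and ?K0.0=K0])
    fix \<delta> K assume \<delta>: "0 < \<delta>" "\<delta> < d" and K: "K0 \<le> K"
    have "(\<bar>x\<bar> + 1) / h \<le> real K" using K unfolding K0_def by linarith
    hence "\<bar>x\<bar> + 1 \<le> real K * h" using h by (simp add: divide_le_eq)
    also have "\<dots> \<le> (real K + 1/2) * h" using h by simp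
    finally have xL: "\<bar>x\<bar> + 1 \<le> (real K + 1/2) * h" .
    have p: "norm (F (of_real x) - (\<Sum>k\<in>{- int K..int K}. ?t k)) \<le> A / (\<delta> * sinh (pi * \<delta> / h)) + \<delta> * A / ((real K + 1/2) * h)\<^sup>2"
      by (rule cardinal_interpolation_partial[OF F \<delta> h refl xL]) (rule decay)
    have "norm (\<Sum>k\<in>{- int K..int K} - ?I. ?t k) \<le> (\<Sum>k\<in>{- int K..int K} - ?I. norm (F (of_real (of_int k * h))))"
    proof (rule order_trans[OF norm_sum sum_mono])
      fix k :: int
      have "norm (?t k) \<le> norm (F (of_real (k * h))) * 1"
        unfolding norm_mult sinc_basis_def norm_of_real by (intro mult_left_mono abs_sinc_le_one) auto
      thus "norm (?t k) \<le> norm (F (of_real (of_int k * h)))" by simp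
    qed
    also have "\<dots> \<le> T" by (intro tail) auto
    finally have r: "norm (\<Sum>k\<in>{- int K..int K} - ?I. ?t k) \<le> T" .
    have "F (of_real x) - (\<Sum>k\<in>?I. ?t k) = (F (of_real x) - (\<Sum>k\<in>{- int K..int K}. ?t k)) + (\<Sum>k\<in>{- int K..int K} - ?I. ?t k)"
      using sum_window_split[of M N K ?t] K by (simp add: K0_def)
    hence "norm (F (of_real x) - (\<Sum>k\<in>?I. ?t k)) \<le> norm (F (of_real x) - (\<Sum>k\<in>{- int K..int K}. ?t k)) + norm (\<Sum>k\<in>{- int K..int K} - ?I. ?t k)"
      by (simp only: norm_triangle_ineq)
    thus "norm (F (of_real x) - (\<Sum>k\<in>?I. ?t k)) \<le> A / (\<delta> * sinh (pi * \<delta> / h)) + \<delta> * A / ((real K + 1/2) * h)\<^sup>2 + T"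
      using p r by linarith
  qed
qed

text \<open>
  Over a finite interval \<open>[a, x]\<close> the estimate is uniform in \<open>a\<close>; the limit \<open>a \<longrightarrow> -\<infinity>\<close> then turns
  the differences of \<open>Si\<close> into the weights \<open>1/2 + Si/\<pi>\<close>.
\<close>

lemma sinc_integration_truncated:
  fixes F :: "complex \<Rightarrow> complex" and h x B :: real and G :: "real \<Rightarrow> complex"
  assumes F: "F holomorphic_on strip d" and d: "d > 0" and h: "h > 0"
    and decay: "\<And>z. z \<in> strip d \<Longrightarrow> norm (F z) \<le> A / (1 + (Re z)\<^sup>2)"
    and tail: "\<And>J. finite J \<Longrightarrow> J \<inter> {- int M..int N} = {} \<Longrightarrow> (\<Sum>k\<in>J. norm (F (of_real (of_int k * h)))) \<le> T"
    and G: "\<And>s. (G has_vector_derivative F (of_real s)) (at s)" and G0: "(G \<longlongrightarrow> G0) at_bot"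
    and B: "\<And>u. \<bar>Si u\<bar> \<le> B"
  shows "norm (G x - G0 - (\<Sum>k\<in>{- int M..int N}. F (of_real (k * h)) * of_real (h * (1 / 2 + 1 / pi * Si (pi * (x - k * h) / h)))))
    \<le> 2 * A * h / (d * sinh (pi * d / h)) + B * h * T"
proof -
  let ?I = "{- int M..int N}"
  define t where "t = (\<lambda>a k. F (of_real (of_int k * h)) * of_real (h / pi * (Si (pi * (x - of_int k * h) / h) - Si (pi * (a - of_int k * h) / h))))"
  have fin: "norm (G x - G a - (\<Sum>k\<in>?I. t a k)) \<le> 2 * A * h / (d * sinh (pi * d / h)) + B * h * T" if ax: "a \<le> x" for a
  proof (rule le_if_le_on_rectangles[OF d h, where b="(x - a) * A" and ?K0.0="max (max M N) (nat \<lceil>(\<bar>a\<bar> + \<bar>x\<bar> + 1) / h\<rceil>)"])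
    fix \<delta> K assume \<delta>: "0 < \<delta>" "\<delta> < d" and K: "max (max M N) (nat \<lceil>(\<bar>a\<bar> + \<bar>x\<bar> + 1) / h\<rceil>) \<le> K"
    have "(\<bar>a\<bar> + \<bar>x\<bar> + 1) / h \<le> real K" using K by linarith
    hence "\<bar>a\<bar> + \<bar>x\<bar> + 1 \<le> real K * h" using h by (simp add: divide_le_eq)
    also have "\<dots> \<le> (real K + 1/2) * h" using h by simp
    finally have xL: "\<bar>a\<bar> + 1 \<le> (real K + 1/2) * h" "\<bar>x\<bar> + 1 \<le> (real K + 1/2) * h" by auto
    have "norm (\<Sum>k\<in>{- int K..int K} - ?I. t a k) \<le> (\<Sum>k\<in>{- int K..int K} - ?I. B * h * norm (F (of_real (of_int k * h))))"
    proof (rule order_trans[OF norm_sum sum_mono])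
      fix k :: int
      have "\<bar>h / pi * (Si (pi * (x - k * h) / h) - Si (pi * (a - k * h) / h))\<bar> \<le> h / pi * (2 * B)"
        unfolding abs_mult using h B[of "pi * (x - k * h) / h"] B[of "pi * (a - k * h) / h"]
        by (intro mult_mono) auto
      also have "\<dots> \<le> B * h"
      proof -
        have "2 * (h * B) \<le> pi * (h * B)" using pi_gt3 h B[of 0] by (intro mult_right_mono) auto
        thus ?thesis by (simp add: field_simps)
      qed
      finally have "\<bar>h / pi * (Si (pi * (x - k * h) / h) - Si (pi * (a - k * h) / h))\<bar> \<le> B * h" .
      thus "norm (t a k) \<le> B * h * norm (F (of_real (of_int k * h)))"
        unfolding t_def norm_mult norm_of_real by (subst mult.commute) (intro mult_right_mono; simp)
    qed
    also have "\<dots> \<le> B * h * T"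
      unfolding sum_distrib_left[symmetric] using h B[of 0] by (intro mult_left_mono tail) auto
    finally have r: "norm (\<Sum>k\<in>{- int K..int K} - ?I. t a k) \<le> B * h * T" .
    have "((\<lambda>s. F (of_real s)) has_integral (G x - G a)) {a..x}"
      by (rule fundamental_theorem_of_calculus[OF ax]) (rule has_vector_derivative_at_within[OF G])
    hence int: "integral {a..x} (\<lambda>s. F (of_real s)) = G x - G a" by (rule integral_unique)
    have "norm (integral {a..x} (\<lambda>s. F (of_real s)) - (\<Sum>k\<in>{- int K..int K}. t a k))
       \<le> 2 * A * h / (\<delta> * sinh (pi * \<delta> / h)) + \<delta> * (x - a) * A / ((real K + 1/2) * h)\<^sup>2"
      unfolding t_def by (rule cardinal_integration_partial[OF F \<delta> h refl ax xL]) (rule decay)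
    hence p: "norm (G x - G a - (\<Sum>k\<in>{- int K..int K}. t a k))
       \<le> 2 * A * h / (\<delta> * sinh (pi * \<delta> / h)) + \<delta> * ((x - a) * A) / ((real K + 1/2) * h)\<^sup>2"
      unfolding int by (simp only: mult.assoc)
    have "G x - G a - (\<Sum>k\<in>?I. t a k) = (G x - G a - (\<Sum>k\<in>{- int K..int K}. t a k)) + (\<Sum>k\<in>{- int K..int K} - ?I. t a k)"
      using sum_window_split[of M N K "t a"] K by simp
    hence "norm (G x - G a - (\<Sum>k\<in>?I. t a k)) \<le> norm (G x - G a - (\<Sum>k\<in>{- int K..int K}. t a k)) + norm (\<Sum>k\<in>{- int K..int K} - ?I. t a k)"
      by (simp only: norm_triangle_ineq)
    thus "norm (G x - G a - (\<Sum>k\<in>?I. t a k)) \<le> 2 * A * h / (\<delta> * sinh (pi * \<delta> / h)) + \<delta> * ((x - a) * A) / ((real K + 1/2) * h)\<^sup>2 + B * h * T"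
      using p r by linarith
  qed
  have Si_lim: "((\<lambda>a. Si (pi * (a - c) / h)) \<longlongrightarrow> - (pi / 2)) at_bot" for c
  proof (rule filterlim_compose[OF Si_at_bot])
    show "filterlim (\<lambda>a. pi * (a - c) / h) at_bot at_bot" using h by real_asymp
  qed
  show ?thesis
  proof (rule tendsto_upperbound)
    have "((\<lambda>a. norm (G x - G a - (\<Sum>k\<in>?I. t a k))) \<longlongrightarrow> norm (G x - G0 -
       (\<Sum>k\<in>?I. F (of_real (k * h)) * of_real (h / pi * (Si (pi * (x - k * h) / h) - (- (pi / 2))))))) at_bot"
      unfolding t_def by (intro tendsto_intros G0 Si_lim)
    moreover have "h / pi * (s - (- (pi / 2))) = h * (1 / 2 + 1 / pi * s)" for s by (simp add: field_simps)
    ultimately show "((\<lambda>a. norm (G x - G a - (\<Sum>k\<in>?I. t a k))) \<longlongrightarrow> norm (G x - G0 -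
       (\<Sum>k\<in>?I. F (of_real (k * h)) * of_real (h * (1 / 2 + 1 / pi * Si (pi * (x - k * h) / h)))))) at_bot"
      by (simp only:)
    show "\<forall>\<^sub>F a in at_bot. norm (G x - G a - (\<Sum>k\<in>?I. t a k)) \<le> 2 * A * h / (d * sinh (pi * d / h)) + B * h * T"
      using eventually_le_at_bot[of x] by eventually_elim (rule fin)
  qed simp
qed

lemma abs_le_abs_sinh: "\<bar>x\<bar> \<le> \<bar>sinh x\<bar>" for x :: real
proof -
  have *: "y \<le> sinh y" if "y \<ge> 0" for y :: real
  proof -
    have "(\<lambda>y. sinh y - y) 0 \<le> (\<lambda>y. sinh y - y) y"
    proof (rule DERIV_nonneg_imp_nondecreasing[OF that])
      fix t :: real
      have "((\<lambda>y. sinh y - y) has_real_derivative cosh t - 1) (at t)" by (auto intro!: derivative_eq_intros)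
      moreover have "cosh t \<ge> 1" by (rule cosh_real_ge_1)
      ultimately show "\<exists>D. ((\<lambda>y. sinh y - y) has_real_derivative D) (at t) \<and> 0 \<le> D" by force
    qed
    thus ?thesis by simp
  qed
  show ?thesis using *[of x] *[of "- x"] by (cases "x \<ge> 0") auto
qed

lemma double_exp_le_rational:
  fixes x :: real
  assumes "\<gamma> > 0"
  shows "exp (- (2 * \<gamma> * \<bar>sinh x\<bar>)) \<le> (1 + 1 / \<gamma>\<^sup>2) / (1 + x\<^sup>2)"
proof -
  define u where "u = 2 * \<gamma> * \<bar>x\<bar>"
  have u: "u \<ge> 0" "u\<^sup>2 = 4 * \<gamma>\<^sup>2 * x\<^sup>2" using assms by (auto simp: u_def power_mult_distrib)
  have "1 + u + u\<^sup>2 / 2 \<le> exp u" using u by (intro exp_lower_Taylor_quadratic)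
  hence e: "1 + 2 * \<gamma>\<^sup>2 * x\<^sup>2 \<le> exp u" using u by simp
  have "(1 + x\<^sup>2) \<le> (1 + 1 / \<gamma>\<^sup>2) * (1 + 2 * \<gamma>\<^sup>2 * x\<^sup>2)"
  proof -
    have "(1 + 1 / \<gamma>\<^sup>2) * (1 + 2 * \<gamma>\<^sup>2 * x\<^sup>2) = 1 + 2 * \<gamma>\<^sup>2 * x\<^sup>2 + 1 / \<gamma>\<^sup>2 + 2 * x\<^sup>2"
      using assms by (simp add: algebra_simps)
    moreover have "0 \<le> 2 * \<gamma>\<^sup>2 * x\<^sup>2" "0 \<le> 1 / \<gamma>\<^sup>2" "0 \<le> x\<^sup>2" by auto
    ultimately show ?thesis by linarith
  qed
  also have "\<dots> \<le> (1 + 1 / \<gamma>\<^sup>2) * exp u" using e by (intro mult_left_mono add_nonneg_nonneg) auto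
  finally have "1 + x\<^sup>2 \<le> (1 + 1 / \<gamma>\<^sup>2) * exp u" .
  hence "exp (- u) \<le> (1 + 1 / \<gamma>\<^sup>2) / (1 + x\<^sup>2)"
    by (simp add: exp_minus field_simps add_pos_nonneg)
  moreover have "u \<le> 2 * \<gamma> * \<bar>sinh x\<bar>" unfolding u_def using assms abs_le_abs_sinh by (intro mult_left_mono) auto
  hence "exp (- (2 * \<gamma> * \<bar>sinh x\<bar>)) \<le> exp (- u)" by simp
  ultimately show ?thesis by linarith
qed

lemma sum_geometric_abs_le:
  fixes J :: "int set"
  assumes "finite J" "u > 0"
  shows "(\<Sum>k\<in>J. exp (- (u * \<bar>real_of_int k\<bar>))) \<le> 2 * (1 + 1 / u)"
proof -
  define q where "q = exp (- u)"
  have q: "0 < q" "q < 1" using assms by (auto simp: q_def)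
  have pw: "exp (- (u * real n)) = q ^ n" for n
    by (simp add: q_def exp_of_nat_mult[symmetric] mult.commute)
  have half: "(\<Sum>k\<in>J'. exp (- (u * \<bar>real_of_int k\<bar>))) \<le> 1 / (1 - q)"
    if J': "finite J'" "inj_on (\<lambda>k. nat \<bar>k\<bar>) J'" for J' :: "int set"
  proof -
    have "(\<Sum>k\<in>J'. exp (- (u * \<bar>real_of_int k\<bar>))) = (\<Sum>k\<in>J'. q ^ nat \<bar>k\<bar>)"
      by (intro sum.cong) (auto simp: pw[symmetric])
    also have "\<dots> = (\<Sum>n\<in>(\<lambda>k. nat \<bar>k\<bar>) ` J'. q ^ n)" using J' by (simp add: sum.reindex)
    also have "\<dots> \<le> (\<Sum>n. q ^ n)" using q J' by (intro sum_le_suminf summable_geometric) auto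
    also have "\<dots> = 1 / (1 - q)" using q by (intro suminf_geometric) auto
    finally show ?thesis .
  qed
  have "(\<Sum>k\<in>J. exp (- (u * \<bar>real_of_int k\<bar>))) = (\<Sum>k\<in>J \<inter> {0..}. exp (- (u * \<bar>real_of_int k\<bar>))) + (\<Sum>k\<in>J - {0..}. exp (- (u * \<bar>real_of_int k\<bar>)))"
    by (rule sum.Int_Diff[OF assms(1)])
  also have "\<dots> \<le> 1 / (1 - q) + 1 / (1 - q)"
    using assms(1) by (intro add_mono half) (auto intro!: inj_onI)
  also have "1 / (1 - q) \<le> 1 + 1 / u"
  proof -
    have "1 + u \<le> exp u" by (rule exp_ge_add_one_self)
    hence "q \<le> 1 / (1 + u)" unfolding q_def exp_minus using assms(2) by (simp add: field_simps)
    hence "u / (1 + u) \<le> 1 - q" using assms(2) by (simp add: field_simps)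
    hence "1 / (1 - q) \<le> 1 / (u / (1 + u))" using assms(2) q by (intro divide_left_mono) auto
    also have "\<dots> = 1 + 1 / u" using assms(2) by (simp add: field_simps)
    finally show ?thesis .
  qed
  finally show ?thesis by simp
qed

text \<open>
  Half of the exponent pays for the factor \<open>exp (-\<gamma> S)\<close>; the other half, by \<open>|x| \<le> |sinh x|\<close>, makes the rest
  a geometric series in \<open>exp (-\<gamma> h)\<close>.
\<close>

lemma sum_double_exp_tail_le:
  fixes f :: "real \<Rightarrow> real"
  assumes h: "h > 0" and \<gamma>: "\<gamma> > 0" and A: "A \<ge> 0"
    and f: "\<And>x. f x \<le> A * exp (- (2 * \<gamma> * \<bar>sinh x\<bar>))"
    and S: "S \<le> sinh (real M * h)" "S \<le> sinh (real N * h)"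
    and J: "finite J" "J \<inter> {- int M..int N} = {}"
  shows "(\<Sum>k\<in>J. f (of_int k * h)) \<le> 2 * A * exp (- (\<gamma> * S)) * (1 + 1 / (\<gamma> * h))"
proof -
  have "f (of_int k * h) \<le> A * exp (- (\<gamma> * S)) * exp (- (\<gamma> * h * \<bar>real_of_int k\<bar>))" if k: "k \<in> J" for k
  proof -
    define x where "x = of_int k * h"
    have "k < - int M \<or> k > int N" using J(2) k by force
    hence "S \<le> \<bar>sinh x\<bar>"
    proof
      assume "k < - int M"
      hence "real M \<le> - real_of_int k" by linarith
      hence "real M * h \<le> - real_of_int k * h" using h by (intro mult_right_mono) auto
      hence "real M * h \<le> - x" by (simp add: x_def)
      hence "sinh (real M * h) \<le> sinh (- x)" unfolding sinh_real_le_iff .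
      thus ?thesis using S by simp
    next
      assume "k > int N"
      hence "real N * h \<le> x" using h by (simp add: x_def)
      hence "sinh (real N * h) \<le> sinh x" by simp
      thus ?thesis using S by linarith
    qed
    moreover have "\<bar>x\<bar> \<le> \<bar>sinh x\<bar>" by (rule abs_le_abs_sinh)
    ultimately have "\<gamma> * (S + \<bar>x\<bar>) \<le> \<gamma> * (2 * \<bar>sinh x\<bar>)" using \<gamma> by (intro mult_left_mono) auto
    hence "exp (- (2 * \<gamma> * \<bar>sinh x\<bar>)) \<le> exp (- (\<gamma> * S) + - (\<gamma> * \<bar>x\<bar>))" by (simp add: algebra_simps)
    hence "A * exp (- (2 * \<gamma> * \<bar>sinh x\<bar>)) \<le> A * (exp (- (\<gamma> * S)) * exp (- (\<gamma> * \<bar>x\<bar>)))"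
      using A unfolding exp_add by (intro mult_left_mono)
    also have "\<gamma> * \<bar>x\<bar> = \<gamma> * h * \<bar>real_of_int k\<bar>" using h by (simp add: x_def abs_mult)
    finally have "f x \<le> A * (exp (- (\<gamma> * S)) * exp (- (\<gamma> * h * \<bar>real_of_int k\<bar>)))"
      using f[of x] by linarith
    thus ?thesis by (simp only: x_def mult.assoc)
  qed
  hence "(\<Sum>k\<in>J. f (of_int k * h)) \<le> (\<Sum>k\<in>J. A * exp (- (\<gamma> * S)) * exp (- (\<gamma> * h * \<bar>real_of_int k\<bar>)))"
    by (rule sum_mono)
  also have "\<dots> = A * exp (- (\<gamma> * S)) * (\<Sum>k\<in>J. exp (- (\<gamma> * h * \<bar>real_of_int k\<bar>)))"
    by (simp add: sum_distrib_left)
  also have "\<dots> \<le> A * exp (- (\<gamma> * S)) * (2 * (1 + 1 / (\<gamma> * h)))"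
    using A h \<gamma> J(1) by (intro mult_left_mono sum_geometric_abs_le) auto
  finally show ?thesis by (simp only: mult_ac)
qed

section \<open>The double-exponential transformation on the strip\<close>

definition de_exp :: "complex \<Rightarrow> complex" where
  "de_exp \<zeta> = exp (of_real pi * sinh \<zeta>)"

lemma de_exp_nonzero [simp]: "de_exp \<zeta> \<noteq> 0"
  by (simp add: de_exp_def)

lemma de_exp_of_real: "de_exp (of_real x) = of_real (exp (pi * sinh x))"
  using one_plus_exp_sinh_of_real[of x] by (simp add: de_exp_def)

lemma norm_de_exp: "norm (de_exp \<zeta>) = exp (pi * (sinh (Re \<zeta>) * cos (Im \<zeta>)))"
  by (simp add: de_exp_def Re_sinh)

lemma holomorphic_de_exp: "de_exp holomorphic_on S"
  unfolding de_exp_def[abs_def] sinh_field_def by (intro holomorphic_intros) auto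

lemma strip_mono: "d \<le> d' \<Longrightarrow> strip d \<subseteq> strip d'"
  by (auto simp: strip_def)

lemma cos_Im_ge:
  assumes "d < pi / 2" "\<zeta> \<in> strip d"
  shows "cos d \<le> cos (Im \<zeta>)"
proof -
  have "cos d \<le> cos \<bar>Im \<zeta>\<bar>"
    using assms by (intro cos_monotone_0_pi_le) (auto simp: strip_def)
  thus ?thesis by (simp add: cos_abs_real)
qed

lemma norm_de_exp_right:
  assumes "d < pi / 2" "\<zeta> \<in> strip d" "Re \<zeta> \<ge> 0"
  shows "exp (pi * cos d * \<bar>sinh (Re \<zeta>)\<bar>) \<le> norm (de_exp \<zeta>)"
proof -
  have "\<bar>sinh (Re \<zeta>)\<bar> * cos d \<le> sinh (Re \<zeta>) * cos (Im \<zeta>)"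
    using cos_Im_ge[OF assms(1,2)] assms(3) by (simp add: mult_left_mono)
  hence "pi * (\<bar>sinh (Re \<zeta>)\<bar> * cos d) \<le> pi * (sinh (Re \<zeta>) * cos (Im \<zeta>))" by (intro mult_left_mono) auto
  thus ?thesis by (simp add: norm_de_exp mult_ac)
qed

lemma norm_de_exp_left:
  assumes "d < pi / 2" "\<zeta> \<in> strip d" "Re \<zeta> \<le> 0"
  shows "norm (de_exp \<zeta>) \<le> exp (- (pi * cos d * \<bar>sinh (Re \<zeta>)\<bar>))"
proof -
  have "\<bar>sinh (Re \<zeta>)\<bar> * cos d \<le> \<bar>sinh (Re \<zeta>)\<bar> * cos (Im \<zeta>)"
    using cos_Im_ge[OF assms(1,2)] by (simp add: mult_left_mono)
  also have "\<dots> = - (sinh (Re \<zeta>) * cos (Im \<zeta>))" using assms(3) by (simp add: abs_if)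
  finally have "pi * (\<bar>sinh (Re \<zeta>)\<bar> * cos d) \<le> pi * (- (sinh (Re \<zeta>) * cos (Im \<zeta>)))" by (intro mult_left_mono) auto
  thus ?thesis by (simp add: norm_de_exp mult_ac)
qed

text \<open>
  Let \<open>e = de_exp \<zeta>\<close>. If \<open>|e|\<close> is not between \<open>1/2\<close> and \<open>2\<close> the triangle inequality suffices. Otherwise
  \<open>|sinh (Re \<zeta>)|\<close> is bounded, so \<open>\<zeta>\<close> lies in a compact rectangle on which \<open>1 + e\<close> has no zero.
\<close>

lemma one_plus_de_exp_lower_bound:
  assumes d: "0 < d" "d < pi / 2"
  obtains c where "c > 0" "\<And>\<zeta>. \<zeta> \<in> strip d \<Longrightarrow> c * (1 + norm (de_exp \<zeta>)) \<le> norm (1 + de_exp \<zeta>)"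
proof -
  define \<kappa> where "\<kappa> = cos d"
  have \<kappa>: "\<kappa> > 0" using d by (auto simp: \<kappa>_def intro!: cos_gt_zero_pi)
  \<comment> \<open>Since \<open>exp 1 \<ge> 2\<close>, \<open>1/2 < |e| < 2\<close> forces \<open>\<pi> \<kappa> |sinh (Re \<zeta>)| \<le> 1\<close>.\<close>
  define X where "X = 1 / (pi * \<kappa>)"
  define R where "R = cbox (Complex (- X) (- d)) (Complex X d)"
  have "continuous_on R (\<lambda>\<zeta>. norm (1 + de_exp \<zeta>))"
    using holomorphic_on_imp_continuous_on[OF holomorphic_de_exp, of R] by (intro continuous_intros)
  moreover have "compact R" by (simp add: R_def)
  moreover have "X > 0" using \<kappa> by (simp add: X_def)
  hence "0 \<in> R" using d by (auto simp: R_def in_cbox_complex_iff)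
  hence "R \<noteq> {}" by blast
  ultimately obtain \<zeta>0 where z0: "\<zeta>0 \<in> R" "\<And>\<zeta>. \<zeta> \<in> R \<Longrightarrow> norm (1 + de_exp \<zeta>0) \<le> norm (1 + de_exp \<zeta>)"
    using continuous_attains_inf by metis
  define c0 where "c0 = norm (1 + de_exp \<zeta>0)"
  have "\<zeta>0 \<in> strip (pi / 2)" using z0(1) d by (auto simp: R_def in_cbox_complex_iff strip_def)
  from one_plus_exp_sinh_nonzero[OF this] have c0: "c0 > 0" by (simp add: c0_def de_exp_def)
  have e2: "exp 1 \<ge> (2::real)" using exp_ge_add_one_self[of 1] by simp
  show ?thesis
  proof (rule that[of "min (1 / 3) (c0 / 3)"])
    fix \<zeta> assume \<zeta>: "\<zeta> \<in> strip d"
    define e where "e = norm (de_exp \<zeta>)"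
    have e: "e > 0" by (simp add: e_def)
    have tri: "\<bar>1 - e\<bar> \<le> norm (1 + de_exp \<zeta>)"
      using norm_triangle_ineq3[of 1 "- de_exp \<zeta>"] by (simp add: e_def)
    show "min (1 / 3) (c0 / 3) * (1 + norm (de_exp \<zeta>)) \<le> norm (1 + de_exp \<zeta>)"
    proof (cases "1 / 2 < e \<and> e < 2")
      case False
      hence "1 / 3 * (1 + e) \<le> \<bar>1 - e\<bar>" by (auto simp: abs_if)
      moreover have "min (1 / 3) (c0 / 3) * (1 + e) \<le> 1 / 3 * (1 + e)" using e by (intro mult_right_mono) auto
      ultimately show ?thesis using tri unfolding e_def by linarith
    next
      case True
      have "pi * \<kappa> * \<bar>sinh (Re \<zeta>)\<bar> \<le> 1"
      proof (cases "Re \<zeta> \<ge> 0")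
        case R: True
        have "exp (pi * \<kappa> * \<bar>sinh (Re \<zeta>)\<bar>) < exp 1"
          using norm_de_exp_right[OF d(2) \<zeta> R] True e2 unfolding e_def \<kappa>_def by linarith
        thus ?thesis by simp
      next
        case R: False
        have "exp (- 1 :: real) \<le> 1 / 2" unfolding exp_minus using e2 by (simp add: field_simps)
        also have "1 / 2 < exp (- (pi * \<kappa> * \<bar>sinh (Re \<zeta>)\<bar>))"
          using norm_de_exp_left[OF d(2) \<zeta>] R True unfolding e_def \<kappa>_def by linarith
        finally show ?thesis by simp
      qed
      hence "\<bar>sinh (Re \<zeta>)\<bar> \<le> X" using \<kappa> by (simp add: X_def field_simps)
      hence "\<bar>Re \<zeta>\<bar> \<le> X" using abs_le_abs_sinh[of "Re \<zeta>"] by linarith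
      hence "\<zeta> \<in> R" using \<zeta> by (auto simp: R_def in_cbox_complex_iff strip_def)
      hence "c0 \<le> norm (1 + de_exp \<zeta>)" using z0(2) by (simp add: c0_def)
      moreover have "min (1 / 3) (c0 / 3) * (1 + e) \<le> c0 / 3 * 3" using True c0 by (intro mult_mono) auto
      ultimately show ?thesis by (simp add: e_def)
    qed
  qed (use c0 in auto)
qed

lemma exp_de_phi: "\<zeta> \<in> strip (pi / 2) \<Longrightarrow> exp (de_phi \<zeta>) = 1 + de_exp \<zeta>"
  using is_de_branch_de_phi by (auto simp: is_de_branch_def de_exp_def)

lemma holomorphic_de_phi: "de_phi holomorphic_on strip (pi / 2)"
  using is_de_branch_de_phi by (auto simp: is_de_branch_def)

lemma has_field_derivative_de_exp:
  "(de_exp has_field_derivative of_real pi * cosh \<zeta> * de_exp \<zeta>) (at \<zeta>)"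
  unfolding de_exp_def[abs_def] by (auto intro!: derivative_eq_intros)

lemma has_field_derivative_de_phi:
  assumes "\<zeta> \<in> strip (pi / 2)"
  shows "(de_phi has_field_derivative of_real pi * cosh \<zeta> * de_exp \<zeta> / (1 + de_exp \<zeta>)) (at \<zeta>)"
proof -
  have D: "(de_phi has_field_derivative deriv de_phi \<zeta>) (at \<zeta>)"
    using holomorphic_derivI[OF holomorphic_de_phi open_strip assms] .
  have "((\<lambda>\<zeta>. exp (de_phi \<zeta>)) has_field_derivative exp (de_phi \<zeta>) * deriv de_phi \<zeta>) (at \<zeta>)"
    by (rule DERIV_chain2[OF DERIV_exp D])
  moreover have "((\<lambda>\<zeta>. 1 + de_exp \<zeta>) has_field_derivative of_real pi * cosh \<zeta> * de_exp \<zeta>) (at \<zeta>)"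
    using has_field_derivative_de_exp by (auto intro!: derivative_eq_intros)
  hence "((\<lambda>\<zeta>. exp (de_phi \<zeta>)) has_field_derivative of_real pi * cosh \<zeta> * de_exp \<zeta>) (at \<zeta>)"
    by (rule has_field_derivative_transform_within_open[OF _ open_strip assms]) (simp add: exp_de_phi)
  ultimately have "exp (de_phi \<zeta>) * deriv de_phi \<zeta> = of_real pi * cosh \<zeta> * de_exp \<zeta>"
    by (rule DERIV_unique)
  hence "(1 + de_exp \<zeta>) * deriv de_phi \<zeta> = of_real pi * cosh \<zeta> * de_exp \<zeta>" by (simp only: exp_de_phi[OF assms])
  moreover have "1 + de_exp \<zeta> \<noteq> 0" using exp_de_phi[OF assms] by (metis exp_not_eq_zero)
  ultimately have "deriv de_phi \<zeta> = of_real pi * cosh \<zeta> * de_exp \<zeta> / (1 + de_exp \<zeta>)"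
    by (simp add: field_simps)
  thus ?thesis using D by simp
qed

lemma norm_cosh_le: "norm (cosh \<zeta>) \<le> cosh (Re \<zeta>)" for \<zeta> :: complex
proof -
  have "norm (exp \<zeta> + exp (- \<zeta>)) \<le> exp (Re \<zeta>) + exp (- Re \<zeta>)"
    using norm_triangle_ineq[of "exp \<zeta>" "exp (- \<zeta>)"] by simp
  thus ?thesis by (simp add: cosh_field_def norm_divide divide_right_mono)
qed

lemma norm_deriv_de_phi_le:
  assumes c: "c > 0" "\<And>\<zeta>. \<zeta> \<in> strip d \<Longrightarrow> c * (1 + norm (de_exp \<zeta>)) \<le> norm (1 + de_exp \<zeta>)"
    and d: "d < pi / 2" and \<zeta>: "\<zeta> \<in> strip d"
  shows "norm (deriv de_phi \<zeta>) \<le> pi / c * cosh (Re \<zeta>) * (norm (de_exp \<zeta>) / (1 + norm (de_exp \<zeta>)))"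
proof -
  have s: "\<zeta> \<in> strip (pi / 2)" using \<zeta> strip_mono[of d "pi / 2"] d by auto
  have e: "norm (de_exp \<zeta>) > 0" by simp
  have "norm (deriv de_phi \<zeta>) = pi * norm (cosh \<zeta>) * norm (de_exp \<zeta>) / norm (1 + de_exp \<zeta>)"
    using DERIV_imp_deriv[OF has_field_derivative_de_phi[OF s]] by (simp add: norm_mult norm_divide)
  also have "\<dots> \<le> pi * cosh (Re \<zeta>) * norm (de_exp \<zeta>) / (c * (1 + norm (de_exp \<zeta>)))"
    using c(1) c(2)[OF \<zeta>] e norm_cosh_le[of \<zeta>]
    by (intro frac_le mult_right_mono mult_left_mono mult_nonneg_nonneg mult_pos_pos add_pos_nonneg) auto
  finally show ?thesis by (simp add: mult_ac)
qed

text \<open>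
  From \<open>|exp z - 1| \<le> exp 1 |z|\<close> on the unit disc, with \<open>exp (\<phi> \<zeta>) - 1 = exp (\<pi> sinh \<zeta>)\<close>. This controls the
  singularity of the weight at \<open>z = 0\<close>.
\<close>

lemma norm_de_phi_ge:
  assumes "\<zeta> \<in> strip (pi / 2)"
  shows "norm (de_exp \<zeta>) / (1 + norm (de_exp \<zeta>)) \<le> exp 1 * norm (de_phi \<zeta>)"
proof (cases "norm (de_phi \<zeta>) \<le> 1")
  case True
  have e: "norm (de_exp \<zeta>) > 0" by simp
  have "de_exp \<zeta> = exp (de_phi \<zeta>) - 1" using exp_de_phi[OF assms] by simp
  hence "norm (de_exp \<zeta>) = norm (exp (de_phi \<zeta>) - exp 0)" by simp
  also have "\<dots> \<le> exp 1 * norm (de_phi \<zeta> - 0)"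
  proof (rule field_differentiable_bound[of "cball 0 1" exp exp])
    show "norm (exp z) \<le> exp 1" if "z \<in> cball 0 1" for z :: complex
      using norm_exp[of z] that by (meson exp_le_cancel_iff mem_cball_0 order_trans)
  qed (use True in \<open>auto intro!: derivative_eq_intros\<close>)
  finally have "norm (de_exp \<zeta>) \<le> exp 1 * norm (de_phi \<zeta>)" by simp
  moreover have "norm (de_exp \<zeta>) / (1 + norm (de_exp \<zeta>)) \<le> norm (de_exp \<zeta>) / 1"
    by (intro divide_left_mono mult_pos_pos add_pos_nonneg) auto
  ultimately show ?thesis by simp
next
  case False
  have "norm (de_exp \<zeta>) / (1 + norm (de_exp \<zeta>)) \<le> 1" by (simp add: divide_le_eq add_pos_nonneg)
  moreover have "1 * 1 \<le> exp 1 * norm (de_phi \<zeta>)" using False by (intro mult_mono) auto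
  ultimately show ?thesis by linarith
qed

text \<open>
  On the real line \<open>ln (1 + e) \<le> e\<close> for \<open>e = exp (\<pi> sinh x)\<close>. The vertical segment from \<open>Re \<zeta>\<close> to \<open>\<zeta>\<close> adds at most its length
  times the bound for \<open>\<phi>'\<close>; this avoids identifying \<open>\<phi>\<close> with a branch of the logarithm.
\<close>

lemma norm_de_phi_left_le:
  assumes c: "c > 0" "\<And>\<zeta>. \<zeta> \<in> strip d \<Longrightarrow> c * (1 + norm (de_exp \<zeta>)) \<le> norm (1 + de_exp \<zeta>)"
    and d: "0 < d" "d < pi / 2" and \<zeta>: "\<zeta> \<in> strip d" and left: "Re \<zeta> \<le> 0"
  shows "norm (de_phi \<zeta>) \<le> (1 + pi * pi / c) * cosh (Re \<zeta>) * exp (- (pi * cos d * \<bar>sinh (Re \<zeta>)\<bar>))"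
proof -
  define x where "x = Re \<zeta>"
  define b where "b = exp (- (pi * cos d * \<bar>sinh x\<bar>))"
  let ?S = "closed_segment (complex_of_real x) \<zeta>"
  have real_in: "complex_of_real x \<in> strip d" using d by (simp add: strip_def)
  have sub: "?S \<subseteq> strip d" using real_in \<zeta> convex_strip by (simp add: closed_segment_subset)
  have reS: "Re z = x" if "z \<in> ?S" for z
    using that by (simp add: closed_segment_same_Re x_def)
  have "norm (de_phi \<zeta> - de_phi (of_real x)) \<le> pi / c * cosh x * b * norm (\<zeta> - of_real x)"
  proof (rule field_differentiable_bound[of ?S de_phi "deriv de_phi"])
    fix z assume z: "z \<in> ?S"
    have zs: "z \<in> strip d" using z sub by auto
    hence zs': "z \<in> strip (pi / 2)" using strip_mono[of d "pi / 2"] d by auto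
    show "(de_phi has_field_derivative deriv de_phi z) (at z within ?S)"
      using holomorphic_derivI[OF holomorphic_de_phi open_strip zs'] by (rule has_field_derivative_at_within)
    have "norm (de_exp z) / (1 + norm (de_exp z)) \<le> norm (de_exp z) / 1"
      by (intro divide_left_mono mult_pos_pos add_pos_nonneg) auto
    also have "\<dots> \<le> b" using norm_de_exp_left[OF d(2) zs] left reS[OF z] by (simp add: b_def x_def)
    finally have "norm (de_exp z) / (1 + norm (de_exp z)) \<le> b" .
    hence "pi / c * cosh (Re z) * (norm (de_exp z) / (1 + norm (de_exp z))) \<le> pi / c * cosh (Re z) * b"
      using c(1) by (intro mult_left_mono) auto
    thus "norm (deriv de_phi z) \<le> pi / c * cosh x * b"
      using norm_deriv_de_phi_le[OF c d(2) zs] reS[OF z] by simp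
  qed auto
  also have "\<dots> \<le> pi / c * cosh x * b * pi"
  proof (rule mult_left_mono)
    have "\<zeta> - of_real x = \<i> * of_real (Im \<zeta>)" by (simp add: complex_eq_iff x_def)
    hence "norm (\<zeta> - of_real x) = \<bar>Im \<zeta>\<bar>" by (simp add: norm_mult)
    thus "norm (\<zeta> - of_real x) \<le> pi" using \<zeta> d by (simp add: strip_def)
    show "0 \<le> pi / c * cosh x * b" using c(1) by (auto simp: b_def)
  qed
  finally have 1: "norm (de_phi \<zeta> - de_phi (of_real x)) \<le> pi * pi / c * cosh x * b" by (simp add: mult_ac)
  have "norm (de_phi (of_real x)) = ln (1 + exp (pi * sinh x))"
    by (simp add: de_phi_of_real del: of_real_add)
  also have "\<dots> \<le> exp (pi * sinh x)" by (rule ln_add_one_self_le_self) simp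
  also have "\<dots> = norm (de_exp (of_real x))" by (simp add: de_exp_of_real)
  also have "\<dots> \<le> b" using norm_de_exp_left[OF d(2) real_in] left by (simp add: b_def x_def)
  also have "b \<le> cosh x * b" using cosh_real_ge_1[of x] by (simp add: b_def)
  finally have "norm (de_phi (of_real x)) \<le> cosh x * b" .
  with 1 have "norm (de_phi \<zeta>) \<le> cosh x * b + pi * pi / c * cosh x * b"
    using norm_triangle_sub[of "de_phi \<zeta>" "de_phi (of_real x)"] by linarith
  thus ?thesis by (simp add: b_def x_def algebra_simps)
qed

lemma cosh_times_double_exp_le:
  fixes x :: real
  assumes "\<gamma> > 0"
  shows "cosh x * exp (- (pi * \<gamma> * \<bar>sinh x\<bar>)) \<le> (1 + 1 / \<gamma>) * exp (- (2 * \<gamma> * \<bar>sinh x\<bar>))"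
proof -
  define s where "s = \<bar>sinh x\<bar>"
  have s: "s \<ge> 0" by (simp add: s_def)
  have "(cosh x)\<^sup>2 = s\<^sup>2 + 1" by (simp add: s_def cosh_square_eq)
  also have "\<dots> \<le> (1 + s)\<^sup>2" using s by (simp add: power2_sum)
  finally have "cosh x \<le> 1 + s" using s by (intro power2_le_imp_le[of "cosh x"]) auto
  also have "\<dots> \<le> (1 + 1 / \<gamma>) * (1 + \<gamma> * s)"
    using assms s by (simp add: field_simps)
  also have "\<dots> \<le> (1 + 1 / \<gamma>) * exp (\<gamma> * s)"
    using assms s by (intro mult_left_mono) (auto simp: exp_ge_add_one_self)
  finally have "cosh x * exp (- (pi * \<gamma> * s)) \<le> (1 + 1 / \<gamma>) * exp (\<gamma> * s) * exp (- (pi * \<gamma> * s))"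
    by (intro mult_right_mono) auto
  also have "\<dots> = (1 + 1 / \<gamma>) * exp (\<gamma> * s - pi * \<gamma> * s)" by (simp add: exp_diff exp_minus field_simps)
  also have "\<dots> \<le> (1 + 1 / \<gamma>) * exp (- (2 * \<gamma> * s))"
  proof -
    have "3 * (\<gamma> * s) \<le> pi * (\<gamma> * s)" using assms s pi_gt3 by (intro mult_right_mono) auto
    thus ?thesis using assms by (intro mult_left_mono) (auto simp: algebra_simps)
  qed
  finally show ?thesis by (simp add: s_def)
qed

lemma exp_powr_real: "exp x powr a = exp (a * x)" for x a :: real
  by (simp add: powr_def)

text \<open>
  To the right, where \<open>|e|\<close> is large, the second factor decays; to the left the first one does.
\<close>

lemma sigmoid_powr_le:
  assumes d: "d < pi / 2" and \<zeta>: "\<zeta> \<in> strip d" and ab: "\<alpha> > 0" "\<beta> > 0" "\<mu> = min \<alpha> \<beta>" and \<kappa>: "cos d \<ge> 0"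
  shows "(norm (de_exp \<zeta>) / (1 + norm (de_exp \<zeta>))) powr \<alpha> * (1 / (1 + norm (de_exp \<zeta>))) powr \<beta>
     \<le> exp (- (pi * (\<mu> * cos d) * \<bar>sinh (Re \<zeta>)\<bar>))"
proof -
  define e where "e = norm (de_exp \<zeta>)"
  have e: "e > 0" by (simp add: e_def)
  define u where "u = pi * cos d * \<bar>sinh (Re \<zeta>)\<bar>"
  have u: "u \<ge> 0" using \<kappa> by (simp add: u_def)
  have le1: "(e / (1 + e)) powr \<alpha> \<le> 1" "(1 / (1 + e)) powr \<beta> \<le> 1"
    using e ab by (auto intro!: powr_le1)
  have "(e / (1 + e)) powr \<alpha> * (1 / (1 + e)) powr \<beta> \<le> exp (- (\<mu> * u))"
  proof (cases "Re \<zeta> \<ge> 0")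
    case True
    have "exp u \<le> e" using norm_de_exp_right[OF d \<zeta> True] by (simp add: u_def e_def)
    hence "1 / (1 + e) \<le> exp (- u)" using e by (simp add: exp_minus field_simps)
    hence "(1 / (1 + e)) powr \<beta> \<le> exp (- u) powr \<beta>" using e ab by (intro powr_mono2) auto
    also have "\<dots> = exp (- (\<beta> * u))" by (simp add: exp_powr_real)
    also have "\<dots> \<le> exp (- (\<mu> * u))" using u ab by (simp add: mult_right_mono)
    finally show ?thesis using le1 by (intro order_trans[OF mult_left_le_one_le]) auto
  next
    case False
    have "e / (1 + e) \<le> e / 1" using e by (intro divide_left_mono) auto
    also have "e \<le> exp (- u)" using norm_de_exp_left[OF d \<zeta>] False by (simp add: u_def e_def)
    finally have "(e / (1 + e)) powr \<alpha> \<le> exp (- u) powr \<alpha>" using e ab by (intro powr_mono2) auto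
    also have "\<dots> = exp (- (\<alpha> * u))" by (simp add: exp_powr_real)
    also have "\<dots> \<le> exp (- (\<mu> * u))" using u ab by (simp add: mult_right_mono)
    finally show ?thesis using le1 by (intro order_trans[OF mult_right_le_one_le]) auto
  qed
  thus ?thesis by (simp add: e_def u_def mult_ac)
qed

text \<open>
  With \<open>e = de_exp \<zeta>\<close> and \<open>q = |e| / (1 + |e|)\<close> the three factors are bounded by multiples of \<open>q powr (\<alpha> - 1)\<close>,
  \<open>(1 / (1 + |e|)) powr \<beta>\<close> and \<open>cosh (Re \<zeta>) * q\<close>. Their product is the one bounded in \<open>sigmoid_powr_le\<close>, and
  \<open>cosh\<close> is absorbed by giving up part of the exponent, which is possible because \<open>\<pi> > 3\<close>.
\<close>

lemma de_transformed_decay: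
  assumes d: "0 < d" "d < pi / 2" and ab: "0 < \<alpha>" "\<alpha> \<le> 1" "0 < \<beta>" and \<gamma>: "\<gamma> = min \<alpha> \<beta> * cos d"
  obtains A where "A > 0" "\<And>\<zeta>. \<zeta> \<in> strip d \<Longrightarrow>
    de_weight \<alpha> (de_phi \<zeta>) * norm (exp (- de_phi \<zeta>)) powr \<beta> * norm (deriv de_phi \<zeta>)
      \<le> A * exp (- (2 * \<gamma> * \<bar>sinh (Re \<zeta>)\<bar>))"
proof -
  have \<kappa>: "cos d > 0" using d by (intro cos_gt_zero_pi) auto
  have \<gamma>0: "\<gamma> > 0" using \<kappa> ab by (simp add: \<gamma>)
  obtain c where c: "c > 0" "\<And>\<zeta>. \<zeta> \<in> strip d \<Longrightarrow> c * (1 + norm (de_exp \<zeta>)) \<le> norm (1 + de_exp \<zeta>)"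
    using one_plus_de_exp_lower_bound[OF d] by blast
  define w where "w = (1 + exp 1) powr (1 - \<alpha>) * ((1 / c) powr \<beta>) * (pi / c)"
  have ne1: "(1 + exp 1 :: real) \<noteq> 0" using exp_gt_zero[of "1::real"] by linarith
  hence w: "w > 0" unfolding w_def using c(1) by (intro mult_pos_pos divide_pos_pos) auto
  show ?thesis
  proof (rule that[of "w * (1 + 1 / \<gamma>)"])
    fix \<zeta> assume \<zeta>: "\<zeta> \<in> strip d"
    have \<zeta>': "\<zeta> \<in> strip (pi / 2)" using \<zeta> strip_mono[of d "pi / 2"] d by auto
    define e where "e = norm (de_exp \<zeta>)"
    define z where "z = de_phi \<zeta>"
    have e: "e > 0" by (simp add: e_def)
    define q where "q = e / (1 + e)"
    have q: "q > 0" "q \<le> 1" using e by (auto simp: q_def)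
    have z0: "q \<le> exp 1 * norm z" using norm_de_phi_ge[OF \<zeta>'] by (simp add: q_def e_def z_def)
    have znz: "norm z > 0"
    proof (rule ccontr)
      assume "\<not> norm z > 0"
      hence "norm z = 0" by simp
      with z0 q(1) show False by (simp only: mult_zero_right)
    qed
    have weight: "de_weight \<alpha> z \<le> (1 + exp 1) powr (1 - \<alpha>) * (1 / q) powr (1 - \<alpha>)"
    proof (cases "\<alpha> = 1")
      case True
      thus ?thesis using ne1 q by (simp add: de_weight_def)
    next
      case False
      have "norm ((1 + z) / z) \<le> (1 + norm z) / norm z"
        using norm_triangle_ineq[of 1 z] by (simp add: norm_divide divide_right_mono)
      also have "\<dots> = 1 / norm z + 1" using znz by (simp add: field_simps)
      also have "1 / norm z \<le> exp 1 / q" using z0 znz q by (simp add: field_simps)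
      also have "exp 1 / q + 1 \<le> (1 + exp 1) * (1 / q)" using q by (simp add: field_simps)
      finally have "norm ((1 + z) / z) powr (1 - \<alpha>) \<le> ((1 + exp 1) * (1 / q)) powr (1 - \<alpha>)"
        using ab by (intro powr_mono2) auto
      also have "((1 + exp 1) * (1 / q)) powr (1 - \<alpha>) = (1 + exp 1) powr (1 - \<alpha>) * (1 / q) powr (1 - \<alpha>)"
        by (rule powr_mult)
      finally show ?thesis using False unfolding de_weight_def by (simp only: if_False)
    qed
    have ez: "norm (exp (- z)) powr \<beta> \<le> (1 / c) powr \<beta> * (1 / (1 + e)) powr \<beta>"
    proof -
      have "norm (exp (- z)) = 1 / norm (1 + de_exp \<zeta>)"
        using exp_de_phi[OF \<zeta>'] by (simp add: exp_minus z_def norm_inverse divide_inverse)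
      also have "\<dots> \<le> 1 / (c * (1 + e))"
      proof (rule divide_left_mono)
        show 1: "c * (1 + e) \<le> norm (1 + de_exp \<zeta>)" using c(2)[OF \<zeta>] by (simp add: e_def)
        have 2: "0 < c * (1 + e)" using c(1) e by simp
        hence "0 < norm (1 + de_exp \<zeta>)" using 1 by linarith
        with 2 show "0 < norm (1 + de_exp \<zeta>) * (c * (1 + e))" by (rule mult_pos_pos[rotated])
      qed simp
      finally have "norm (exp (- z)) powr \<beta> \<le> (1 / c * (1 / (1 + e))) powr \<beta>" using ab by (intro powr_mono2) auto
      also have "(1 / c * (1 / (1 + e))) powr \<beta> = (1 / c) powr \<beta> * (1 / (1 + e)) powr \<beta>"
        by (rule powr_mult)
      finally show ?thesis .
    qed
    have dp: "norm (deriv de_phi \<zeta>) \<le> pi / c * cosh (Re \<zeta>) * q"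
      using norm_deriv_de_phi_le[OF c d(2) \<zeta>] by (simp add: q_def e_def)
    have wn: "de_weight \<alpha> z \<ge> 0" by (simp add: de_weight_def)
    have "de_weight \<alpha> z * norm (exp (- z)) powr \<beta> * norm (deriv de_phi \<zeta>) \<le>
      ((1 + exp 1) powr (1 - \<alpha>) * (1 / q) powr (1 - \<alpha>)) * ((1 / c) powr \<beta> * (1 / (1 + e)) powr \<beta>) * (pi / c * cosh (Re \<zeta>) * q)"
      using weight ez dp wn c(1) q by (intro mult_mono mult_nonneg_nonneg) auto
    also have "\<dots> = w * cosh (Re \<zeta>) * (((1 / q) powr (1 - \<alpha>) * q) * (1 / (1 + e)) powr \<beta>)"
      by (simp add: w_def mult_ac)
    also have "(1 / q) powr (1 - \<alpha>) * q = q powr \<alpha>"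
    proof -
      have "(1 / q) powr (1 - \<alpha>) = q powr (\<alpha> - 1)" using q by (simp add: powr_divide powr_diff)
      thus ?thesis using q powr_mult_base[of q "\<alpha> - 1"] by (simp add: mult.commute)
    qed
    also have "w * cosh (Re \<zeta>) * (q powr \<alpha> * (1 / (1 + e)) powr \<beta>) \<le> w * cosh (Re \<zeta>) * exp (- (pi * \<gamma> * \<bar>sinh (Re \<zeta>)\<bar>))"
      using sigmoid_powr_le[OF d(2) \<zeta> ab(1,3) refl] \<kappa> w
      by (intro mult_left_mono mult_nonneg_nonneg) (auto simp: q_def e_def \<gamma>)
    also have "\<dots> = w * (cosh (Re \<zeta>) * exp (- (pi * \<gamma> * \<bar>sinh (Re \<zeta>)\<bar>)))" by simp
    also have "\<dots> \<le> w * ((1 + 1 / \<gamma>) * exp (- (2 * \<gamma> * \<bar>sinh (Re \<zeta>)\<bar>)))"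
      using cosh_times_double_exp_le[OF \<gamma>0] w by (intro mult_left_mono) auto
    finally show "de_weight \<alpha> (de_phi \<zeta>) * norm (exp (- de_phi \<zeta>)) powr \<beta> * norm (deriv de_phi \<zeta>)
      \<le> w * (1 + 1 / \<gamma>) * exp (- (2 * \<gamma> * \<bar>sinh (Re \<zeta>)\<bar>))" by (simp add: z_def mult_ac)
  qed (use w \<gamma>0 in \<open>auto intro!: mult_pos_pos add_pos_pos\<close>)
qed

text \<open>
  Subtracting \<open>r / (1 + e)\<close> from \<open>f \<circ> \<phi>\<close> removes the limit \<open>r\<close> at the left end without disturbing the decay at
  the right end.
\<close>

lemma de_interpolant_decay:
  assumes d: "0 < d" "d < pi / 2" and ab: "0 < \<alpha>" "\<alpha> \<le> 1" "0 < \<beta>" and \<gamma>: "\<gamma> = min \<alpha> \<beta> * cos d"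
    and H: "H > 0"
    and left: "\<And>z. z \<in> de_phi ` strip d \<Longrightarrow> norm (f z - r) \<le> H * norm z powr \<alpha>"
    and right: "\<And>z. z \<in> de_phi ` strip d \<Longrightarrow> norm (f z) \<le> H * norm (exp (- z)) powr \<beta>"
  obtains A where "A > 0" "\<And>\<zeta>. \<zeta> \<in> strip d \<Longrightarrow>
      norm (f (de_phi \<zeta>) - r / (1 + de_exp \<zeta>)) \<le> A * exp (- (2 * \<gamma> * \<bar>sinh (Re \<zeta>)\<bar>))"
proof -
  have \<kappa>: "cos d > 0" using d by (intro cos_gt_zero_pi) auto
  have \<gamma>0: "\<gamma> > 0" using \<kappa> ab by (simp add: \<gamma>)
  obtain c where c: "c > 0" "\<And>\<zeta>. \<zeta> \<in> strip d \<Longrightarrow> c * (1 + norm (de_exp \<zeta>)) \<le> norm (1 + de_exp \<zeta>)"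
    using one_plus_de_exp_lower_bound[OF d] by blast
  define C where "C = 1 + pi * pi / c"
  have C: "C > 0" using c by (simp add: C_def add_pos_pos)
  define W where "W = H * C powr \<alpha> + norm r / c + H * (1 / c) powr \<beta>"
  have W: "W > 0" "H * C powr \<alpha> + norm r / c \<le> W" "H * (1 / c) powr \<beta> + norm r / c \<le> W"
    using H C c by (auto simp: W_def intro!: add_pos_nonneg)
  show ?thesis
  proof (rule that[of "W * (1 + 1 / \<gamma>)"])
    fix \<zeta> assume \<zeta>: "\<zeta> \<in> strip d"
    have \<zeta>': "\<zeta> \<in> strip (pi / 2)" using \<zeta> strip_mono[of d "pi / 2"] d by auto
    define e where "e = norm (de_exp \<zeta>)"
    define z where "z = de_phi \<zeta>"
    define x where "x = Re \<zeta>"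
    define s where "s = \<bar>sinh x\<bar>"
    define u where "u = pi * cos d * s"
    define b where "b = exp (- (pi * \<gamma> * s))"
    have zim: "z \<in> de_phi ` strip d" using \<zeta> by (simp add: z_def)
    have e: "e > 0" by (simp add: e_def)
    have u: "u \<ge> 0" using \<kappa> by (simp add: u_def s_def)
    have mono: "exp (- (t * u)) \<le> b" if "min \<alpha> \<beta> \<le> t" for t
    proof -
      have "min \<alpha> \<beta> * u \<le> t * u" using that u by (rule mult_right_mono)
      thus ?thesis by (simp add: b_def \<gamma> u_def mult_ac)
    qed
    have b1: "exp (- u) \<le> b" using mono[of 1] ab by simp
    have ch: "cosh x \<ge> 1" by (rule cosh_real_ge_1)
    have b: "b > 0" by (simp add: b_def)
    have cb: "b \<le> cosh x * b" using ch b by simp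
    have E1: "1 + de_exp \<zeta> \<noteq> 0" using exp_de_phi[OF \<zeta>'] by (metis exp_not_eq_zero)
    have ge: "c * (1 + e) \<le> norm (1 + de_exp \<zeta>)" using c(2)[OF \<zeta>] by (simp add: e_def)
    have ge0: "0 < c * (1 + e)" using c(1) e by simp
    have inv: "1 / norm (1 + de_exp \<zeta>) \<le> 1 / (c * (1 + e))" using ge ge0 by (intro frac_le) auto
    have key: "norm (f z - r / (1 + de_exp \<zeta>)) \<le> W * (cosh x * b)"
    proof (cases "x \<le> 0")
      case True
      have eu: "e \<le> exp (- u)"
        using norm_de_exp_left[OF d(2) \<zeta>] True by (simp add: e_def u_def s_def x_def)
      have zb: "norm z \<le> C * cosh x * exp (- u)"
        using norm_de_phi_left_le[OF c d \<zeta>] True by (simp add: z_def C_def u_def s_def x_def)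
      have "norm z powr \<alpha> \<le> (C * cosh x * exp (- u)) powr \<alpha>"
        using zb ab by (intro powr_mono2) auto
      also have "\<dots> = C powr \<alpha> * cosh x powr \<alpha> * exp (- (\<alpha> * u))"
        by (simp add: powr_mult exp_powr_real)
      also have "\<dots> \<le> C powr \<alpha> * cosh x * b"
      proof (intro mult_mono)
        show "cosh x powr \<alpha> \<le> cosh x" using powr_mono[of \<alpha> 1 "cosh x"] ab ch by simp
        show "exp (- (\<alpha> * u)) \<le> b" by (rule mono) simp
      qed (use ch in auto)
      finally have "H * norm z powr \<alpha> \<le> H * (C powr \<alpha> * cosh x * b)" using H by (intro mult_left_mono) auto
      hence 1: "norm (f z - r) \<le> H * C powr \<alpha> * (cosh x * b)" using left[OF zim] by (simp add: mult_ac)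
      have "norm (r - r / (1 + de_exp \<zeta>)) = norm r * e * (1 / norm (1 + de_exp \<zeta>))"
      proof -
        have "r - r / (1 + de_exp \<zeta>) = r * de_exp \<zeta> / (1 + de_exp \<zeta>)" using E1 by (simp add: field_simps)
        thus ?thesis by (simp add: norm_mult norm_divide e_def)
      qed
      also have "\<dots> \<le> norm r * e * (1 / (c * (1 + e)))" using inv e by (intro mult_left_mono) auto
      also have "\<dots> \<le> norm r * e * (1 / (c * 1))" using e c(1) by (intro mult_left_mono frac_le) auto
      also have "\<dots> = norm r / c * e" by simp
      also have "\<dots> \<le> norm r / c * (cosh x * b)" using eu b1 cb c(1) by (intro mult_left_mono) auto
      finally have 2: "norm (r - r / (1 + de_exp \<zeta>)) \<le> norm r / c * (cosh x * b)" .
      have "norm (f z - r / (1 + de_exp \<zeta>)) \<le> norm (f z - r) + norm (r - r / (1 + de_exp \<zeta>))"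
        using norm_triangle_ineq[of "f z - r" "r - r / (1 + de_exp \<zeta>)"] by simp
      also have "\<dots> \<le> (H * C powr \<alpha> + norm r / c) * (cosh x * b)" using 1 2 by (simp only: distrib_right)
      also have "\<dots> \<le> W * (cosh x * b)" using W(2) ch b by (intro mult_right_mono) auto
      finally show ?thesis .
    next
      case False
      have "exp u \<le> e"
        using norm_de_exp_right[OF d(2) \<zeta>] False by (simp add: e_def u_def s_def x_def)
      hence eu: "1 / (1 + e) \<le> exp (- u)" using e by (simp add: exp_minus field_simps)
      have inv': "1 / norm (1 + de_exp \<zeta>) \<le> 1 / c * exp (- u)"
      proof -
        have "1 / (c * (1 + e)) = 1 / c * (1 / (1 + e))" by simp
        also have "\<dots> \<le> 1 / c * exp (- u)" using eu c(1) by (intro mult_left_mono) auto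
        finally show ?thesis using inv by linarith
      qed
      have "norm (exp (- z)) = 1 / norm (1 + de_exp \<zeta>)"
        using exp_de_phi[OF \<zeta>'] by (simp only: exp_minus z_def norm_inverse divide_inverse mult_1_left)
      hence "norm (exp (- z)) powr \<beta> \<le> (1 / c * exp (- u)) powr \<beta>" using inv' ab by (intro powr_mono2) auto
      also have "\<dots> = (1 / c) powr \<beta> * exp (- (\<beta> * u))" by (simp only: powr_mult exp_powr_real) simp
      also have "\<dots> \<le> (1 / c) powr \<beta> * (cosh x * b)"
        using mono[of \<beta>] cb by (intro mult_left_mono) auto
      finally have "H * norm (exp (- z)) powr \<beta> \<le> H * ((1 / c) powr \<beta> * (cosh x * b))" using H by (intro mult_left_mono) auto
      hence 1: "norm (f z) \<le> H * (1 / c) powr \<beta> * (cosh x * b)" using right[OF zim] by (simp only: mult.assoc)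
      have "norm (r / (1 + de_exp \<zeta>)) = norm r * (1 / norm (1 + de_exp \<zeta>))" by (simp add: norm_divide)
      also have "\<dots> \<le> norm r * (1 / c * exp (- u))" using inv' by (intro mult_left_mono) auto
      also have "\<dots> = norm r / c * exp (- u)" by simp
      also have "\<dots> \<le> norm r / c * (cosh x * b)" using b1 cb c(1) by (intro mult_left_mono) auto
      finally have 2: "norm (r / (1 + de_exp \<zeta>)) \<le> norm r / c * (cosh x * b)" .
      have "norm (f z - r / (1 + de_exp \<zeta>)) \<le> norm (f z) + norm (r / (1 + de_exp \<zeta>))"
        by (rule norm_triangle_ineq4)
      also have "\<dots> \<le> (H * (1 / c) powr \<beta> + norm r / c) * (cosh x * b)" using 1 2 by (simp only: distrib_right)
      also have "\<dots> \<le> W * (cosh x * b)" using W(3) ch b by (intro mult_right_mono) auto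
      finally show ?thesis .
    qed
    also have "\<dots> \<le> W * ((1 + 1 / \<gamma>) * exp (- (2 * \<gamma> * s)))"
      unfolding b_def s_def using cosh_times_double_exp_le[OF \<gamma>0] W by (intro mult_left_mono) auto
    finally show "norm (f (de_phi \<zeta>) - r / (1 + de_exp \<zeta>)) \<le> W * (1 + 1 / \<gamma>) * exp (- (2 * \<gamma> * \<bar>sinh (Re \<zeta>)\<bar>))"
      by (simp only: z_def s_def x_def mult.assoc)
  qed (use W \<gamma>0 in \<open>auto intro!: mult_pos_pos add_pos_pos\<close>)
qed

section \<open>Mesh size, truncation numbers and the rate\<close>

lemma arsinh_le_self: "x \<ge> 0 \<Longrightarrow> arsinh x \<le> (x::real)"
  using abs_le_abs_sinh[of "arsinh x"] by simp

lemma arsinh_mono: "x \<le> y \<Longrightarrow> arsinh x \<le> arsinh (y::real)"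
  by (auto simp: le_less)

lemma exp_arsinh_le: "x \<ge> 0 \<Longrightarrow> exp (arsinh x) \<le> 2 * x + (1::real)"
proof -
  assume x: "x \<ge> 0"
  have "sqrt (x\<^sup>2 + 1) \<le> x + 1" using x by (intro real_le_lsqrt) (auto simp: power2_sum)
  moreover have "0 < x + sqrt (x\<^sup>2 + 1)" by (rule arsinh_real_aux)
  ultimately show ?thesis by (simp add: arsinh_real_def)
qed

context
  fixes \<alpha> \<beta> d :: real and n :: nat
  assumes pos: "0 < \<alpha>" "0 < \<beta>" "0 < d" and n: "n \<ge> 1"
begin

private abbreviation (input) "\<mu> \<equiv> min \<alpha> \<beta>"
private abbreviation (input) "h \<equiv> de_h d \<mu> n"

lemma de_h_pos: "h > 0" and de_h_times: "real n * h = arsinh (d * real n / \<mu>)"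
proof -
  have "d * real n / \<mu> > 0" using pos n by simp
  thus "h > 0" using n by (simp add: de_h_def)
  show "real n * h = arsinh (d * real n / \<mu>)" using n by (simp add: de_h_def)
qed

lemma de_h_le: "h \<le> d / \<mu>"
proof -
  have "arsinh (d * real n / \<mu>) \<le> d * real n / \<mu>" using pos n by (intro arsinh_le_self) auto
  hence "h \<le> d * real n / \<mu> / real n" unfolding de_h_def using n by (intro divide_right_mono) auto
  also have "\<dots> = d / \<mu>" using n by simp
  finally show ?thesis .
qed

text \<open>
  \<open>K\<close> is the truncation number that is not set to \<open>n\<close>, and \<open>b\<close> is the decay rate at its end. Up to rounding,
  \<open>b sinh (K h) = d n = \<mu> sinh (n h)\<close>, so the function is equally small at both end points.
\<close>

lemma de_truncation_number_bounds:
  assumes "\<mu> \<le> b" "b > 0" and K: "K = nat \<lceil>1 / h * arsinh (\<mu> / b * sinh (real n * h))\<rceil>"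
  shows "K \<le> n + 1" and "d * real n / b \<le> sinh (real K * h)"
proof -
  have arg: "\<mu> / b * sinh (real n * h) = d * real n / b"
    using pos by (simp add: de_h_times field_simps)
  have ar0: "arsinh (d * real n / b) \<ge> 0" using pos assms arsinh_mono[of 0 "d * real n / b"] by simp
  have Kge: "1 / h * arsinh (d * real n / b) \<le> real K" and Kle: "real K \<le> 1 / h * arsinh (d * real n / b) + 1"
  proof -
    have "0 \<le> 1 / h * arsinh (d * real n / b)" using ar0 de_h_pos by simp
    thus "1 / h * arsinh (d * real n / b) \<le> real K" "real K \<le> 1 / h * arsinh (d * real n / b) + 1"
      unfolding K arg by linarith+
  qed
  have "arsinh (d * real n / b) \<le> arsinh (d * real n / \<mu>)"
    using pos assms by (intro arsinh_mono frac_le) auto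
  also have "\<dots> = real n * h" by (simp only: de_h_times)
  finally have "1 / h * arsinh (d * real n / b) \<le> real n" using de_h_pos by (simp add: field_simps)
  with Kle show "K \<le> n + 1" by linarith
  have "arsinh (d * real n / b) \<le> real K * h" using Kge de_h_pos by (simp add: field_simps)
  hence "sinh (arsinh (d * real n / b)) \<le> sinh (real K * h)" by (simp only: sinh_real_le_iff)
  thus "d * real n / b \<le> sinh (real K * h)" by simp
qed

lemma sinh_de_h: "sinh (real n * h) = d * real n / \<mu>"
  by (simp add: de_h_times)

lemma de_M_le: "de_M \<alpha> \<beta> d n \<le> n + 1" and sinh_de_M_ge: "d * real n / \<alpha> \<le> sinh (real (de_M \<alpha> \<beta> d n) * h)"
proof -
  have *: "de_M \<alpha> \<beta> d n \<le> n + 1 \<and> d * real n / \<alpha> \<le> sinh (real (de_M \<alpha> \<beta> d n) * h)"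
  proof (cases "\<mu> = \<alpha>")
    case True
    thus ?thesis using sinh_de_h by (simp add: de_M_def Let_def)
  next
    case False
    hence \<mu>: "\<mu> = \<beta>" by linarith
    have "de_M \<alpha> \<beta> d n = nat \<lceil>1 / h * arsinh (\<mu> / \<alpha> * sinh (real n * h))\<rceil>"
      using False unfolding de_M_def Let_def by (simp only: if_False)
    with de_truncation_number_bounds[of \<alpha> "de_M \<alpha> \<beta> d n"] pos show ?thesis by simp
  qed
  thus "de_M \<alpha> \<beta> d n \<le> n + 1" "d * real n / \<alpha> \<le> sinh (real (de_M \<alpha> \<beta> d n) * h)" by auto
qed

lemma de_N_le: "de_N \<alpha> \<beta> d n \<le> n + 1" and sinh_de_N_ge: "d * real n / \<beta> \<le> sinh (real (de_N \<alpha> \<beta> d n) * h)"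
proof -
  have *: "de_N \<alpha> \<beta> d n \<le> n + 1 \<and> d * real n / \<beta> \<le> sinh (real (de_N \<alpha> \<beta> d n) * h)"
  proof (cases "\<mu> = \<alpha>")
    case True
    show ?thesis using de_truncation_number_bounds[of \<beta> "de_N \<alpha> \<beta> d n"] pos True
      by (simp add: de_N_def Let_def)
  next
    case False
    hence \<mu>: "\<mu> = \<beta>" by linarith
    have "de_N \<alpha> \<beta> d n = n" using False by (simp add: de_N_def Let_def)
    thus ?thesis using sinh_de_h \<mu> by simp
  qed
  thus "de_N \<alpha> \<beta> d n \<le> n + 1" "d * real n / \<beta> \<le> sinh (real (de_N \<alpha> \<beta> d n) * h)" by auto
qed

text \<open>
  The outermost nodes are of the order of \<open>ln n\<close>, so \<open>\<phi>'\<close>, which grows like \<open>cosh\<close>, is of order \<open>n\<close> there.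
\<close>

lemma exp_truncation_point_le: "exp (real (n + 1) * h) \<le> (2 * d / \<mu> + 1) * exp (d / \<mu>) * real n"
proof -
  have "exp (real (n + 1) * h) = exp (arsinh (d * real n / \<mu>)) * exp h"
    by (simp add: distrib_right exp_add de_h_times[symmetric])
  also have "\<dots> \<le> (2 * (d * real n / \<mu>) + 1) * exp (d / \<mu>)"
    using pos de_h_le by (intro mult_mono exp_arsinh_le) auto
  also have "2 * (d * real n / \<mu>) + 1 \<le> (2 * d / \<mu> + 1) * real n"
    using n by (simp add: algebra_simps)
  hence "(2 * (d * real n / \<mu>) + 1) * exp (d / \<mu>) \<le> (2 * d / \<mu> + 1) * real n * exp (d / \<mu>)"
    by (rule mult_right_mono) simp
  finally show ?thesis by (simp only: mult_ac)
qed

lemma arsinh_de_ge: "arsinh (d / \<mu>) \<le> arsinh (d * real n / \<mu>)"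
  using pos n by (intro arsinh_mono divide_right_mono) auto

text \<open>
  Since \<open>\<pi>d/h \<ge> \<pi>\<mu>\<close>, replacing \<open>sinh\<close> by half the exponential costs only a constant factor.
\<close>

lemma inverse_sinh_le:
  "1 / sinh (pi * d / h) \<le> 2 / (1 - exp (- (2 * pi * \<mu>))) * exp (- pi * d * real n / arsinh (d * real n / \<mu>))"
proof -
  define v where "v = pi * d / h"
  have v: "v = pi * d * real n / arsinh (d * real n / \<mu>)" using n by (simp add: v_def de_h_def)
  have "\<mu> * h \<le> d" using de_h_le pos by (simp add: field_simps)
  hence "\<mu> \<le> d / h" using de_h_pos by (simp add: field_simps)
  hence "pi * \<mu> \<le> pi * (d / h)" by (intro mult_left_mono) auto
  hence v_ge: "pi * \<mu> \<le> v" by (simp add: v_def)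
  define q where "q = exp (- (2 * pi * \<mu>))"
  have q: "q < 1" using pos by (simp add: q_def)
  have "exp (- (2 * v)) \<le> q" using v_ge by (simp add: q_def)
  hence "exp v * (1 - q) \<le> exp v * (1 - exp (- (2 * v)))" by (intro mult_left_mono) auto
  also have "\<dots> = 2 * sinh v" by (simp add: sinh_field_def right_diff_distrib exp_add[symmetric])
  finally have s: "exp v * (1 - q) / 2 \<le> sinh v" by simp
  have "1 / sinh v \<le> 1 / (exp v * (1 - q) / 2)" using s q by (intro frac_le) auto
  also have "\<dots> = 2 / (1 - q) * exp (- v)" using q by (simp add: exp_minus field_simps)
  finally show ?thesis unfolding v_def[symmetric] q_def[symmetric] using v by simp
qed

lemma harm_nodes_le: "l \<le> 2 * n + 3 \<Longrightarrow> harm l \<le> (4 + 1 / ln 2) * ln (real n + 1)"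
proof -
  assume l: "l \<le> 2 * n + 3"
  have "(harm l :: real) \<le> harm (2 * n + 3)" using l by (rule harm_mono)
  also have "\<dots> \<le> ln (real (2 * n + 3)) + 1" using euler_mascheroni_sequence_decreasing[of 1 "2 * n + 3"] by (simp add: harm_expand)
  also have "ln (real (2 * n + 3)) \<le> ln ((real n + 1) ^ 4)"
  proof -
    have n1: "1 \<le> real n" using n by simp
    \<comment> \<open>A crude bound: \<open>2 n + 3\<close> is at most \<open>(n + 1)\<close> to the fourth power.\<close>
    have "2 * real n + 3 \<le> 2 * (real n + 1) * (2 :: real)" using n1 by simp
    also have "\<dots> \<le> 2 * (real n + 1) * (real n + 1)" using n1 by (intro mult_left_mono) auto
    also have "\<dots> \<le> (real n + 1) * (real n + 1) * ((real n + 1) * (real n + 1))"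
    proof -
      have "2 * 1 \<le> (real n + 1) * (real n + 1)" using n1 by (intro mult_mono) auto
      hence "2 * ((real n + 1) * (real n + 1)) \<le> (real n + 1) * (real n + 1) * ((real n + 1) * (real n + 1))"
        by (intro mult_right_mono) auto
      thus ?thesis by (simp only: mult.assoc)
    qed
    also have "\<dots> = (real n + 1) ^ 4" by (simp add: power4_eq_xxxx mult.assoc)
    finally show ?thesis by simp
  qed
  also have "\<dots> = 4 * ln (real n + 1)" by (simp add: ln_realpow)
  finally have "harm l \<le> 4 * ln (real n + 1) + 1" by simp
  moreover have "1 \<le> 1 / ln 2 * ln (real n + 1)"
  proof -
    have "ln 2 \<le> ln (real n + 1)" using n by simp
    thus ?thesis by (simp add: field_simps)
  qed
  ultimately show ?thesis unfolding distrib_right by linarith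
qed

end

text \<open>
  The target exponent is \<open>o(n)\<close> because \<open>arsinh(dn/\<mu>)\<close> tends to infinity, so every term that decays
  geometrically in \<open>n\<close> is negligible against the rate.
\<close>

lemma exp_minus_linear_le_de_rate:
  fixes c d \<mu> :: real
  assumes c: "c > 0" and pos: "d > 0" "\<mu> > 0"
  obtains C where "C > 0"
    "\<And>n::nat. (1 + real n) * exp (- (c * real n)) \<le> C * exp (- pi * d * real n / arsinh (d * real n / \<mu>))"
proof -
  define f where "f = (\<lambda>n::nat. (1 + real n) * exp (- (c * real n)) * exp (pi * d * real n / arsinh (d * real n / \<mu>)))"
  have "f \<longlonglongrightarrow> 0"
    unfolding f_def arsinh_real_def using c pos by real_asymp
  hence "Bseq f" using convergent_def convergent_imp_Bseq by blast
  then obtain C where C: "C > 0" "\<And>n. norm (f n) \<le> C" by (auto elim: BseqE)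
  show ?thesis
  proof (rule that[OF C(1)])
    fix n :: nat
    let ?v = "pi * d * real n / arsinh (d * real n / \<mu>)"
    have "f n \<le> C" using C(2)[of n] by simp
    hence "f n * exp (- ?v) \<le> C * exp (- ?v)" by (intro mult_right_mono) auto
    moreover have "f n * exp (- ?v) = (1 + real n) * exp (- (c * real n))"
      unfolding f_def by (simp add: exp_minus)
    ultimately show "(1 + real n) * exp (- (c * real n)) \<le> C * exp (- pi * d * real n / arsinh (d * real n / \<mu>))"
      by simp
  qed
qed

lemma sinc_error_bound_le_de_rate:
  fixes A \<gamma> \<alpha> \<beta> d :: real
  assumes pos: "0 < \<alpha>" "0 < \<beta>" "0 < d" "0 < \<gamma>" "0 < A" and \<mu>: "\<mu> = min \<alpha> \<beta>"
  obtains C where "C > 0" "\<And>n. n \<ge> 1 \<Longrightarrow>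
     A / (d * sinh (pi * d / de_h d \<mu> n)) + A * exp (- (\<gamma> * (d * real n / max \<alpha> \<beta>))) * (1 + 1 / (\<gamma> * de_h d \<mu> n))
     \<le> C * exp (- pi * d * real n / arsinh (d * real n / \<mu>))"
proof -
  have \<mu>0: "\<mu> > 0" using pos \<mu> by simp
  define c where "c = \<gamma> * d / max \<alpha> \<beta>"
  have c: "c > 0" using pos by (simp add: c_def)
  obtain C where C: "C > 0" "\<And>n::nat. (1 + real n) * exp (- (c * real n)) \<le> C * exp (- pi * d * real n / arsinh (d * real n / \<mu>))"
    using exp_minus_linear_le_de_rate[OF c pos(3) \<mu>0] by blast
  define C1 where "C1 = A / d * (2 / (1 - exp (- (2 * pi * \<mu>))))"
  have C1: "C1 > 0" using pos \<mu>0 by (simp add: C1_def)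
  define a where "a = arsinh (d / \<mu>)"
  have a: "a > 0" using pos \<mu>0 by (simp add: a_def)
  define C2 where "C2 = A * (1 + 1 / (\<gamma> * a))"
  have C2: "C2 > 0" using pos a by (simp add: C2_def add_pos_pos)
  show ?thesis
  proof (rule that[of "C1 + C2 * C"])
    show "C1 + C2 * C > 0" using C1 C2 C by (simp add: add_pos_pos)
    fix n :: nat assume n: "n \<ge> 1"
    define R where "R = exp (- pi * d * real n / arsinh (d * real n / \<mu>))"
    define h where "h = de_h d \<mu> n"
    have h: "h > 0" using de_h_pos[OF pos(1-3) n] by (simp add: h_def \<mu>)
    have "A / (d * sinh (pi * d / h)) = A / d * (1 / sinh (pi * d / h))" by simp
    also have "\<dots> \<le> A / d * (2 / (1 - exp (- (2 * pi * \<mu>))) * R)"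
      using inverse_sinh_le[OF pos(1-3) n] pos by (intro mult_left_mono) (auto simp: h_def \<mu> R_def)
    also have "\<dots> = C1 * R" by (simp add: C1_def)
    finally have 1: "A / (d * sinh (pi * d / h)) \<le> C1 * R" .
    have "a \<le> real n * h" using arsinh_de_ge[OF pos(1-3) n] de_h_times[OF pos(1-3) n] by (simp add: a_def h_def \<mu>)
    hence "1 / (\<gamma> * h) \<le> 1 / (\<gamma> * a) * real n" using h a pos by (simp add: field_simps)
    moreover have "1 + 1 / (\<gamma> * a) * real n \<le> (1 + 1 / (\<gamma> * a)) * (1 + real n)"
    proof -
      have "0 \<le> 1 / (\<gamma> * a)" using a pos by simp
      thus ?thesis unfolding distrib_right distrib_left by simp
    qed
    ultimately have "1 + 1 / (\<gamma> * h) \<le> (1 + 1 / (\<gamma> * a)) * (1 + real n)" by linarith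
    moreover have "\<gamma> * (d * real n / max \<alpha> \<beta>) = c * real n" by (simp add: c_def)
    ultimately have "A * exp (- (\<gamma> * (d * real n / max \<alpha> \<beta>))) * (1 + 1 / (\<gamma> * h))
        \<le> A * exp (- (c * real n)) * ((1 + 1 / (\<gamma> * a)) * (1 + real n))"
      using pos by (simp only:) (intro mult_left_mono, auto)
    also have "\<dots> = C2 * ((1 + real n) * exp (- (c * real n)))" by (simp add: C2_def mult_ac)
    also have "\<dots> \<le> C2 * (C * R)" using C(2)[of n] C2 by (intro mult_left_mono) (auto simp: R_def)
    finally have 2: "A * exp (- (\<gamma> * (d * real n / max \<alpha> \<beta>))) * (1 + 1 / (\<gamma> * h)) \<le> C2 * C * R" by simp
    show "A / (d * sinh (pi * d / de_h d \<mu> n)) + A * exp (- (\<gamma> * (d * real n / max \<alpha> \<beta>))) * (1 + 1 / (\<gamma> * de_h d \<mu> n))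
      \<le> (C1 + C2 * C) * exp (- pi * d * real n / arsinh (d * real n / \<mu>))"
      using 1 2 unfolding R_def[symmetric] h_def[symmetric] distrib_right by (rule add_mono)
  qed
qed

section \<open>The collocation system\<close>

lemma mat_mult_vec_index:
  fixes A :: "complex mat"
  assumes "A \<in> carrier_mat n n" "v \<in> carrier_vec n" "i < n"
  shows "vec_index (A *\<^sub>v v) i = (\<Sum>j<n. A $$ (i, j) * vec_index v j)"
  using assms by (auto simp: scalar_prod_def atLeast0LessThan intro!: sum.cong)

lemma vec_max_norm_ge: "i < dim_vec v \<Longrightarrow> cmod (vec_index v i) \<le> vec_max_norm v"
  unfolding vec_max_norm_def by (intro Max_ge) auto

lemma vec_max_norm_le:
  assumes "dim_vec v > 0" "\<And>i. i < dim_vec v \<Longrightarrow> cmod (vec_index v i) \<le> c"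
  shows "vec_max_norm v \<le> c"
  unfolding vec_max_norm_def using assms by (subst Max_le_iff) auto

lemma vec_max_norm_pos:
  assumes "v \<in> carrier_vec n - {0\<^sub>v n}"
  shows "vec_max_norm v > 0"
proof -
  obtain i where i: "i < n" "vec_index v i \<noteq> 0" using assms by (metis Diff_iff carrier_vecD eq_vecI index_zero_vec singletonI)
  have "0 < cmod (vec_index v i)" using i by simp
  also have "\<dots> \<le> vec_max_norm v" using i assms by (intro vec_max_norm_ge) auto
  finally show ?thesis .
qed

text \<open>
  The supremum in \<open>mat_max_norm\<close> is taken in the reals, so the quotients must first be shown to be bounded.
  The sum of the moduli of all entries is a crude bound.
\<close>

lemma vec_max_norm_mult_le:
  assumes A: "A \<in> carrier_mat n n" and n: "n > 0" and v: "v \<in> carrier_vec n"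
  shows "vec_max_norm (A *\<^sub>v v) \<le> mat_max_norm A * vec_max_norm v"
    and "0 \<le> mat_max_norm A"
proof -
  have nn: "0 \<le> vec_max_norm u" if "u \<in> carrier_vec n" for u
    using vec_max_norm_ge[of 0 u] n that norm_ge_zero order_trans by (metis carrier_vecD)
  define c where "c = (\<Sum>i<n. \<Sum>j<n. cmod (A $$ (i, j)))"
  have raw: "vec_max_norm (A *\<^sub>v u) \<le> c * vec_max_norm u" if u: "u \<in> carrier_vec n" for u
  proof (rule vec_max_norm_le)
    fix i assume "i < dim_vec (A *\<^sub>v u)"
    hence i: "i < n" using A by simp
    have "cmod (vec_index (A *\<^sub>v u) i) \<le> (\<Sum>j<n. cmod (A $$ (i, j) * vec_index u j))"
      unfolding mat_mult_vec_index[OF A u i] by (rule norm_sum)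
    also have "\<dots> \<le> (\<Sum>j<n. cmod (A $$ (i, j)) * vec_max_norm u)"
      unfolding norm_mult using u by (intro sum_mono mult_left_mono vec_max_norm_ge) auto
    also have "\<dots> = (\<Sum>j<n. cmod (A $$ (i, j))) * vec_max_norm u" by (simp add: sum_distrib_right)
    also have "\<dots> \<le> c * vec_max_norm u"
      unfolding c_def using nn[OF u] i
      by (intro mult_right_mono member_le_sum[of i "{..<n}" "\<lambda>i. \<Sum>j<n. cmod (A $$ (i, j))"] sum_nonneg) auto
    finally show "cmod (vec_index (A *\<^sub>v u) i) \<le> c * vec_max_norm u" .
  qed (use A n in auto)
  have bdd: "bdd_above ((\<lambda>u. vec_max_norm (A *\<^sub>v u) / vec_max_norm u) ` (carrier_vec (dim_col A) - {0\<^sub>v (dim_col A)}))"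
  proof (rule bdd_aboveI2[where M=c])
    fix u :: "complex Matrix.vec" assume "u \<in> carrier_vec (dim_col A) - {0\<^sub>v (dim_col A)}"
    hence u: "u \<in> carrier_vec n - {0\<^sub>v n}" using A by auto
    have "vec_max_norm (A *\<^sub>v u) \<le> c * vec_max_norm u" using raw u by simp
    thus "vec_max_norm (A *\<^sub>v u) / vec_max_norm u \<le> c" using vec_max_norm_pos[OF u] by (simp add: pos_divide_le_eq)
  qed
  have le: "vec_max_norm (A *\<^sub>v u) \<le> mat_max_norm A * vec_max_norm u" if u: "u \<in> carrier_vec n - {0\<^sub>v n}" for u
  proof -
    have "vec_max_norm (A *\<^sub>v u) / vec_max_norm u \<le> mat_max_norm A"
      unfolding mat_max_norm_def using u A by (intro cSUP_upper bdd) auto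
    thus ?thesis using vec_max_norm_pos[OF u] by (simp add: pos_divide_le_eq)
  qed
  show "vec_max_norm (A *\<^sub>v v) \<le> mat_max_norm A * vec_max_norm v"
  proof (cases "v = 0\<^sub>v n")
    case True
    have "vec_max_norm (0\<^sub>v n) = 0"
      using nn[of "0\<^sub>v n"] n by (intro antisym vec_max_norm_le) auto
    moreover have "A *\<^sub>v v = 0\<^sub>v n"
    proof (rule eq_vecI)
      fix i assume "i < dim_vec (0\<^sub>v n :: complex Matrix.vec)"
      hence i: "i < n" by simp
      show "vec_index (A *\<^sub>v v) i = vec_index (0\<^sub>v n) i"
        unfolding mat_mult_vec_index[OF A v i] using i by (simp add: True)
    qed (use carrier_matD[OF A] in simp)
    ultimately show ?thesis by (simp add: True)
  qed (use le v in auto)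
  define u where "u = vec n (\<lambda>_. 1 :: complex)"
  have u: "u \<in> carrier_vec n - {0\<^sub>v n}"
  proof -
    have "vec_index u 0 \<noteq> vec_index (0\<^sub>v n) 0" using n by (simp add: u_def)
    thus ?thesis by (auto simp: u_def)
  qed
  have "0 \<le> vec_max_norm (A *\<^sub>v u)" using A u by (intro nn) auto
  hence "0 \<le> mat_max_norm A * vec_max_norm u" using le[OF u] by linarith
  thus "0 \<le> mat_max_norm A" using vec_max_norm_pos[OF u] by (simp add: zero_le_mult_iff)
qed

text \<open>
  The inverse that \<open>invertible_mat\<close> provides carries no dimensions; they follow from the two product equations.
\<close>

lemma mat_inverse_of_invertible:
  fixes A :: "complex mat"
  assumes A: "A \<in> carrier_mat n n" and inv: "invertible_mat A"
  shows "A * the (mat_inverse A) = 1\<^sub>m n" "the (mat_inverse A) * A = 1\<^sub>m n" "the (mat_inverse A) \<in> carrier_mat n n"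
proof -
  obtain X where X: "A * X = 1\<^sub>m n" "X * A = 1\<^sub>m (dim_row X)"
    using inv A unfolding invertible_mat_def inverts_mat_def by auto
  have "dim_col X = n" using arg_cong[OF X(1), of dim_col] by simp
  moreover have "dim_row X = n" using arg_cong[OF X(2), of dim_col] A by simp
  ultimately have "X \<in> carrier_mat n n" "X * A = 1\<^sub>m n" using X by auto
  hence "A \<in> Units (ring_mat TYPE(complex) n ())"
    using A X(1) unfolding Units_def ring_mat_def by auto
  hence "mat_inverse A \<noteq> None" using mat_inverse(1)[OF A, of "()"] by auto
  then obtain Y where Y: "mat_inverse A = Some Y" by auto
  from mat_inverse(2)[OF A this]
  show "A * the (mat_inverse A) = 1\<^sub>m n" "the (mat_inverse A) * A = 1\<^sub>m n" "the (mat_inverse A) \<in> carrier_mat n n"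
    using Y by auto
qed

lemma sum_blocks:
  fixes f :: "nat \<Rightarrow> complex"
  shows "(\<Sum>b<m * l. f b) = (\<Sum>j<m. \<Sum>q<l. f (j * l + q))"
proof -
  have "(\<Sum>q<l. f (j * l + q)) = sum f {j * l..<j * l + l}" for j
    by (rule sum.reindex_bij_witness[of _ "\<lambda>b. b - j * l" "\<lambda>q. j * l + q"]) auto
  thus ?thesis by (simp add: sum.nat_group)
qed

lemma block_index_less: "i < m \<Longrightarrow> p < l \<Longrightarrow> i * l + p < m * (l::nat)"
proof -
  assume "i < m" "p < l"
  hence "i * l + p < i * l + l" by simp
  also have "\<dots> = Suc i * l" by simp
  also have "\<dots> \<le> m * l" using \<open>i < m\<close> by (intro mult_le_mono1) simp
  finally show ?thesis .
qed

context
  fixes m M N l :: nat and h :: real and k :: "nat \<Rightarrow> nat \<Rightarrow> complex \<Rightarrow> complex"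
    and g :: "nat \<Rightarrow> complex \<Rightarrow> complex" and r :: "nat \<Rightarrow> complex"
  assumes m: "m > 0"
  defines "l \<equiv> M + N + 1"
begin

private abbreviation (input) "nd q \<equiv> de_node h (int q - int M)"
private abbreviation (input) "dnd q \<equiv> de_node_deriv h (int q - int M)"
private abbreviation (input) "\<sigma> p q \<equiv> complex_of_real (h * (1 / 2 + 1 / pi * Si (pi * (real p - real q))))"

lemma int_op_mat_carrier: "int_op_mat m h M N \<in> carrier_mat (m * l) (m * l)"
  unfolding int_op_mat_def kronecker_mat_def l_def
  by (auto simp: sinc_int_mat_def D_mat_def mat_diag_def)

lemma int_op_mat_mult_index:
  assumes v: "v \<in> carrier_vec (m * l)" and i: "i < m" and p: "p < l"
  shows "vec_index (int_op_mat m h M N *\<^sub>v v) (i * l + p) = (\<Sum>q<l. \<sigma> p q * dnd q * vec_index v (i * l + q))"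
proof -
  have SD: "sinc_int_mat l * D_mat h M N = mat l l (\<lambda>(p, q). of_real (1 / 2 + 1 / pi * Si (pi * (real p - real q))) * dnd q)"
  proof -
    have "sinc_int_mat l \<in> carrier_mat l l" by (simp add: sinc_int_mat_def)
    from mat_diag_mult_right[OF this] show ?thesis
      unfolding D_mat_def l_def[symmetric] by (auto intro!: eq_matI simp: sinc_int_mat_def)
  qed
  have entry: "int_op_mat m h M N $$ (i * l + p, j * l + q) = (if j = i then \<sigma> p q * dnd q else 0)"
    if "j < m" "q < l" for j q
  proof -
    have "(i * l + p) div l = i" "(i * l + p) mod l = p" "(j * l + q) div l = j" "(j * l + q) mod l = q"
      using that p by auto
    thus ?thesis
      using block_index_less[OF i p] block_index_less[OF that] i p that
      unfolding int_op_mat_def kronecker_mat_def l_def[symmetric] SD by auto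
  qed
  have "vec_index (int_op_mat m h M N *\<^sub>v v) (i * l + p) =
     (\<Sum>j<m. \<Sum>q<l. int_op_mat m h M N $$ (i * l + p, j * l + q) * vec_index v (j * l + q))"
    by (subst mat_mult_vec_index[OF int_op_mat_carrier v block_index_less[OF i p]]) (rule sum_blocks)
  also have "\<dots> = (\<Sum>j<m. if j = i then (\<Sum>q<l. \<sigma> p q * dnd q * vec_index v (i * l + q)) else 0)"
    by (intro sum.cong refl) (auto simp: entry)
  also have "\<dots> = (\<Sum>q<l. \<sigma> p q * dnd q * vec_index v (i * l + q))" using i by simp
  finally show ?thesis .
qed

lemma block_mat_mult_index:
  assumes v: "v \<in> carrier_vec (m * l)" and i: "i < m" and p: "p < l"
  shows "vec_index (block_mat m l (\<lambda>i j. K_mat (k i j) h M N) *\<^sub>v v) (i * l + p) = (\<Sum>j<m. k i j (nd p) * vec_index v (j * l + p))"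
proof -
  let ?A = "block_mat m l (\<lambda>i j. K_mat (k i j) h M N)"
  have A: "?A \<in> carrier_mat (m * l) (m * l)" by (simp add: block_mat_def)
  have entry: "?A $$ (i * l + p, j * l + q) = (if q = p then k i j (nd p) else 0)"
    if "j < m" "q < l" for j q
  proof -
    have "(i * l + p) div l = i" "(i * l + p) mod l = p" "(j * l + q) div l = j" "(j * l + q) mod l = q"
      using that p by auto
    thus ?thesis
      using block_index_less[OF i p] block_index_less[OF that] i p that
      unfolding block_mat_def K_mat_def l_def[symmetric] by (auto simp: mat_diag_def)
  qed
  have "vec_index (?A *\<^sub>v v) (i * l + p) = (\<Sum>j<m. \<Sum>q<l. ?A $$ (i * l + p, j * l + q) * vec_index v (j * l + q))"
    by (subst mat_mult_vec_index[OF A v block_index_less[OF i p]]) (rule sum_blocks)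
  also have "\<dots> = (\<Sum>j<m. \<Sum>q<l. if q = p then k i j (nd p) * vec_index v (j * l + p) else 0)"
    by (intro sum.cong refl) (auto simp: entry)
  also have "\<dots> = (\<Sum>j<m. k i j (nd p) * vec_index v (j * l + p))" using p by simp
  finally show ?thesis .
qed

lemma kronecker_one_one: "kronecker_mat (1\<^sub>m m) (1\<^sub>m l) = 1\<^sub>m (m * l)"
proof (rule eq_matI)
  fix a b assume ab: "a < dim_row (1\<^sub>m (m * l) :: complex mat)" "b < dim_col (1\<^sub>m (m * l) :: complex mat)"
  hence d: "a div l < m" "b div l < m" "a mod l < l" "b mod l < l"
    using l_def by (auto simp: less_mult_imp_div_less)
  moreover have "(a div l = b div l \<and> a mod l = b mod l) \<longleftrightarrow> a = b" by (metis div_mult_mod_eq)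
  ultimately show "kronecker_mat (1\<^sub>m m) (1\<^sub>m l) $$ (a, b) = 1\<^sub>m (m * l) $$ (a, b)"
    using ab by (auto simp: kronecker_mat_def)
qed (auto simp: kronecker_mat_def)

lemma B_mat_carrier: "B_mat m k h M N \<in> carrier_mat (m * l) (m * l)"
  using int_op_mat_carrier unfolding B_mat_def l_def[symmetric] by (auto simp: block_mat_def)

lemma B_mat_mult:
  assumes v: "v \<in> carrier_vec (m * l)"
  shows "B_mat m k h M N *\<^sub>v v = v - int_op_mat m h M N *\<^sub>v (block_mat m l (\<lambda>i j. K_mat (k i j) h M N) *\<^sub>v v)"
proof -
  have A: "block_mat m l (\<lambda>i j. K_mat (k i j) h M N) \<in> carrier_mat (m * l) (m * l)" by (simp add: block_mat_def)
  show ?thesis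
    unfolding B_mat_def l_def[symmetric] kronecker_one_one
    using v int_op_mat_carrier A
    by (subst minus_mult_distrib_mat_vec[of _ "m * l" "m * l"]) auto
qed

lemma B_mat_mult_index:
  assumes v: "v \<in> carrier_vec (m * l)" and i: "i < m" and p: "p < l"
  shows "vec_index (B_mat m k h M N *\<^sub>v v) (i * l + p) = vec_index v (i * l + p) -
    (\<Sum>q<l. \<sigma> p q * dnd q * (\<Sum>j<m. k i j (nd q) * vec_index v (j * l + q)))"
proof -
  let ?A = "block_mat m l (\<lambda>i j. K_mat (k i j) h M N)"
  have A: "?A \<in> carrier_mat (m * l) (m * l)" by (simp add: block_mat_def)
  have Av: "?A *\<^sub>v v \<in> carrier_vec (m * l)" using A v by auto
  have "vec_index (B_mat m k h M N *\<^sub>v v) (i * l + p) = vec_index v (i * l + p) - vec_index (int_op_mat m h M N *\<^sub>v (?A *\<^sub>v v)) (i * l + p)"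
    unfolding B_mat_mult[OF v] using int_op_mat_carrier block_index_less[OF i p] by (intro index_minus_vec(1)) auto
  also have "vec_index (int_op_mat m h M N *\<^sub>v (?A *\<^sub>v v)) (i * l + p) = (\<Sum>q<l. \<sigma> p q * dnd q * (\<Sum>j<m. k i j (nd q) * vec_index v (j * l + q)))"
    unfolding int_op_mat_mult_index[OF Av i p] by (intro sum.cong refl) (simp add: block_mat_mult_index[OF v i])
  finally show ?thesis .
qed

text \<open>
  By invertibility the definite description in \<open>Y_vec\<close> denotes the solution. Written per component and node, the
  system is the discretised integral equation.
\<close>

lemma collocation_solution:
  assumes inv: "invertible_mat (B_mat m k h M N)"
  shows "Y_vec m k g r h M N \<in> carrier_vec (m * l)"
    and "\<lbrakk>i < m; p < l\<rbrakk> \<Longrightarrow> vec_index (Y_vec m k g r h M N) (i * l + p) = r i +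
      (\<Sum>q<l. \<sigma> p q * dnd q * ((\<Sum>j<m. k i j (nd q) * vec_index (Y_vec m k g r h M N) (j * l + q)) + g i (nd q)))"
proof -
  define B where "B = B_mat m k h M N"
  define Bi where "Bi = the (mat_inverse B)"
  define w where "w = R_vec m r M N + int_op_mat m h M N *\<^sub>v G_vec m g h M N"
  define Y where "Y = Y_vec m k g r h M N"
  have B: "B \<in> carrier_mat (m * l) (m * l)" unfolding B_def by (rule B_mat_carrier)
  have Bi: "B * Bi = 1\<^sub>m (m * l)" "Bi * B = 1\<^sub>m (m * l)" "Bi \<in> carrier_mat (m * l) (m * l)"
    using mat_inverse_of_invertible[OF B] inv by (auto simp: B_def Bi_def)
  have R: "R_vec m r M N \<in> carrier_vec (m * l)" and G: "G_vec m g h M N \<in> carrier_vec (m * l)"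
    by (simp_all add: R_vec_def G_vec_def l_def)
  have w: "w \<in> carrier_vec (m * l)" unfolding w_def using R int_op_mat_carrier G by auto
  have "\<exists>!Y. Y \<in> carrier_vec (m * l) \<and> B *\<^sub>v Y = w"
  proof (rule ex1I)
    have "B *\<^sub>v (Bi *\<^sub>v w) = (B * Bi) *\<^sub>v w"
      using B Bi(3) w by (intro assoc_mult_mat_vec[symmetric]) auto
    also have "\<dots> = w" using Bi w by simp
    finally show "Bi *\<^sub>v w \<in> carrier_vec (m * l) \<and> B *\<^sub>v (Bi *\<^sub>v w) = w" using Bi w by auto
  next
    fix Z assume Z: "Z \<in> carrier_vec (m * l) \<and> B *\<^sub>v Z = w"
    have "Z = (Bi * B) *\<^sub>v Z" using Bi Z by simp
    also have "\<dots> = Bi *\<^sub>v (B *\<^sub>v Z)" using Bi(3) B Z by (intro assoc_mult_mat_vec) auto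
    finally show "Z = Bi *\<^sub>v w" using Z by simp
  qed
  from theI'[OF this] have Y: "Y \<in> carrier_vec (m * l)" and BY: "B *\<^sub>v Y = w"
    unfolding Y_def Y_vec_def B_def w_def l_def by auto
  show "Y_vec m k g r h M N \<in> carrier_vec (m * l)" using Y by (simp add: Y_def)
  show "vec_index (Y_vec m k g r h M N) (i * l + p) = r i +
      (\<Sum>q<l. \<sigma> p q * dnd q * ((\<Sum>j<m. k i j (nd q) * vec_index (Y_vec m k g r h M N) (j * l + q)) + g i (nd q)))"
    if i: "i < m" and p: "p < l"
  proof -
    have "vec_index Y (i * l + p) - (\<Sum>q<l. \<sigma> p q * dnd q * (\<Sum>j<m. k i j (nd q) * vec_index Y (j * l + q))) = vec_index w (i * l + p)"
      using B_mat_mult_index[OF Y i p] BY by (simp only: B_def)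
    also have "vec_index w (i * l + p) = r i + (\<Sum>q<l. \<sigma> p q * dnd q * g i (nd q))"
    proof -
      have "vec_index w (i * l + p) = vec_index (R_vec m r M N) (i * l + p) + vec_index (int_op_mat m h M N *\<^sub>v G_vec m g h M N) (i * l + p)"
        unfolding w_def using int_op_mat_carrier block_index_less[OF i p] by (intro index_add_vec(1)) auto
      moreover have "vec_index (R_vec m r M N) (i * l + p) = r i"
        using block_index_less[OF i p] p unfolding R_vec_def l_def[symmetric] by simp
      moreover have "vec_index (G_vec m g h M N) (i * l + q) = g i (nd q)" if "q < l" for q
        using block_index_less[OF i that] that unfolding G_vec_def l_def[symmetric] by simp
      ultimately show ?thesis using int_op_mat_mult_index[OF G i p] by simp
    qed
    finally show ?thesis unfolding Y_def[symmetric] by (simp add: distrib_left sum.distrib algebra_simps)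
  qed
qed

text \<open>
  \<open>B\<close> maps the vector of nodal errors to the vector of residuals of \<open>z\<close>.
\<close>

lemma collocation_stability:
  assumes inv: "invertible_mat (B_mat m k h M N)"
    and z: "\<And>i p. \<lbrakk>i < m; p < l\<rbrakk> \<Longrightarrow>
      norm (z i p - r i - (\<Sum>q<l. \<sigma> p q * dnd q * ((\<Sum>j<m. k i j (nd q) * z j q) + g i (nd q)))) \<le> \<epsilon>"
    and i: "i < m" and p: "p < l"
  shows "norm (z i p - vec_index (Y_vec m k g r h M N) (i * l + p))
     \<le> mat_max_norm (the (mat_inverse (B_mat m k h M N))) * \<epsilon>"
proof -
  define B where "B = B_mat m k h M N"
  define Bi where "Bi = the (mat_inverse B)"
  define Y where "Y = Y_vec m k g r h M N"
  define v where "v = vec (m * l) (\<lambda>a. z (a div l) (a mod l) - vec_index Y a)"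
  have l: "l > 0" by (simp add: l_def)
  have B: "B \<in> carrier_mat (m * l) (m * l)" unfolding B_def by (rule B_mat_carrier)
  have Bi: "B * Bi = 1\<^sub>m (m * l)" "Bi * B = 1\<^sub>m (m * l)" "Bi \<in> carrier_mat (m * l) (m * l)"
    using mat_inverse_of_invertible[OF B] inv by (auto simp: B_def Bi_def)
  have v: "v \<in> carrier_vec (m * l)" by (simp add: v_def)
  have ml: "m * l > 0" using m l by simp
  have vi: "vec_index v (i * l + p) = z i p - vec_index Y (i * l + p)" if "i < m" "p < l" for i p
    using block_index_less[OF that] that by (simp add: v_def)
  have Bv: "vec_max_norm (B *\<^sub>v v) \<le> \<epsilon>"
  proof (rule vec_max_norm_le)
    show "dim_vec (B *\<^sub>v v) > 0" using B ml by simp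
    fix a assume "a < dim_vec (B *\<^sub>v v)"
    hence a: "a < m * l" using B by simp
    define i p where "i = a div l" and "p = a mod l"
    have ip: "i < m" "p < l" "a = i * l + p" using a l by (auto simp: i_def p_def less_mult_imp_div_less)
    have "vec_index (B *\<^sub>v v) a = z i p - vec_index Y (i * l + p) -
      (\<Sum>q<l. \<sigma> p q * dnd q * (\<Sum>j<m. k i j (nd q) * (z j q - vec_index Y (j * l + q))))"
      unfolding ip(3) B_def B_mat_mult_index[OF v ip(1,2)] using ip by (simp add: vi)
    also have "\<dots> = z i p - r i - (\<Sum>q<l. \<sigma> p q * dnd q * ((\<Sum>j<m. k i j (nd q) * z j q) + g i (nd q)))"
      unfolding Y_def collocation_solution(2)[OF inv ip(1,2)]
      by (simp add: algebra_simps sum.distrib sum_subtractf sum_distrib_left)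
    finally show "cmod (vec_index (B *\<^sub>v v) a) \<le> \<epsilon>" using z[OF ip(1,2)] by simp
  qed
  have "norm (z i p - vec_index Y (i * l + p)) \<le> vec_max_norm v"
    using vec_max_norm_ge[of "i * l + p" v] block_index_less[OF i p] vi[OF i p] v by simp
  also have "v = (Bi * B) *\<^sub>v v" using Bi v by simp
  also have "\<dots> = Bi *\<^sub>v (B *\<^sub>v v)" using Bi(3) B v by (intro assoc_mult_mat_vec) auto
  also have "vec_max_norm \<dots> \<le> mat_max_norm Bi * vec_max_norm (B *\<^sub>v v)"
    using B v by (intro vec_max_norm_mult_le(1)[OF Bi(3) ml]) auto
  also have "\<dots> \<le> mat_max_norm Bi * \<epsilon>"
    using Bv vec_max_norm_mult_le(2)[OF Bi(3) ml v] by (intro mult_left_mono)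
  finally show ?thesis by (simp add: Y_def Bi_def B_def)
qed

end

section \<open>From nodal errors to the error of the approximate solution\<close>

lemma sum_window_shift:
  fixes f :: "int \<Rightarrow> 'a::comm_monoid_add"
  shows "(\<Sum>j\<in>{- int M..int N}. f j) = (\<Sum>q<M + N + 1. f (int q - int M))"
  by (rule sum.reindex_bij_witness[of _ "\<lambda>q. int q - int M" "\<lambda>j. nat (j + int M)"]) auto

lemma sinc_basis_scaled: "h > 0 \<Longrightarrow> sinc_basis k h x = sinc (pi * (x / h - real_of_int k))"
proof -
  assume "h > 0"
  hence "pi * (x - real_of_int k * h) / h = pi * (x / h - real_of_int k)" by (simp add: field_simps)
  thus ?thesis by (simp only: sinc_basis_def)
qed

lemma Si_integer_tail_bound:
  fixes n :: nat
  shows "\<bar>1 / 2 - 1 / pi * Si (pi * real n)\<bar> \<le> 1 / (1 + real n)"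
proof (cases "n = 0")
  case True
  have "Si 0 = 0" using Si_uminus[of 0] by simp
  thus ?thesis using True by simp
next
  case False
  have eq: "1 / 2 - 1 / pi * Si (pi * real n) = (pi / 2 - Si (pi * real n)) / pi" by (simp add: field_simps)
  have "\<bar>(pi / 2 - Si (pi * real n)) / pi\<bar> \<le> 2 / (pi * real n) / pi"
    using divide_right_mono[OF Si_tail_bound[of "pi * real n"], of pi] False by (simp add: abs_divide)
  also have "\<dots> = 2 / (pi * pi * real n)" by (simp add: mult_ac)
  also have "\<dots> \<le> 2 / (2 * (1 + real n))"
  proof (rule divide_left_mono)
    have "2 * 2 \<le> pi * pi" using pi_gt3 by (intro mult_mono) auto
    hence "4 * real n \<le> pi * pi * real n" by (intro mult_right_mono) auto
    moreover have "1 \<le> real n" using False by simp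
    hence "2 * (1 + real n) \<le> 4 * real n" by simp
    ultimately show "2 * (1 + real n) \<le> pi * pi * real n" by (rule order_trans[rotated])
  qed (use False in auto)
  also have "2 / (2 * (1 + real n)) = 1 / (1 + real n)" by (simp add: field_simps)
  finally show ?thesis unfolding eq .
qed

lemma norm_deriv_de_phi_of_real_le: "norm (deriv de_phi (of_real x)) \<le> pi * cosh x"
proof -
  define e where "e = exp (pi * sinh x)"
  have e: "e > 0" by (simp add: e_def)
  have s: "complex_of_real x \<in> strip (pi / 2)" by (simp add: strip_def)
  have "norm (deriv de_phi (of_real x)) = pi * norm (cosh (complex_of_real x)) * (norm (de_exp (of_real x)) / norm (1 + de_exp (of_real x)))"
    using DERIV_imp_deriv[OF has_field_derivative_de_phi[OF s]] by (simp add: norm_mult norm_divide)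
  also have "norm (1 + de_exp (of_real x)) = 1 + e"
  proof -
    have "1 + de_exp (of_real x) = complex_of_real (1 + e)" by (simp add: de_exp_of_real e_def)
    thus ?thesis using e by (simp only: norm_of_real)
  qed
  also have "norm (de_exp (of_real x)) = e" by (simp add: de_exp_of_real e_def)
  also have "pi * norm (cosh (complex_of_real x)) * (e / (1 + e)) \<le> pi * cosh x * 1"
    using norm_cosh_le[of "of_real x"] e by (intro mult_mono) auto
  finally show ?thesis by simp
qed

text \<open>
  \<open>Q\<close> is the indefinite integration error of the transformed right-hand side, and \<open>P\<close> the interpolation
  error of the transformed solution. The term with the product \<open>Dn * h * \<Lambda>\<close> comes from the coefficient \<open>p\<close>,
  which is compared with the last row of the linear system.
\<close>

lemma collocation_error_at_point:
  fixes h :: real and y g :: "nat \<Rightarrow> complex \<Rightarrow> complex"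
  defines "nd \<equiv> \<lambda>x::real. de_phi (of_real x)"
  assumes m: "m > 0" and h: "h > 0"
    and inv: "invertible_mat (B_mat m k h M N)"
    and k: "\<And>i j x. i < m \<Longrightarrow> j < m \<Longrightarrow> norm (k i j (nd x)) \<le> Kb"
    and Dn: "\<And>j. j \<in> {- int M..int N} \<Longrightarrow> norm (de_node_deriv h j) \<le> Dn"
    and \<Lambda>: "harm (M + N + 1) \<le> \<Lambda>"
    and Q: "\<And>i x. i < m \<Longrightarrow> norm (y i (nd x) - r i - (\<Sum>j\<in>{- int M..int N}.
        ((\<Sum>q<m. k i q (de_node h j) * y q (de_node h j)) + g i (de_node h j)) * de_node_deriv h j *
        of_real (h * (1 / 2 + 1 / pi * Si (pi * (x - of_int j * h) / h))))) \<le> Q"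
    and lim: "\<And>i. i < m \<Longrightarrow> ((\<lambda>x. y i (nd x)) \<longlongrightarrow> 0) at_top"
    and P: "\<And>i x. i < m \<Longrightarrow> norm ((y i (nd x) - r i / (1 + de_exp (of_real x))) - (\<Sum>j\<in>{- int M..int N}.
        (y i (de_node h j) - r i / (1 + de_exp (of_real (of_int j * h)))) * of_real (sinc_basis j h x))) \<le> P"
    and i: "i < m"
  defines "b \<equiv> mat_max_norm (the (mat_inverse (B_mat m k h M N)))"
  shows "norm (y i (nd x) - y_hat m k g r h M N i (de_phi_real x))
     \<le> P + 4 * \<Lambda> * (b * Q) + 5 * (2 * Q + b * Q + 2 * real m * Kb * Dn * h * \<Lambda> * (b * Q))"
proof -
  let ?I = "{- int M..int N}"
  define yn where "yn = (\<lambda>i j. y_node m k g r h M N i j)"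
  define z where "z = (\<lambda>i j. y i (de_node h j))"
  define \<delta> where "\<delta> = (\<lambda>i j. z i j - yn i j)"
  define w where "w = (\<lambda>j. de_node_deriv h j)"
  define \<sigma> where "\<sigma> = (\<lambda>p j. complex_of_real (h * (1 / 2 + 1 / pi * Si (pi * (of_int p - of_int j)))))"
  have nodes: "de_node h j = nd (of_int j * h)" for j by (simp add: de_node_def nd_def)
  have b0: "b \<ge> 0"
    unfolding b_def
    using mat_inverse_of_invertible(3)[OF B_mat_carrier[OF m] inv] m
    by (intro vec_max_norm_mult_le(2)[of _ "m * (M + N + 1)" "0\<^sub>v (m * (M + N + 1))"]) auto
  have "norm (y i (nd 0) - r i - (\<Sum>j\<in>?I. ((\<Sum>q<m. k i q (de_node h j) * y q (de_node h j)) + g i (de_node h j)) * de_node_deriv h j *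
        of_real (h * (1 / 2 + 1 / pi * Si (pi * (0 - of_int j * h) / h))))) \<le> Q" by (rule Q[OF i])
  from order_trans[OF norm_ge_zero this] have Q0: "Q \<ge> 0" .
  from order_trans[OF norm_ge_zero k[OF i i, of 0]] have K0: "Kb \<ge> 0" .
  have "0 \<in> ?I" by simp
  from order_trans[OF norm_ge_zero Dn[OF this]] have D0: "Dn \<ge> 0" .
  have "0 \<le> (harm (M + N + 1) :: real)" by (rule harm_nonneg)
  hence \<Lambda>0: "\<Lambda> \<ge> 0" using \<Lambda> by linarith
  \<comment> \<open>The exact nodal values nearly solve the system: the residual is the integration error at the nodes.\<close>
  have res: "norm (z i p - r i - (\<Sum>j\<in>?I. \<sigma> p j * w j * ((\<Sum>q<m. k i q (de_node h j) * z q j) + g i (de_node h j)))) \<le> Q"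
    if "i < m" for i p
  proof -
    have "pi * (of_int p * h - of_int j * h) / h = pi * (of_int p - of_int j)" for j using h by (simp add: field_simps)
    thus ?thesis using Q[OF that, of "of_int p * h"] unfolding nodes[symmetric] z_def \<sigma>_def w_def by (simp only: mult_ac)
  qed
  have yn_eq: "yn i p = r i + (\<Sum>j\<in>?I. \<sigma> p j * w j * ((\<Sum>q<m. k i q (de_node h j) * yn q j) + g i (de_node h j)))"
    if "i < m" "p \<in> ?I" for i p
  proof -
    have p: "nat (p + int M) < M + N + 1" "real (nat (p + int M)) = of_int p + real M" using that(2) by auto
    show ?thesis unfolding sum_window_shift yn_def y_node_def \<sigma>_def w_def
      using collocation_solution(2)[OF m inv that(1) p(1), of g r] p(2)
      by (simp add: add_diff_eq diff_diff_eq2)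
  qed
  have \<delta>: "norm (\<delta> i p) \<le> b * Q" if "i < m" "p \<in> ?I" for i p
  proof -
    have p: "nat (p + int M) < M + N + 1" using that(2) by auto
    have "norm (z i (int (nat (p + int M)) - int M) - vec_index (Y_vec m k g r h M N) (i * (M + N + 1) + nat (p + int M))) \<le> b * Q"
      unfolding b_def
    proof (rule collocation_stability[OF m inv _ that(1) p])
      fix i' p' assume ip: "i' < m" "p' < M + N + 1"
      show "norm (z i' (int p' - int M) - r i' - (\<Sum>q<M + N + 1. complex_of_real (h * (1 / 2 + 1 / pi * Si (pi * (real p' - real q)))) *
         de_node_deriv h (int q - int M) * ((\<Sum>j<m. k i' j (de_node h (int q - int M)) * z j (int q - int M)) + g i' (de_node h (int q - int M))))) \<le> Q"
        using res[OF ip(1), of "int p' - int M"] unfolding sum_window_shift \<sigma>_def w_def by simp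
    qed
    thus ?thesis using that(2) by (simp add: \<delta>_def yn_def y_node_def)
  qed
  define \<kappa> where "\<kappa> = (\<lambda>j. \<Sum>q<m. k i q (de_node h j) * \<delta> q j)"
  have \<kappa>: "norm (\<kappa> j) \<le> real m * (Kb * (b * Q))" if "j \<in> ?I" for j
  proof -
    have "norm (\<kappa> j) \<le> (\<Sum>q<m. Kb * (b * Q))"
      unfolding \<kappa>_def
    proof (rule order_trans[OF norm_sum sum_mono])
      fix q assume "q \<in> {..<m}"
      thus "norm (k i q (de_node h j) * \<delta> q j) \<le> Kb * (b * Q)"
        unfolding norm_mult nodes using k[OF i, of q "of_int j * h"] \<delta>[of q j] that K0 by (intro mult_mono) auto
    qed
    thus ?thesis by simp
  qed
  \<comment> \<open>\<open>p\<close> is the quadrature approximation of \<open>r i + \<integral> F = 0\<close>, minus the contribution \<open>V\<close> of the nodal errors.\<close>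
  define p where "p = p_coeff m k g r h M N i"
  define V where "V = (\<Sum>j\<in>?I. of_real h * w j * \<kappa> j)"
  define F where "F = (\<lambda>j. ((\<Sum>q<m. k i q (de_node h j) * z q j) + g i (de_node h j)) * w j)"
  have p_split: "p = r i + of_real h * (\<Sum>j\<in>?I. F j) - V"
    unfolding p_def p_coeff_def V_def F_def \<kappa>_def \<delta>_def yn_def[symmetric] w_def
    by (simp add: algebra_simps sum_subtractf sum.distrib sum_distrib_left)
  \<comment> \<open>The limit \<open>x \<longrightarrow> \<infinity>\<close> turns indefinite integration into quadrature, as every \<open>Si\<close> tends to \<open>\<pi>/2\<close>.\<close>
  have quad: "norm (- r i - of_real h * (\<Sum>j\<in>?I. F j)) \<le> Q"
  proof (rule tendsto_upperbound)
    have Sl: "((\<lambda>x. Si (pi * (x - c) / h)) \<longlongrightarrow> pi / 2) at_top" for c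
    proof (rule filterlim_compose[OF Si_at_top])
      show "filterlim (\<lambda>x. pi * (x - c) / h) at_top at_top" using h by real_asymp
    qed
    have "((\<lambda>x. norm (y i (nd x) - r i - (\<Sum>j\<in>?I. F j * of_real (h * (1 / 2 + 1 / pi * Si (pi * (x - of_int j * h) / h))))))
       \<longlongrightarrow> norm (0 - r i - (\<Sum>j\<in>?I. F j * of_real (h * (1 / 2 + 1 / pi * (pi / 2)))))) at_top"
      by (intro tendsto_intros lim i Sl)
    thus "((\<lambda>x. norm (y i (nd x) - r i - (\<Sum>j\<in>?I. F j * of_real (h * (1 / 2 + 1 / pi * Si (pi * (x - of_int j * h) / h))))))
       \<longlongrightarrow> norm (- r i - of_real h * (\<Sum>j\<in>?I. F j))) at_top"
      by (simp add: sum_distrib_left mult.commute)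
    show "\<forall>\<^sub>F x in at_top. norm (y i (nd x) - r i - (\<Sum>j\<in>?I. F j * of_real (h * (1 / 2 + 1 / pi * Si (pi * (x - of_int j * h) / h))))) \<le> Q"
      unfolding F_def z_def w_def using Q[OF i] by (intro always_eventually allI)
  qed simp
  \<comment> \<open>The last row has the same sum as \<open>V\<close>, except that its weights are \<open>\<sigma> (int N) j\<close> instead of \<open>h\<close>.\<close>
  have row: "(\<Sum>j\<in>?I. \<sigma> (int N) j * w j * \<kappa> j) = \<delta> i (int N) -
     (z i (int N) - r i - (\<Sum>j\<in>?I. \<sigma> (int N) j * w j * ((\<Sum>q<m. k i q (de_node h j) * z q j) + g i (de_node h j))))"
  proof -
    have "\<delta> i (int N) = z i (int N) - (r i + (\<Sum>j\<in>?I. \<sigma> (int N) j * w j * ((\<Sum>q<m. k i q (de_node h j) * yn q j) + g i (de_node h j))))"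
      unfolding \<delta>_def using yn_eq[OF i, of "int N"] by simp
    moreover have "(\<Sum>j\<in>?I. \<sigma> (int N) j * w j * \<kappa> j) =
       (\<Sum>j\<in>?I. \<sigma> (int N) j * w j * ((\<Sum>q<m. k i q (de_node h j) * z q j) + g i (de_node h j))) -
       (\<Sum>j\<in>?I. \<sigma> (int N) j * w j * ((\<Sum>q<m. k i q (de_node h j) * yn q j) + g i (de_node h j)))"
      unfolding \<kappa>_def \<delta>_def by (simp add: algebra_simps sum_subtractf sum.distrib sum_distrib_left)
    ultimately show ?thesis by simp
  qed
  \<comment> \<open>\<open>\<tau>\<close> is the defect of the weights; it decays like \<open>h / (1 + N - j)\<close>.\<close>
  define \<tau> where "\<tau> = (\<lambda>j. h * (1 / 2 - 1 / pi * Si (pi * (real N - of_int j))))"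
  have V_split: "V = (\<Sum>j\<in>?I. \<sigma> (int N) j * w j * \<kappa> j) + (\<Sum>j\<in>?I. of_real (\<tau> j) * w j * \<kappa> j)"
  proof -
    have h_eq: "of_real h = \<sigma> (int N) j + of_real (\<tau> j)" for j
      unfolding \<sigma>_def \<tau>_def of_real_add[symmetric] by (rule arg_cong[of _ _ of_real]) (simp add: algebra_simps)
    have "of_real h * w j * \<kappa> j = \<sigma> (int N) j * w j * \<kappa> j + of_real (\<tau> j) * w j * \<kappa> j" for j
      unfolding distrib_right[symmetric] h_eq[of j, symmetric] ..
    thus ?thesis unfolding V_def by (simp only: sum.distrib)
  qed
  have tail: "norm (\<Sum>j\<in>?I. of_real (\<tau> j) * w j * \<kappa> j) \<le> 2 * real m * Kb * Dn * h * \<Lambda> * (b * Q)"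
  proof -
    have "norm (\<Sum>j\<in>?I. of_real (\<tau> j) * w j * \<kappa> j) \<le> (\<Sum>j\<in>?I. (1 / (1 + \<bar>real_of_int (j - int N)\<bar>)) * (h * Dn * (real m * (Kb * (b * Q)))))"
    proof (rule order_trans[OF norm_sum sum_mono])
      fix j assume j: "j \<in> ?I"
      have Nj: "real N - of_int j = real (nat (int N - j))" "\<bar>real_of_int (j - int N)\<bar> = real (nat (int N - j))" using j by auto
      have "norm (complex_of_real (\<tau> j)) = h * \<bar>1 / 2 - 1 / pi * Si (pi * (real N - of_int j))\<bar>"
        unfolding \<tau>_def norm_of_real abs_mult using h by simp
      also have "\<dots> \<le> h * (1 / (1 + \<bar>real_of_int (j - int N)\<bar>))"
        unfolding Nj using h by (intro mult_left_mono Si_integer_tail_bound) auto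
      finally have "norm (complex_of_real (\<tau> j)) \<le> h * (1 / (1 + \<bar>real_of_int (j - int N)\<bar>))" .
      hence "norm (of_real (\<tau> j) * w j * \<kappa> j) \<le> h * (1 / (1 + \<bar>real_of_int (j - int N)\<bar>)) * Dn * (real m * (Kb * (b * Q)))"
        unfolding norm_mult using Dn[OF j] \<kappa>[OF j] h D0 by (intro mult_mono) (auto simp: w_def)
      thus "norm (of_real (\<tau> j) * w j * \<kappa> j) \<le> (1 / (1 + \<bar>real_of_int (j - int N)\<bar>)) * (h * Dn * (real m * (Kb * (b * Q))))"
        by (simp only: mult_ac)
    qed
    also have "\<dots> = (\<Sum>j\<in>?I. 1 / (1 + \<bar>real_of_int (j - int N)\<bar>)) * (h * Dn * (real m * (Kb * (b * Q))))"
      by (rule sum_distrib_right[symmetric])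
    also have "\<dots> \<le> (2 * harm (M + N + 1)) * (h * Dn * (real m * (Kb * (b * Q))))"
      using h D0 K0 b0 Q0 by (intro mult_right_mono sum_inverse_distance mult_nonneg_nonneg) auto
    also have "\<dots> \<le> (2 * \<Lambda>) * (h * Dn * (real m * (Kb * (b * Q))))"
      using \<Lambda> h D0 K0 b0 Q0 by (intro mult_right_mono mult_nonneg_nonneg) auto
    finally show ?thesis by (simp only: mult_ac)
  qed
  have V: "norm V \<le> Q + b * Q + 2 * real m * Kb * Dn * h * \<Lambda> * (b * Q)"
  proof -
    have "norm (\<Sum>j\<in>?I. \<sigma> (int N) j * w j * \<kappa> j) \<le> b * Q + Q"
      unfolding row
      by (rule order_trans[OF norm_triangle_ineq4 add_mono[OF \<delta>[OF i] res[OF i]]]) simp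
    thus ?thesis unfolding V_split using tail
      by (intro order_trans[OF norm_triangle_ineq]) linarith
  qed
  have p_bound: "norm p \<le> 2 * Q + b * Q + 2 * real m * Kb * Dn * h * \<Lambda> * (b * Q)"
  proof -
    have "p = - (- r i - of_real h * (\<Sum>j\<in>?I. F j)) - V" unfolding p_split by simp
    hence "norm p \<le> norm (- r i - of_real h * (\<Sum>j\<in>?I. F j)) + norm V" by (metis norm_minus_cancel norm_triangle_ineq4)
    thus ?thesis using quad V by linarith
  qed
  \<comment> \<open>The point \<open>x\<close> is inserted; \<open>W\<close> is the increasing function that multiplies \<open>p\<close>.\<close>
  define E where "E = (\<lambda>x. exp (pi * sinh x))"
  have E: "E x > 0" for x by (simp add: E_def)
  have E1: "1 + complex_of_real (E x) \<noteq> 0" for x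
  proof -
    have "complex_of_real (1 + E x) \<noteq> 0" using E[of x] by (simp only: of_real_eq_0_iff)
    thus ?thesis by simp
  qed
  have expt: "exp (de_phi_real x) = 1 + E x" using E[of x] by (simp add: de_phi_real_eq E_def add_pos_pos)
  have invx: "de_phi_inv (de_phi_real x) = x"
    unfolding de_phi_inv_def using bij_betw_de_phi_real by (intro the_inv_into_f_f) (auto simp: bij_betw_def)
  define S where "S = (\<lambda>j. complex_of_real (sinc_basis j h x))"
  define W where "W = (\<lambda>x. E x / (1 + E x))"
  have hat: "y_hat m k g r h M N i (de_phi_real x) = (r i + p * of_real (E x)) / (1 + of_real (E x)) +
     (\<Sum>j\<in>?I. (yn i j - (r i + p * of_real (E (of_int j * h))) / (1 + of_real (E (of_int j * h)))) * S j)"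
    unfolding y_hat_def invx expt p_def[symmetric] yn_def S_def E_def by simp
  have frac: "(r i + p * of_real (E u)) / (1 + of_real (E u)) = r i / (1 + of_real (E u)) + p * of_real (W u)" for u
    by (simp add: W_def add_divide_distrib)
  have "y i (nd x) - y_hat m k g r h M N i (de_phi_real x) =
     ((y i (nd x) - r i / (1 + of_real (E x))) - (\<Sum>j\<in>?I. (z i j - r i / (1 + of_real (E (of_int j * h)))) * S j))
     + (\<Sum>j\<in>?I. \<delta> i j * S j) - p * (of_real (W x) - (\<Sum>j\<in>?I. of_real (W (of_int j * h)) * S j))"
    unfolding hat frac \<delta>_def by (simp add: algebra_simps sum_subtractf sum.distrib sum_distrib_left)
  also have "norm \<dots> \<le> P + 4 * \<Lambda> * (b * Q) + (2 * Q + b * Q + 2 * real m * Kb * Dn * h * \<Lambda> * (b * Q)) * 5"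
  proof (rule order_trans[OF norm_triangle_ineq4 add_mono[OF order_trans[OF norm_triangle_ineq add_mono]]])
    have "1 + de_exp (of_real u) = 1 + of_real (E u)" for u by (simp add: de_exp_of_real E_def)
    thus "norm ((y i (nd x) - r i / (1 + of_real (E x))) - (\<Sum>j\<in>?I. (z i j - r i / (1 + of_real (E (of_int j * h)))) * S j)) \<le> P"
      using P[OF i, of x] by (simp only: z_def S_def)
    have "norm (\<Sum>j\<in>?I. \<delta> i j * S j) \<le> (\<Sum>j\<in>?I. (b * Q) * \<bar>sinc (pi * (x / h - real_of_int j))\<bar>)"
    proof (rule order_trans[OF norm_sum sum_mono])
      fix j assume "j \<in> ?I"
      thus "norm (\<delta> i j * S j) \<le> (b * Q) * \<bar>sinc (pi * (x / h - real_of_int j))\<bar>"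
        unfolding norm_mult S_def norm_of_real sinc_basis_scaled[OF h] using \<delta>[OF i] by (intro mult_right_mono) auto
    qed
    also have "\<dots> \<le> (b * Q) * (4 * \<Lambda>)"
    proof -
      have "(\<Sum>j\<in>?I. \<bar>sinc (pi * (x / h - real_of_int j))\<bar>) \<le> 4 * harm (M + N + 1)"
        by (rule sum_abs_sinc_le) auto
      thus ?thesis unfolding sum_distrib_left[symmetric] using \<Lambda> b0 Q0 by (intro mult_left_mono) auto
    qed
    finally show "norm (\<Sum>j\<in>?I. \<delta> i j * S j) \<le> 4 * \<Lambda> * (b * Q)" by (simp only: mult_ac)
    have "norm (of_real (W x) - (\<Sum>j\<in>?I. of_real (W (of_int j * h)) * S j)) \<le> 5"
    proof -
      have W01: "0 \<le> W u" "W u \<le> 1" for u using E[of u] by (auto simp: W_def)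
      have Wm: "W u \<le> W v" if "u \<le> v" for u v
      proof -
        have "pi * sinh u \<le> pi * sinh v" using that by simp
        hence "E u \<le> E v" by (simp add: E_def)
        thus ?thesis using E[of u] E[of v] by (simp add: W_def field_simps)
      qed
      have "\<bar>\<Sum>j\<in>?I. W (of_int j * h) * sinc (pi * (x / h - real_of_int j))\<bar> \<le> 4"
        using h by (intro abs_sum_mono_sinc_le W01 Wm) simp
      moreover have "of_real (W x) - (\<Sum>j\<in>?I. of_real (W (of_int j * h)) * S j) =
          complex_of_real (W x - (\<Sum>j\<in>?I. W (of_int j * h) * sinc (pi * (x / h - real_of_int j))))"
        unfolding S_def sinc_basis_scaled[OF h] by simp
      ultimately show ?thesis using W01[of x] by (simp only: norm_of_real)
    qed
    thus "norm (p * (of_real (W x) - (\<Sum>j\<in>?I. of_real (W (of_int j * h)) * S j))) \<le>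
      (2 * Q + b * Q + 2 * real m * Kb * Dn * h * \<Lambda> * (b * Q)) * 5"
      unfolding norm_mult using p_bound order_trans[OF norm_ge_zero p_bound] by (intro mult_mono) auto
  qed
  finally show ?thesis by (simp only: mult_ac)
qed

section \<open>The initial value problem in the transformed variable\<close>

lemma uniform_constant:
  fixes Pr :: "nat \<Rightarrow> real \<Rightarrow> bool"
  assumes ex: "\<And>i. i < m \<Longrightarrow> \<exists>C>0. Pr i C" and mono: "\<And>i C C'. Pr i C \<Longrightarrow> C \<le> C' \<Longrightarrow> Pr i C'"
  shows "\<exists>C>0. \<forall>i<m. Pr i C"
proof -
  obtain c where c: "\<And>i. i < m \<Longrightarrow> c i > 0 \<and> Pr i (c i)" using ex by metis
  show ?thesis
  proof (intro exI[of _ "1 + (\<Sum>i<m. c i)"] conjI allI impI)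
    have "(\<Sum>i<m. c i) \<ge> 0" using c by (intro sum_nonneg) (auto intro: less_imp_le)
    thus "1 + (\<Sum>i<m. c i) > 0" by simp
    fix i assume i: "i < m"
    have "c i \<le> (\<Sum>i<m. c i)" using i c by (intro member_le_sum) (auto intro: less_imp_le)
    thus "Pr i (1 + (\<Sum>i<m. c i))" using mono[of i "c i"] c[OF i] by auto
  qed
qed

lemma holomorphic_comp_de_phi:
  assumes "f analytic_on de_phi ` strip d" "d \<le> pi / 2"
  shows "(\<lambda>\<zeta>. f (de_phi \<zeta>)) holomorphic_on strip d"
proof -
  have "de_phi holomorphic_on strip d"
    using holomorphic_de_phi strip_mono[OF assms(2)] by (rule holomorphic_on_subset)
  hence "de_phi analytic_on strip d" by (simp add: analytic_on_open open_strip)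
  from analytic_on_compose[OF this assms(1)] show ?thesis
    by (simp add: analytic_on_open open_strip o_def)
qed

lemma de_phi_real_pos: "de_phi_real x > 0"
  by (auto simp: de_phi_real_eq intro!: ln_gt_zero)

lemma of_real_de_phi_real: "complex_of_real (de_phi_real x) = de_phi (of_real x)"
  by (simp only: de_phi_of_real de_phi_real_eq)

lemma deriv_de_phi_real:
  obtains D where "(de_phi_real has_real_derivative D) (at x)" "deriv de_phi (of_real x) = of_real D"
proof -
  let ?e = "exp (pi * sinh x)"
  have pos: "1 + ?e > 0" by (simp add: add_pos_pos)
  have D: "(de_phi_real has_real_derivative ?e * (pi * cosh x) / (1 + ?e)) (at x)" (is "(_ has_real_derivative ?D) _")
    unfolding de_phi_real_eq[abs_def] using pos by (auto intro!: derivative_eq_intros)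
  have "((\<lambda>x. complex_of_real (de_phi_real x)) has_vector_derivative of_real ?D) (at x)"
    using D by (rule has_vector_derivative_of_real)
  hence 1: "((\<lambda>x. de_phi (of_real x)) has_vector_derivative of_real ?D) (at x)"
    by (simp only: of_real_de_phi_real)
  have s: "complex_of_real x \<in> strip (pi / 2)" by (simp add: strip_def)
  have "(de_phi has_field_derivative deriv de_phi (of_real x)) (at (of_real x))"
    using holomorphic_derivI[OF holomorphic_de_phi open_strip s] .
  moreover have "(complex_of_real has_vector_derivative 1) (at x)"
    using has_vector_derivative_of_real[OF DERIV_ident] by simp
  ultimately have "((\<lambda>x. de_phi (of_real x)) has_vector_derivative deriv de_phi (of_real x)) (at x)"
    using field_vector_diff_chain_at[of of_real 1 x de_phi] by (simp add: o_def)
  from vector_derivative_unique_at[OF this 1] D show ?thesis using that by blast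
qed

lemma solves_ivp_transformed:
  assumes "solves_ivp m k g r y" "i < m"
  shows "((\<lambda>x. y i (de_phi (of_real x))) has_vector_derivative
     ((\<Sum>j<m. k i j (de_phi (of_real x)) * y j (de_phi (of_real x))) + g i (de_phi (of_real x))) * deriv de_phi (of_real x)) (at x)"
proof -
  obtain D where D: "(de_phi_real has_real_derivative D) (at x)" "deriv de_phi (of_real x) = of_real D"
    by (rule deriv_de_phi_real)
  define t where "t = de_phi_real x"
  have t: "t > 0" by (simp add: t_def de_phi_real_pos)
  have "((\<lambda>s. y i (of_real s)) has_vector_derivative (\<Sum>j<m. k i j (of_real t) * y j (of_real t)) + g i (of_real t)) (at t within {0..})"
    using assms t by (auto simp: solves_ivp_def)
  moreover have "at t within {0..} = at t" using t by (intro at_within_interior) auto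
  ultimately have "((\<lambda>s. y i (of_real s)) has_vector_derivative (\<Sum>j<m. k i j (of_real t) * y j (of_real t)) + g i (of_real t)) (at (de_phi_real x))"
    by (simp add: t_def)
  from vector_diff_chain_at[OF D(1)[unfolded has_real_derivative_iff_has_vector_derivative] this]
  show ?thesis unfolding t_def of_real_de_phi_real D(2)
    by (simp add: o_def of_real_de_phi_real scaleR_conv_of_real mult.commute)
qed

text \<open>
  Both limits of the solution follow from the decay of \<open>f \<circ> \<phi> - r / (1 + e)\<close>.
\<close>

lemma interpolant_limits:
  fixes f :: "complex \<Rightarrow> complex"
  assumes \<gamma>: "\<gamma> > 0" and A: "A \<ge> 0"
    and bound: "\<And>x::real. norm (f (de_phi (of_real x)) - r / (1 + de_exp (of_real x))) \<le> A * exp (- (2 * \<gamma> * \<bar>sinh x\<bar>))"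
  shows "((\<lambda>x. f (de_phi (of_real x))) \<longlongrightarrow> 0) at_top" and "((\<lambda>x. f (de_phi (of_real x))) \<longlongrightarrow> r) at_bot"
proof -
  define s where "s = (\<lambda>x. 1 / (1 + exp (pi * sinh x)))"
  have fr: "r / (1 + de_exp (of_real x)) = r * of_real (s x)" for x
    by (simp add: s_def de_exp_of_real)
  have lim0: "((\<lambda>x. f (de_phi (of_real x)) - r / (1 + de_exp (of_real x))) \<longlongrightarrow> 0) F"
    if F: "((\<lambda>x::real. A * ((1 + 1 / \<gamma>\<^sup>2) / (1 + x\<^sup>2))) \<longlongrightarrow> 0) F" for F
  proof (rule Lim_null_comparison[OF always_eventually F], rule allI)
    fix x :: real
    have "A * exp (- (2 * \<gamma> * \<bar>sinh x\<bar>)) \<le> A * ((1 + 1 / \<gamma>\<^sup>2) / (1 + x\<^sup>2))"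
      using A double_exp_le_rational[OF \<gamma>] by (intro mult_left_mono)
    with bound[of x] show "norm (f (de_phi (of_real x)) - r / (1 + de_exp (of_real x))) \<le> A * ((1 + 1 / \<gamma>\<^sup>2) / (1 + x\<^sup>2))"
      by linarith
  qed
  have comb: "((\<lambda>x. f (de_phi (of_real x))) \<longlongrightarrow> r * of_real c) F"
    if F: "((\<lambda>x::real. A * ((1 + 1 / \<gamma>\<^sup>2) / (1 + x\<^sup>2))) \<longlongrightarrow> 0) F" and s: "(s \<longlongrightarrow> c) F" for F c
  proof -
    have "((\<lambda>x. (f (de_phi (of_real x)) - r / (1 + de_exp (of_real x))) + r * of_real (s x)) \<longlongrightarrow> 0 + r * of_real c) F"
      by (intro tendsto_intros lim0[OF F] s)
    thus ?thesis by (simp add: fr)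
  qed
  have "((\<lambda>x::real. A * ((1 + 1 / \<gamma>\<^sup>2) / (1 + x\<^sup>2))) \<longlongrightarrow> 0) at_top" by real_asymp
  moreover have "(s \<longlongrightarrow> 0) at_top"
  proof -
    have "((\<lambda>u::real. 1 / (1 + exp (pi * u))) \<longlongrightarrow> 0) at_top" by real_asymp
    from filterlim_compose[OF this sinh_real_at_top] show ?thesis by (simp add: s_def)
  qed
  ultimately show "((\<lambda>x. f (de_phi (of_real x))) \<longlongrightarrow> 0) at_top" using comb[of at_top 0] by simp
  have "((\<lambda>x::real. A * ((1 + 1 / \<gamma>\<^sup>2) / (1 + x\<^sup>2))) \<longlongrightarrow> 0) at_bot" by real_asymp
  moreover have "(s \<longlongrightarrow> 1) at_bot"
  proof -
    have "((\<lambda>u::real. 1 / (1 + exp (pi * u))) \<longlongrightarrow> 1) at_bot" by real_asymp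
    from filterlim_compose[OF this sinh_real_at_bot] show ?thesis by (simp add: s_def)
  qed
  ultimately show "((\<lambda>x. f (de_phi (of_real x))) \<longlongrightarrow> r) at_bot" using comb[of at_bot 1] by simp
qed

text \<open>
  Both Sinc errors are bounded by multiples of one expression \<open>R\<close>: a discretisation part with the full
  half-width \<open>d\<close> and a truncation part.
\<close>

lemma sinc_errors_double_exp:
  fixes F :: "complex \<Rightarrow> complex" and h x B :: real and G :: "real \<Rightarrow> complex"
  assumes F: "F holomorphic_on strip d" and d: "d > 0" and h: "h > 0" and \<gamma>: "\<gamma> > 0" and A: "A > 0"
    and decay: "\<And>z. z \<in> strip d \<Longrightarrow> norm (F z) \<le> A * exp (- (2 * \<gamma> * \<bar>sinh (Re z)\<bar>))"
    and S: "S \<le> sinh (real M * h)" "S \<le> sinh (real N * h)"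
    and A': "A' = A * (1 + 1 / \<gamma>\<^sup>2) + 2 * A"
  defines "R \<equiv> A' / (d * sinh (pi * d / h)) + A' * exp (- (\<gamma> * S)) * (1 + 1 / (\<gamma> * h))"
  shows "norm (F (of_real x) - (\<Sum>k\<in>{- int M..int N}. F (of_real (k * h)) * of_real (sinc_basis k h x))) \<le> R"
    and "\<lbrakk>\<And>s. (G has_vector_derivative F (of_real s)) (at s); (G \<longlongrightarrow> G0) at_bot; \<And>u. \<bar>Si u\<bar> \<le> B\<rbrakk> \<Longrightarrow>
      norm (G x - G0 - (\<Sum>k\<in>{- int M..int N}. F (of_real (k * h)) * of_real (h * (1 / 2 + 1 / pi * Si (pi * (x - k * h) / h)))))
      \<le> (2 + B) * h * R"
proof -
  define A1 where "A1 = A * (1 + 1 / \<gamma>\<^sup>2)"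
  define T where "T = 2 * A * exp (- (\<gamma> * S)) * (1 + 1 / (\<gamma> * h))"
  have A1: "A1 > 0" using A \<gamma> by (simp add: A1_def add_pos_pos)
  have sh: "sinh (pi * d / h) > 0" using d h by simp
  have rat: "norm (F z) \<le> A1 / (1 + (Re z)\<^sup>2)" if "z \<in> strip d" for z
  proof -
    have "A * exp (- (2 * \<gamma> * \<bar>sinh (Re z)\<bar>)) \<le> A * ((1 + 1 / \<gamma>\<^sup>2) / (1 + (Re z)\<^sup>2))"
      using A double_exp_le_rational[OF \<gamma>] by (intro mult_left_mono) auto
    with decay[OF that] show ?thesis by (simp add: A1_def)
  qed
  have tail: "(\<Sum>k\<in>J. norm (F (of_real (of_int k * h)))) \<le> T"
    if "finite J" "J \<inter> {- int M..int N} = {}" for J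
    unfolding T_def
  proof (rule sum_double_exp_tail_le[OF h \<gamma> _ _ S that, where f="\<lambda>x. norm (F (of_real x))"])
    show "norm (F (of_real x)) \<le> A * exp (- (2 * \<gamma> * \<bar>sinh x\<bar>))" for x
      using decay[of "of_real x"] d by (simp add: strip_def)
  qed (use A in auto)
  have 1: "A1 / (d * sinh (pi * d / h)) \<le> A' / (d * sinh (pi * d / h))"
    using A sh d unfolding A' A1_def by (intro divide_right_mono) auto
  have 2: "T \<le> A' * exp (- (\<gamma> * S)) * (1 + 1 / (\<gamma> * h))"
    unfolding T_def using A A1 \<gamma> h unfolding A' A1_def[symmetric] by (intro mult_right_mono) auto
  show "norm (F (of_real x) - (\<Sum>k\<in>{- int M..int N}. F (of_real (k * h)) * of_real (sinc_basis k h x))) \<le> R"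
  proof -
    have "norm (F (of_real x) - (\<Sum>k\<in>{- int M..int N}. F (of_real (k * h)) * of_real (sinc_basis k h x)))
       \<le> A1 / (d * sinh (pi * d / h)) + T"
      by (rule sinc_interpolation_truncated[OF F d h rat tail])
    thus ?thesis using 1 2 unfolding R_def by linarith
  qed
  show "norm (G x - G0 - (\<Sum>k\<in>{- int M..int N}. F (of_real (k * h)) * of_real (h * (1 / 2 + 1 / pi * Si (pi * (x - k * h) / h)))))
      \<le> (2 + B) * h * R"
    if G: "\<And>s. (G has_vector_derivative F (of_real s)) (at s)" "(G \<longlongrightarrow> G0) at_bot" and B: "\<And>u. \<bar>Si u\<bar> \<le> B"
  proof -
    have B0: "B \<ge> 0" using B[of 0] by simp
    define X where "X = A' / (d * sinh (pi * d / h))"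
    define Y where "Y = A' * exp (- (\<gamma> * S)) * (1 + 1 / (\<gamma> * h))"
    have XY: "0 \<le> X" "0 \<le> Y" "R = X + Y"
      using A1 A d sh \<gamma> h unfolding X_def Y_def A' A1_def[symmetric] R_def by auto
    have "norm (G x - G0 - (\<Sum>k\<in>{- int M..int N}. F (of_real (k * h)) * of_real (h * (1 / 2 + 1 / pi * Si (pi * (x - k * h) / h)))))
      \<le> 2 * A1 * h / (d * sinh (pi * d / h)) + B * h * T"
      by (rule sinc_integration_truncated[OF F d h rat tail G B])
    also have "2 * A1 * h / (d * sinh (pi * d / h)) = 2 * h * (A1 / (d * sinh (pi * d / h)))" by simp
    also have "\<dots> \<le> 2 * h * X" using 1 h unfolding X_def by (intro mult_left_mono) auto
    also have "B * h * T \<le> B * h * Y" using 2 h B0 unfolding Y_def by (intro mult_left_mono) auto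
    also have "2 * h * X + B * h * Y \<le> (2 + B) * h * R"
    proof -
      have "(2 + B) * h * R = (2 * h * X + B * h * Y) + (B * h * X + 2 * h * Y)" unfolding XY(3) by (simp add: algebra_simps)
      moreover have "0 \<le> B * h * X + 2 * h * Y" using XY B0 h by simp
      ultimately show ?thesis by linarith
    qed
    finally show ?thesis by simp
  qed
qed

lemma de_node_deriv_bound:
  assumes pos: "0 < \<alpha>" "0 < \<beta>" "0 < d" and n: "n \<ge> 1" and \<mu>: "\<mu> = min \<alpha> \<beta>"
    and j: "j \<in> {- int (de_M \<alpha> \<beta> d n)..int (de_N \<alpha> \<beta> d n)}"
  shows "norm (de_node_deriv (de_h d \<mu> n) j) \<le> pi * ((2 * d / \<mu> + 1) * exp (d / \<mu>)) * real n"
proof -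
  define h where "h = de_h d \<mu> n"
  have h: "h > 0" using de_h_pos[OF pos n] by (simp add: h_def \<mu>)
  have "\<bar>j\<bar> \<le> int (n + 1)" using j de_M_le[OF pos n] de_N_le[OF pos n] by auto
  hence "\<bar>real_of_int j\<bar> \<le> real (n + 1)" by linarith
  hence jh: "\<bar>of_int j * h\<bar> \<le> real (n + 1) * h" using h by (simp add: abs_mult)
  have "cosh (of_int j * h) = cosh \<bar>of_int j * h\<bar>" by (simp add: cosh_real_abs)
  also have "\<dots> \<le> exp \<bar>of_int j * h\<bar>"
  proof -
    have "exp (- \<bar>of_int j * h\<bar>) \<le> exp \<bar>of_int j * h\<bar>" by simp
    thus ?thesis by (simp add: cosh_field_def)
  qed
  also have "\<dots> \<le> exp (real (n + 1) * h)" using jh by simp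
  also have "\<dots> \<le> (2 * d / \<mu> + 1) * exp (d / \<mu>) * real n"
    using exp_truncation_point_le[OF pos n] by (simp only: h_def \<mu>)
  finally have c: "cosh (of_int j * h) \<le> (2 * d / \<mu> + 1) * exp (d / \<mu>) * real n" .
  have "norm (de_node_deriv h j) \<le> pi * cosh (of_int j * h)"
    unfolding de_node_deriv_def by (rule norm_deriv_de_phi_of_real_le)
  also have "\<dots> \<le> pi * ((2 * d / \<mu> + 1) * exp (d / \<mu>) * real n)" using c by (intro mult_left_mono) auto
  finally show ?thesis by (simp only: h_def mult.assoc)
qed

text \<open>
  \<open>X * L\<close> is bounded below by \<open>a * ln 2\<close>, so the terms that carry neither or only one of the two factors can be
  given both at the cost of a constant.
\<close>

lemma combine_error_terms:
  fixes P Q b \<Lambda> Dn h Kb c1 c2 C\<^sub>P C\<^sub>Q X L R a :: real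
  assumes P: "P \<le> C\<^sub>P * R" and Q: "0 \<le> Q" "Q \<le> C\<^sub>Q * R" and b: "0 \<le> b" and K: "0 \<le> Kb"
    and c: "0 \<le> c1" "0 \<le> c2" "0 \<le> C\<^sub>P" "0 \<le> C\<^sub>Q" and R: "0 \<le> R"
    and \<Lambda>: "\<Lambda> = c1 * L" and Dh: "Dn * h = c2 * X" and X: "0 < a" "a \<le> X" and L: "ln 2 \<le> L"
  shows "P + 4 * \<Lambda> * (b * Q) + 5 * (2 * Q + b * Q + 2 * real m * Kb * Dn * h * \<Lambda> * (b * Q)) \<le>
    ((C\<^sub>P + 10 * C\<^sub>Q) / (a * ln 2) + (4 * c1 * C\<^sub>Q / a + 5 * C\<^sub>Q / (a * ln 2) + 10 * real m * Kb * c2 * c1 * C\<^sub>Q) * b) * X * L * R"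
proof -
  have l2: "(0::real) < ln 2" by simp
  have L0: "0 < L" using L l2 by linarith
  have X0: "0 < X" using X by linarith
  have one: "1 \<le> X * L / (a * ln 2)"
    using mult_mono[OF X(2) L] X0 X l2 by (simp add: field_simps)
  have L1: "L \<le> X * L / a" using X L0 by (simp add: field_simps)
  have R1: "R \<le> X * L / (a * ln 2) * R" using mult_right_mono[OF one R] by simp
  have "P + 10 * Q \<le> (C\<^sub>P + 10 * C\<^sub>Q) * R" using P Q by (simp add: algebra_simps)
  also have "\<dots> \<le> (C\<^sub>P + 10 * C\<^sub>Q) * (X * L / (a * ln 2) * R)" using R1 c by (intro mult_left_mono) auto
  finally have 1: "P + 10 * Q \<le> (C\<^sub>P + 10 * C\<^sub>Q) / (a * ln 2) * X * L * R" by simp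
  have bQ: "b * Q \<le> b * (C\<^sub>Q * R)" using Q b by (intro mult_left_mono)
  have "4 * c1 * L * (b * Q) \<le> 4 * c1 * (X * L / a) * (b * (C\<^sub>Q * R))"
  proof (rule mult_mono[OF mult_left_mono[OF L1] bQ])
    show "0 \<le> 4 * c1 * (X * L / a)" using c X X0 L0 by simp
  qed (use c b Q in auto)
  hence 2: "4 * \<Lambda> * (b * Q) \<le> 4 * c1 * C\<^sub>Q / a * b * X * L * R" by (simp add: \<Lambda> mult_ac)
  have "5 * (b * Q) \<le> 5 * (b * (C\<^sub>Q * (X * L / (a * ln 2) * R)))"
    using bQ R1 b c by (intro mult_left_mono order_trans[OF bQ]) auto
  hence 3: "5 * (b * Q) \<le> 5 * C\<^sub>Q / (a * ln 2) * b * X * L * R" by (simp add: mult_ac)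
  have "10 * real m * Kb * (Dn * h) * \<Lambda> * (b * Q) \<le> 10 * real m * Kb * (c2 * X) * (c1 * L) * (b * (C\<^sub>Q * R))"
    unfolding Dh \<Lambda> by (rule mult_left_mono[OF bQ]) (use K c X0 L0 in simp)
  hence 4: "5 * (2 * real m * Kb * Dn * h * \<Lambda> * (b * Q)) \<le> 10 * real m * Kb * c2 * c1 * C\<^sub>Q * b * X * L * R"
    by (simp add: mult_ac)
  show ?thesis using 1 2 3 4 by (simp only: distrib_right distrib_left)
qed

section \<open>The error estimate\<close>

text \<open>
  The constants for the components of \<open>k\<close>, \<open>y\<close> and \<open>g\<close> are made uniform, and then the two Sinc estimates are
  applied to \<open>F\<close> and \<open>U\<close> for each \<open>n\<close>.
\<close>

lemma de_sinc_collocation_error: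
  fixes m :: nat and \<alpha> \<beta> d \<mu> :: real
    and k :: "nat \<Rightarrow> nat \<Rightarrow> complex \<Rightarrow> complex" and y g :: "nat \<Rightarrow> complex \<Rightarrow> complex"
    and r :: "nat \<Rightarrow> complex"
  assumes m: "0 < m" and ab: "0 < \<beta>" "0 < \<alpha>" "\<alpha> \<le> 1" and d: "0 < d" "d < pi / 2" and \<mu>: "\<mu> = min \<alpha> \<beta>"
    and ivp: "solves_ivp m k g r y"
    and k_hol: "\<And>i j. i < m \<Longrightarrow> j < m \<Longrightarrow> k i j analytic_on de_phi ` strip d"
    and k_bounded: "\<And>i j. i < m \<Longrightarrow> j < m \<Longrightarrow> bounded (k i j ` de_phi ` strip d)"
    and decay: "\<And>i. i < m \<Longrightarrow> de_decay \<alpha> \<beta> d (y i) \<and> de_decay \<alpha> \<beta> d (g i)"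
    and H: "H > 0"
    and left: "\<And>i z. i < m \<Longrightarrow> z \<in> de_phi ` strip d \<Longrightarrow> norm (y i z - r i) \<le> H * norm z powr \<alpha>"
    and right: "\<And>i z. i < m \<Longrightarrow> z \<in> de_phi ` strip d \<Longrightarrow> norm (y i z) \<le> H * norm (exp (- z)) powr \<beta>"
  obtains C C' where "C > 0" "C' > 0"
    "\<And>n i x. \<lbrakk>n \<ge> 1; invertible_mat (B_mat m k (de_h d \<mu> n) (de_M \<alpha> \<beta> d n) (de_N \<alpha> \<beta> d n)); i < m\<rbrakk> \<Longrightarrow>
       norm (y i (de_phi (of_real x)) - y_hat m k g r (de_h d \<mu> n) (de_M \<alpha> \<beta> d n) (de_N \<alpha> \<beta> d n) i (de_phi_real x))
       \<le> (C + C' * mat_max_norm (the (mat_inverse (B_mat m k (de_h d \<mu> n) (de_M \<alpha> \<beta> d n) (de_N \<alpha> \<beta> d n))))) *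
         arsinh (d * real n / \<mu>) * ln (real n + 1) * exp (- pi * d * real n / arsinh (d * real n / \<mu>))"
proof -
  note pos = ab(2,1) d(1)
  have \<mu>0: "\<mu> > 0" using ab by (simp add: \<mu>)
  have d2: "d \<le> pi / 2" using d by simp
  define \<gamma> where "\<gamma> = min \<alpha> \<beta> * cos d"
  have \<gamma>: "\<gamma> > 0" using ab d by (auto simp: \<gamma>_def intro!: mult_pos_pos cos_gt_zero_pi)
  obtain Kb where Kb: "Kb > 0" "\<And>i j z. i < m \<Longrightarrow> j < m \<Longrightarrow> z \<in> de_phi ` strip d \<Longrightarrow> norm (k i j z) \<le> Kb"
  proof -
    have "\<exists>K>0. \<forall>j<m. \<forall>z\<in>de_phi ` strip d. norm (k i j z) \<le> K" if i: "i < m" for i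
    proof -
      have "\<exists>K>0. \<forall>z\<in>de_phi ` strip d. norm (k i j z) \<le> K" if "j < m" for j
        using k_bounded[OF i that] by (auto simp: bounded_pos)
      thus ?thesis
        by (rule uniform_constant[where Pr="\<lambda>j K. \<forall>z\<in>de_phi ` strip d. norm (k i j z) \<le> K"])
           (meson order_trans)+
    qed
    hence "\<exists>K>0. \<forall>i<m. \<forall>j<m. \<forall>z\<in>de_phi ` strip d. norm (k i j z) \<le> K"
      by (rule uniform_constant[where Pr="\<lambda>i K. \<forall>j<m. \<forall>z\<in>de_phi ` strip d. norm (k i j z) \<le> K"])
         (meson order_trans)+
    thus ?thesis using that by blast
  qed
  define wt where "wt = (\<lambda>z. de_weight \<alpha> z * norm (exp (- z)) powr \<beta>)"
  have wt0: "wt z \<ge> 0" for z by (simp add: wt_def de_weight_def)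
  have yg_ex: "\<exists>C>0. \<forall>z\<in>de_phi ` strip d. norm (y i z) \<le> C * wt z \<and> norm (g i z) \<le> C * wt z" if i: "i < m" for i
  proof -
    obtain C1 where C1: "C1 > 0" "\<And>z. z \<in> de_phi ` strip d \<Longrightarrow> norm (y i z) \<le> C1 * wt z"
      using decay[OF i] unfolding de_decay_def wt_def by (auto simp: mult.assoc)
    obtain C2 where C2: "C2 > 0" "\<And>z. z \<in> de_phi ` strip d \<Longrightarrow> norm (g i z) \<le> C2 * wt z"
      using decay[OF i] unfolding de_decay_def wt_def by (auto simp: mult.assoc)
    show ?thesis
    proof (intro exI[of _ "C1 + C2"] conjI ballI)
      fix z assume z: "z \<in> de_phi ` strip d"
      have "C1 * wt z \<le> (C1 + C2) * wt z" "C2 * wt z \<le> (C1 + C2) * wt z"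
        using C1(1) C2(1) wt0[of z] by (auto intro!: mult_right_mono)
      thus "norm (y i z) \<le> (C1 + C2) * wt z" "norm (g i z) \<le> (C1 + C2) * wt z"
        using C1(2)[OF z] C2(2)[OF z] by linarith+
    qed (use C1 C2 in auto)
  qed
  obtain Cw where Cw: "Cw > 0" "\<And>i z. i < m \<Longrightarrow> z \<in> de_phi ` strip d \<Longrightarrow> norm (y i z) \<le> Cw * wt z \<and> norm (g i z) \<le> Cw * wt z"
  proof -
    have "\<forall>z\<in>de_phi ` strip d. norm (y i z) \<le> C' * wt z \<and> norm (g i z) \<le> C' * wt z"
      if a: "\<forall>z\<in>de_phi ` strip d. norm (y i z) \<le> C * wt z \<and> norm (g i z) \<le> C * wt z" and "C \<le> C'" for i C C'
    proof -
      have "C * wt z \<le> C' * wt z" for z using \<open>C \<le> C'\<close> wt0 by (rule mult_right_mono)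
      thus ?thesis using a by (meson order_trans)
    qed
    with yg_ex have "\<exists>C>0. \<forall>i<m. \<forall>z\<in>de_phi ` strip d. norm (y i z) \<le> C * wt z \<and> norm (g i z) \<le> C * wt z"
      by (rule uniform_constant[where Pr="\<lambda>i C. \<forall>z\<in>de_phi ` strip d. norm (y i z) \<le> C * wt z \<and> norm (g i z) \<le> C * wt z"])
    then obtain C where C: "C > 0"
      and bound: "\<forall>i<m. \<forall>z\<in>de_phi ` strip d. norm (y i z) \<le> C * wt z \<and> norm (g i z) \<le> C * wt z"
      by (elim exE conjE)
    show ?thesis by (rule that[OF C]) (rule bound[rule_format])
  qed
  obtain A0 where A0: "A0 > 0" "\<And>\<zeta>. \<zeta> \<in> strip d \<Longrightarrow> wt (de_phi \<zeta>) * norm (deriv de_phi \<zeta>) \<le> A0 * exp (- (2 * \<gamma> * \<bar>sinh (Re \<zeta>)\<bar>))"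
    using de_transformed_decay[OF d ab(2,3,1) \<gamma>_def] unfolding wt_def by blast
  define F where "F = (\<lambda>i \<zeta>. ((\<Sum>j<m. k i j (de_phi \<zeta>) * y j (de_phi \<zeta>)) + g i (de_phi \<zeta>)) * deriv de_phi \<zeta>)"
  define U where "U = (\<lambda>i \<zeta>. y i (de_phi \<zeta>) - r i / (1 + de_exp \<zeta>))"
  have y_hol: "y i analytic_on de_phi ` strip d" and g_hol: "g i analytic_on de_phi ` strip d" if "i < m" for i
    using decay[OF that] unfolding de_decay_def by blast+
  have deriv_hol: "deriv de_phi holomorphic_on strip d"
    using holomorphic_on_subset[OF holomorphic_de_phi strip_mono[OF d2]] open_strip by (intro holomorphic_deriv)
  have F_hol: "F i holomorphic_on strip d" if "i < m" for i
    unfolding F_def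
    by (intro holomorphic_on_mult holomorphic_on_add holomorphic_on_sum holomorphic_comp_de_phi[OF _ d2]
          deriv_hol g_hol that) (use that k_hol y_hol in auto)
  have U_hol: "U i holomorphic_on strip d" if "i < m" for i
  proof -
    have "1 + de_exp \<zeta> \<noteq> 0" if "\<zeta> \<in> strip d" for \<zeta>
      unfolding de_exp_def using one_plus_exp_sinh_nonzero[of \<zeta>] that strip_mono[OF d2] by blast
    thus ?thesis unfolding U_def
      by (intro holomorphic_on_diff holomorphic_on_divide holomorphic_on_add holomorphic_on_const
            holomorphic_comp_de_phi[OF y_hol[OF that] d2] holomorphic_de_exp)
  qed
  define AF where "AF = (real m * Kb + 1) * Cw * A0"
  have AF: "AF > 0" using Kb Cw A0 by (auto simp: AF_def intro!: mult_pos_pos add_nonneg_pos)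
  have F_decay: "norm (F i \<zeta>) \<le> AF * exp (- (2 * \<gamma> * \<bar>sinh (Re \<zeta>)\<bar>))" if i: "i < m" and \<zeta>: "\<zeta> \<in> strip d" for i \<zeta>
  proof -
    define z where "z = de_phi \<zeta>"
    have z: "z \<in> de_phi ` strip d" using \<zeta> by (simp add: z_def)
    have "norm (\<Sum>j<m. k i j z * y j z) \<le> (\<Sum>j<m. Kb * (Cw * wt z))"
      using Kb(1) Kb(2)[OF i _ z] Cw(2)[OF _ z]
      by (intro order_trans[OF norm_sum sum_mono]) (auto simp: norm_mult intro!: mult_mono)
    hence "norm ((\<Sum>j<m. k i j z * y j z) + g i z) \<le> real m * (Kb * (Cw * wt z)) + Cw * wt z"
      using Cw(2)[OF i z] by (intro order_trans[OF norm_triangle_ineq] add_mono) auto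
    also have "\<dots> = (real m * Kb + 1) * Cw * wt z" by (simp add: algebra_simps)
    finally have "norm (F i \<zeta>) \<le> (real m * Kb + 1) * Cw * wt z * norm (deriv de_phi \<zeta>)"
      unfolding F_def norm_mult z_def[symmetric] by (intro mult_right_mono) auto
    also have "\<dots> = (real m * Kb + 1) * Cw * (wt z * norm (deriv de_phi \<zeta>))" by (simp only: mult.assoc)
    also have "\<dots> \<le> (real m * Kb + 1) * Cw * (A0 * exp (- (2 * \<gamma> * \<bar>sinh (Re \<zeta>)\<bar>)))"
      using A0(2)[OF \<zeta>] Kb(1) Cw(1) unfolding z_def by (intro mult_left_mono) auto
    finally show ?thesis by (simp only: AF_def mult.assoc)
  qed
  obtain AU where AU: "AU > 0" "\<And>i \<zeta>. i < m \<Longrightarrow> \<zeta> \<in> strip d \<Longrightarrow> norm (U i \<zeta>) \<le> AU * exp (- (2 * \<gamma> * \<bar>sinh (Re \<zeta>)\<bar>))"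
  proof -
    have "\<exists>A>0. \<forall>\<zeta>\<in>strip d. norm (U i \<zeta>) \<le> A * exp (- (2 * \<gamma> * \<bar>sinh (Re \<zeta>)\<bar>))" if i: "i < m" for i
    proof -
      obtain A where "A > 0" "\<And>\<zeta>. \<zeta> \<in> strip d \<Longrightarrow> norm (y i (de_phi \<zeta>) - r i / (1 + de_exp \<zeta>)) \<le> A * exp (- (2 * \<gamma> * \<bar>sinh (Re \<zeta>)\<bar>))"
        using de_interpolant_decay[OF d ab(2,3,1) \<gamma>_def H left[OF i] right[OF i]] by blast
      thus ?thesis by (auto simp: U_def)
    qed
    moreover have "\<forall>\<zeta>\<in>strip d. norm (U i \<zeta>) \<le> A' * exp (- (2 * \<gamma> * \<bar>sinh (Re \<zeta>)\<bar>))"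
      if a: "\<forall>\<zeta>\<in>strip d. norm (U i \<zeta>) \<le> A * exp (- (2 * \<gamma> * \<bar>sinh (Re \<zeta>)\<bar>))" and "A \<le> A'" for i A A'
    proof -
      have "A * exp (- (2 * \<gamma> * \<bar>sinh (Re \<zeta>)\<bar>)) \<le> A' * exp (- (2 * \<gamma> * \<bar>sinh (Re \<zeta>)\<bar>))" for \<zeta>
        using \<open>A \<le> A'\<close> by (rule mult_right_mono) simp
      thus ?thesis using a by (meson order_trans)
    qed
    ultimately have "\<exists>A>0. \<forall>i<m. \<forall>\<zeta>\<in>strip d. norm (U i \<zeta>) \<le> A * exp (- (2 * \<gamma> * \<bar>sinh (Re \<zeta>)\<bar>))"
      by (rule uniform_constant[where Pr="\<lambda>i A. \<forall>\<zeta>\<in>strip d. norm (U i \<zeta>) \<le> A * exp (- (2 * \<gamma> * \<bar>sinh (Re \<zeta>)\<bar>))"])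
    then obtain A where "A > 0" "\<forall>i<m. \<forall>\<zeta>\<in>strip d. norm (U i \<zeta>) \<le> A * exp (- (2 * \<gamma> * \<bar>sinh (Re \<zeta>)\<bar>))"
      by blast
    thus ?thesis by (intro that[of A]) auto
  qed
  have real_strip: "complex_of_real x \<in> strip d" for x using d by (simp add: strip_def)
  obtain B where B: "\<And>u. \<bar>Si u\<bar> \<le> B" using bounded_Si by blast
  have B0: "B \<ge> 0" using B[of 0] by simp
  define A where "A = max AF AU"
  have A: "A > 0" using AF by (simp add: A_def)
  have dec: "norm (F i z) \<le> A * exp (- (2 * \<gamma> * \<bar>sinh (Re z)\<bar>))" "norm (U i z) \<le> A * exp (- (2 * \<gamma> * \<bar>sinh (Re z)\<bar>))"
    if "i < m" "z \<in> strip d" for i z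
  proof -
    have "AF * exp (- (2 * \<gamma> * \<bar>sinh (Re z)\<bar>)) \<le> A * exp (- (2 * \<gamma> * \<bar>sinh (Re z)\<bar>))"
      "AU * exp (- (2 * \<gamma> * \<bar>sinh (Re z)\<bar>)) \<le> A * exp (- (2 * \<gamma> * \<bar>sinh (Re z)\<bar>))"
      unfolding A_def by (intro mult_right_mono; simp)+
    thus "norm (F i z) \<le> A * exp (- (2 * \<gamma> * \<bar>sinh (Re z)\<bar>))" "norm (U i z) \<le> A * exp (- (2 * \<gamma> * \<bar>sinh (Re z)\<bar>))"
      using F_decay[OF that] AU(2)[OF that] by linarith+
  qed
  define A' where "A' = A * (1 + 1 / \<gamma>\<^sup>2) + 2 * A"
  have A': "A' > 0" using A \<gamma> by (auto simp: A'_def intro!: add_pos_pos mult_pos_pos)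
  obtain CR where CR: "CR > 0" "\<And>n. n \<ge> 1 \<Longrightarrow>
     A' / (d * sinh (pi * d / de_h d \<mu> n)) + A' * exp (- (\<gamma> * (d * real n / max \<alpha> \<beta>))) * (1 + 1 / (\<gamma> * de_h d \<mu> n))
     \<le> CR * exp (- pi * d * real n / arsinh (d * real n / \<mu>))"
    using sinc_error_bound_le_de_rate[OF pos \<gamma> A' \<mu>] by blast
  define CQ where "CQ = (2 + B) * (d / \<mu>) * CR"
  have CQ: "CQ > 0" using B0 d \<mu>0 CR by (auto simp: CQ_def)
  define c1 where "c1 = 4 + 1 / ln (2::real)"
  define c2 where "c2 = pi * ((2 * d / \<mu> + 1) * exp (d / \<mu>))"
  have c: "c1 > 0" "c2 > 0" using d \<mu>0 by (auto simp: c1_def c2_def intro!: add_pos_pos mult_pos_pos)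
  define a where "a = arsinh (d / \<mu>)"
  have a: "a > 0" using d \<mu>0 by (simp add: a_def)
  have l2: "ln (2::real) > 0" by simp
  show ?thesis
  proof (rule that[of "(CR + 10 * CQ) / (a * ln 2)" "4 * c1 * CQ / a + 5 * CQ / (a * ln 2) + 10 * real m * Kb * c2 * c1 * CQ"])
    show "(CR + 10 * CQ) / (a * ln 2) > 0" using CR(1) CQ a l2 by (auto intro!: divide_pos_pos add_pos_pos)
    show "4 * c1 * CQ / a + 5 * CQ / (a * ln 2) + 10 * real m * Kb * c2 * c1 * CQ > 0"
      using c CQ a l2 Kb(1) by (intro add_pos_nonneg add_pos_pos divide_pos_pos mult_pos_pos mult_nonneg_nonneg) auto
    fix n i :: nat and x :: real
    assume n: "n \<ge> 1" and i: "i < m"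
    define h M N where "h = de_h d \<mu> n" and "M = de_M \<alpha> \<beta> d n" and "N = de_N \<alpha> \<beta> d n"
    assume "invertible_mat (B_mat m k (de_h d \<mu> n) (de_M \<alpha> \<beta> d n) (de_N \<alpha> \<beta> d n))"
    hence inv: "invertible_mat (B_mat m k h M N)" by (simp add: h_def M_def N_def)
    define R where "R = exp (- pi * d * real n / arsinh (d * real n / \<mu>))"
    define X where "X = arsinh (d * real n / \<mu>)"
    define b where "b = mat_max_norm (the (mat_inverse (B_mat m k h M N)))"
    have h: "h > 0" "h \<le> d / \<mu>" "real n * h = X"
      using de_h_pos[OF pos n] de_h_le[OF pos n] de_h_times[OF pos n] by (simp_all add: h_def X_def \<mu>)
    \<comment> \<open>A lower bound for \<open>sinh\<close> at both truncation points.\<close>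
  define S where "S = d * real n / max \<alpha> \<beta>"
    have S: "S \<le> sinh (real M * h)" "S \<le> sinh (real N * h)"
    proof -
      have "S \<le> d * real n / \<alpha>" "S \<le> d * real n / \<beta>" unfolding S_def using ab d by (auto intro!: divide_left_mono)
      thus "S \<le> sinh (real M * h)" "S \<le> sinh (real N * h)"
        using sinh_de_M_ge[OF pos n] sinh_de_N_ge[OF pos n] by (simp_all add: h_def M_def N_def \<mu>)
    qed
    define E where "E = A' / (d * sinh (pi * d / h)) + A' * exp (- (\<gamma> * S)) * (1 + 1 / (\<gamma> * h))"
    have E: "E \<le> CR * R" using CR(2)[OF n] by (simp only: E_def R_def S_def h_def)
    have E0: "E \<ge> 0" unfolding E_def using A' d h \<gamma> by (intro add_nonneg_nonneg) auto
    have lims: "((\<lambda>x. y i (de_phi (of_real x))) \<longlongrightarrow> 0) at_top" "((\<lambda>x. y i (de_phi (of_real x))) \<longlongrightarrow> r i) at_bot" if "i < m" for i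
      using interpolant_limits[OF \<gamma> less_imp_le[OF AU(1)], of "y i" "r i"] AU(2)[OF that real_strip]
      by (auto simp: U_def)
    have node: "de_node h j = de_phi (of_real (of_int j * h))" "de_node_deriv h j = deriv de_phi (of_real (of_int j * h))" for j
      by (simp_all add: de_node_def de_node_deriv_def)
    have Qb: "norm (y i (de_phi (of_real x)) - r i - (\<Sum>j\<in>{- int M..int N}.
        ((\<Sum>q<m. k i q (de_node h j) * y q (de_node h j)) + g i (de_node h j)) * de_node_deriv h j *
        of_real (h * (1 / 2 + 1 / pi * Si (pi * (x - of_int j * h) / h))))) \<le> CQ * R" if "i < m" for i x
    proof -
      have "norm (y i (de_phi (of_real x)) - r i - (\<Sum>j\<in>{- int M..int N}. F i (of_real (of_int j * h)) *
        of_real (h * (1 / 2 + 1 / pi * Si (pi * (x - of_int j * h) / h))))) \<le> (2 + B) * h * E"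
        unfolding E_def
      proof (rule sinc_errors_double_exp(2)[OF F_hol[OF that] d(1) h(1) \<gamma> A dec(1)[OF that] S A'_def])
        show "((\<lambda>x. y i (de_phi (of_real x))) has_vector_derivative F i (of_real s)) (at s)" for s
          unfolding F_def by (rule solves_ivp_transformed[OF ivp that])
      qed (auto simp: lims that B)
      also have "\<dots> \<le> (2 + B) * (d / \<mu>) * (CR * R)"
        using h E E0 B0 d \<mu>0 by (intro mult_mono) auto
      finally show ?thesis unfolding F_def node by (simp only: CQ_def mult.assoc)
    qed
    have Pb: "norm ((y i (de_phi (of_real x)) - r i / (1 + de_exp (of_real x))) - (\<Sum>j\<in>{- int M..int N}.
        (y i (de_node h j) - r i / (1 + de_exp (of_real (of_int j * h)))) * of_real (sinc_basis j h x))) \<le> CR * R" if "i < m" for i x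
    proof -
      have "norm (U i (of_real x) - (\<Sum>j\<in>{- int M..int N}. U i (of_real (of_int j * h)) * of_real (sinc_basis j h x))) \<le> E"
        unfolding E_def
        by (rule sinc_errors_double_exp(1)[OF U_hol[OF that] d(1) h(1) \<gamma> A dec(2)[OF that] S A'_def])
      thus ?thesis using E unfolding U_def node by linarith
    qed
    have kb: "norm (k i j (de_phi (of_real x))) \<le> Kb" if "i < m" "j < m" for i j x
      using Kb(2)[OF that] real_strip by blast
    have Dnb: "norm (de_node_deriv h j) \<le> c2 * real n" if "j \<in> {- int M..int N}" for j
      using de_node_deriv_bound[OF pos n \<mu>] that by (simp only: h_def M_def N_def c2_def)
    have Lb: "harm (M + N + 1) \<le> c1 * ln (real n + 1)"
      unfolding c1_def using de_M_le[OF pos n] de_N_le[OF pos n] by (intro harm_nodes_le[OF pos n]) (simp add: M_def N_def)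
    have b0: "b \<ge> 0"
      unfolding b_def using mat_inverse_of_invertible(3)[OF B_mat_carrier[OF m] inv] m
      by (intro vec_max_norm_mult_le(2)[of _ "m * (M + N + 1)" "0\<^sub>v (m * (M + N + 1))"]) auto
    have "norm (y i (de_phi (of_real x)) - y_hat m k g r h M N i (de_phi_real x))
       \<le> CR * R + 4 * (c1 * ln (real n + 1)) * (b * (CQ * R)) + 5 * (2 * (CQ * R) + b * (CQ * R) +
          2 * real m * Kb * (c2 * real n) * h * (c1 * ln (real n + 1)) * (b * (CQ * R)))"
      unfolding b_def
      by (rule collocation_error_at_point[OF m h(1) inv kb Dnb Lb Qb lims(1) Pb i])
    also have "\<dots> \<le> ((CR + 10 * CQ) / (a * ln 2) + (4 * c1 * CQ / a + 5 * CQ / (a * ln 2) + 10 * real m * Kb * c2 * c1 * CQ) * b)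
        * X * ln (real n + 1) * R"
    proof (rule combine_error_terms)
      show "c2 * real n * h = c2 * X" using h(3) by (simp add: mult.assoc)
      show "a \<le> X" using arsinh_de_ge[OF pos n] by (simp add: a_def X_def \<mu>)
      show "ln 2 \<le> ln (real n + 1)" using n by simp
    qed (use b0 Kb(1) c CR(1) CQ a in \<open>auto simp: R_def\<close>)
    finally show "norm (y i (de_phi (of_real x)) - y_hat m k g r (de_h d \<mu> n) (de_M \<alpha> \<beta> d n) (de_N \<alpha> \<beta> d n) i (de_phi_real x))
       \<le> ((CR + 10 * CQ) / (a * ln 2) + (4 * c1 * CQ / a + 5 * CQ / (a * ln 2) + 10 * real m * Kb * c2 * c1 * CQ) *
           mat_max_norm (the (mat_inverse (B_mat m k (de_h d \<mu> n) (de_M \<alpha> \<beta> d n) (de_N \<alpha> \<beta> d n))))) *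
         arsinh (d * real n / \<mu>) * ln (real n + 1) * exp (- pi * d * real n / arsinh (d * real n / \<mu>))"
      unfolding b_def X_def R_def h_def M_def N_def .
  qed
qed

theorem theorem4p2:
  fixes m :: nat and \<alpha> \<beta> d \<mu> :: real
    and k :: "nat \<Rightarrow> nat \<Rightarrow> complex \<Rightarrow> complex"
    and y g :: "nat \<Rightarrow> complex \<Rightarrow> complex"
    and r :: "nat \<Rightarrow> complex"
    and h :: "nat \<Rightarrow> real" and M N :: "nat \<Rightarrow> nat"
    and B :: "nat \<Rightarrow> complex mat"
  defines "\<mu> \<equiv> min \<alpha> \<beta>"
    and "h \<equiv> de_h d \<mu>"
    and "M \<equiv> de_M \<alpha> \<beta> d"
    and "N \<equiv> de_N \<alpha> \<beta> d"
    and "B \<equiv> (\<lambda>n. B_mat m k (h n) (M n) (N n))"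
  assumes "0 < m" and "0 < \<beta>" and "0 < \<alpha>" and "\<alpha> \<le> 1" and "0 < d" and "d < pi / 2"
    and ivp: "solves_ivp m k g r y"
    and k_bounded: "\<And>i j. i < m \<Longrightarrow> j < m \<Longrightarrow>
      k i j analytic_on de_phi ` strip d \<and> bounded (k i j ` de_phi ` strip d)"
    and decay: "\<And>i. i < m \<Longrightarrow> de_decay \<alpha> \<beta> d (y i) \<and> de_decay \<alpha> \<beta> d (g i)"
    and y_bounds: "\<exists>H>0. \<forall>z\<in>de_phi ` strip d.
      (MAX i\<in>{..<m}. cmod (y i z - r i)) \<le> H * cmod z powr \<alpha> \<and>
      (MAX i\<in>{..<m}. cmod (y i z)) \<le> H * cmod (exp (- z)) powr \<beta>"
  shows "\<exists>C>0. \<exists>C'>0. \<forall>n\<ge>1. invertible_mat (B n) \<longrightarrow>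
    (MAX i\<in>{..<m}. SUP t\<in>{0<..}.
       ereal (cmod (y i (of_real t) - y_hat m k g r (h n) (M n) (N n) i t)))
    \<le> ereal ((C + C' * mat_max_norm (the (mat_inverse (B n)))) *
        arsinh (d * real n / \<mu>) * ln (real n + 1) * exp (- pi * d * real n / arsinh (d * real n / \<mu>)))"
proof -
  obtain H where H: "H > 0" and Hz: "\<And>z. z \<in> de_phi ` strip d \<Longrightarrow>
      (MAX i\<in>{..<m}. cmod (y i z - r i)) \<le> H * cmod z powr \<alpha> \<and>
      (MAX i\<in>{..<m}. cmod (y i z)) \<le> H * cmod (exp (- z)) powr \<beta>"
    using y_bounds by blast
  have le_Max: "f i \<le> (MAX i\<in>{..<m}. f i)" if "i < m" for i and f :: "nat \<Rightarrow> real"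
    using that by (intro Max_ge) auto
  have left: "norm (y i z - r i) \<le> H * norm z powr \<alpha>" and right: "norm (y i z) \<le> H * norm (exp (- z)) powr \<beta>"
    if "i < m" "z \<in> de_phi ` strip d" for i z
    using Hz[OF that(2)] le_Max[OF that(1), of "\<lambda>i. cmod (y i z - r i)"] le_Max[OF that(1), of "\<lambda>i. cmod (y i z)"] by linarith+
  have \<mu>: "\<mu> = min \<alpha> \<beta>" by (simp add: \<mu>_def)
  have k_hol: "k i j analytic_on de_phi ` strip d" and k_bdd: "bounded (k i j ` de_phi ` strip d)"
    if "i < m" "j < m" for i j
    using k_bounded[OF that] by blast+
  obtain C C' where C: "C > 0" "C' > 0" and err: "\<And>n i x. \<lbrakk>n \<ge> 1; invertible_mat (B_mat m k (h n) (M n) (N n)); i < m\<rbrakk> \<Longrightarrow>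
       norm (y i (de_phi (of_real x)) - y_hat m k g r (h n) (M n) (N n) i (de_phi_real x))
       \<le> (C + C' * mat_max_norm (the (mat_inverse (B_mat m k (h n) (M n) (N n))))) *
         arsinh (d * real n / \<mu>) * ln (real n + 1) * exp (- pi * d * real n / arsinh (d * real n / \<mu>))"
    unfolding h_def M_def N_def
    using de_sinc_collocation_error[OF assms(6-11) \<mu> ivp k_hol k_bdd decay H left right] by blast
  show ?thesis
  proof (rule exI[of _ C], intro exI[of _ C'] conjI C allI impI)
    fix n :: nat assume n: "1 \<le> n" and inv: "invertible_mat (B n)"
    show "(MAX i\<in>{..<m}. SUP t\<in>{0<..}. ereal (cmod (y i (of_real t) - y_hat m k g r (h n) (M n) (N n) i t)))
      \<le> ereal ((C + C' * mat_max_norm (the (mat_inverse (B n)))) *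
        arsinh (d * real n / \<mu>) * ln (real n + 1) * exp (- pi * d * real n / arsinh (d * real n / \<mu>)))"
    proof (subst Max_le_iff; (intro ballI)?)
      fix s assume "s \<in> (\<lambda>i. SUP t\<in>{0<..}. ereal (cmod (y i (of_real t) - y_hat m k g r (h n) (M n) (N n) i t))) ` {..<m}"
      then obtain i where i: "i < m" and s: "s = (SUP t\<in>{0<..}. ereal (cmod (y i (of_real t) - y_hat m k g r (h n) (M n) (N n) i t)))"
        by auto
      show "s \<le> ereal ((C + C' * mat_max_norm (the (mat_inverse (B n)))) *
        arsinh (d * real n / \<mu>) * ln (real n + 1) * exp (- pi * d * real n / arsinh (d * real n / \<mu>)))"
        unfolding s
      proof (rule SUP_least)
        fix t :: real assume "t \<in> {0<..}"
        then obtain x where x: "t = de_phi_real x"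
          using bij_betw_de_phi_real unfolding bij_betw_def by auto
        show "ereal (cmod (y i (of_real t) - y_hat m k g r (h n) (M n) (N n) i t))
          \<le> ereal ((C + C' * mat_max_norm (the (mat_inverse (B n)))) *
            arsinh (d * real n / \<mu>) * ln (real n + 1) * exp (- pi * d * real n / arsinh (d * real n / \<mu>)))"
          using err[OF n inv[unfolded B_def] i, of x] unfolding x of_real_de_phi_real by (simp add: B_def)
      qed
    qed (use \<open>0 < m\<close> in auto)
  qed
qed

end
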